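(* Assume $[\![\Gamma]\!]$ is a non-empty set and let $\gamma \in [\![\Gamma]\!]$. 1. If $t_1 =_\beta t_2$, and $\Gamma \vdash t_1 : T$ and $\Gamma \vdash t_2 : T$ are derivable, then $[\![\Gamma \vdash t_1]\!](\gamma) = [\![\Gamma \vdash t_2]\!](\gamma)$. 2. If $\Gamma \vdash t : T$ is derivable, then $[\![\Gamma \vdash t]\!](\gamma) \in [\![\Gamma \vdash T]\!](\gamma)$.
   Context: Type system: ECC without strong sums (sorts $\mathrm{Prop}$, $\mathrm{Type}_i$), with two restrictions: the Prop–Prop case of the PI-Type rule only allows $\forall x:P.Q : \mathrm{Prop}$ when $x$ does not occur in $Q$, and there is no subtyping rule from $\mathrm{Prop}$ to $\mathrm{Type}$. A propositional term for $\Gamma$ is $P$ with $\Gamma \vdash P : \mathrm{Prop}$; a proof term for $\Gamma$ is $t$ with $\Gamma \vdash t : P$ for some propositional term $P$. Model: fix a topological space $(X,\mathcal{O}(X))$ and a reference point $p \in X$ satisfying the point condition: $\bigcap\{U \in \mathcal{O}(X) \mid p \in U\}$ is open. $\mathcal{O}(X)$ is a complete Heyting algebra ordered by inclusion: for a family $S$ of open sets, its meet is the interior $(\bigcap S)^\circ$ of the intersection (equal to $X$ when $S=\emptyset$), joins are unions, and the exponential is $b^a := \bigcup\{t \in \mathcal{O}(X) \mid t \cap a \subseteq b\}$. $\mathscr{U}(i) = V_{\lambda_i}$ is the Grothendieck universe at the $i$-th inaccessible cardinal $\lambda_i$. Interpretation (mutual recursion): strict interpretation $[\![\Gamma \vdash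 A]\!]'(\gamma) = [\![\Gamma \vdash A]\!](\gamma) \cap \{p\}$ if $A$ is a propositional term for $\Gamma$, else $[\![\Gamma \vdash A]\!](\gamma)$. Contexts: $[\![\,[]\,]\!] = \{()\}$, $[\![\Gamma;(x:A)]\!] = \{(\gamma,\alpha) \mid \gamma \in [\![\Gamma]\!], \alpha \in [\![\Gamma \vdash A]\!]'(\gamma)\}$. Judgments: if $t$ is a proof term for $\Gamma$ then $[\![\Gamma \vdash t]\!](\gamma) = p$; otherwise $[\![\Gamma \vdash \mathrm{Type}_i]\!](\gamma) = \mathscr{U}(i)$, $[\![\Gamma \vdash \mathrm{Prop}]\!](\gamma) = \mathcal{O}(X)$; $[\![\Gamma \vdash \forall x:P.Q]\!](\gamma)$ is $([\![\Gamma \vdash Q]\!](\gamma))^{[\![\Gamma \vdash P]\!](\gamma)}$ when $P$ and $Q$ are both propositional terms for $\Gamma$; is $\bigl(\bigcap\{[\![\Gamma;(x:P) \vdash Q]\!](\gamma,\alpha) \mid \alpha \in [\![\Gamma \vdash P]\!](\gamma)\}\bigr)^\circ$ (taken to be $X$ if the family is empty) when $P$ is not a propositional term for $\Gamma$ and $Q$ is a propositional term for $\Gamma;(x:P)$; and is the set-theoretic dependent function space $\prod_{\alpha \in [\![\Gamma \vdash P]\!]'(\gamma)} [\![\Gamma;(x:P) \vdash Q]\!](\gamma,\alpha)$ otherwise. $[\![\Gamma \vdash \lambda x:A.t]\!](\gamma) = \{(\alpha, [\![\Gamma;(x:A) \vdash t]\!](\gamma,\alpha)) \mid \alpha \in [\![\Gamma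 \vdash A]\!]'(\gamma)\}$, $[\![\Gamma \vdash u\,v]\!](\gamma) = [\![\Gamma \vdash u]\!](\gamma)([\![\Gamma \vdash v]\!](\gamma))$, $[\![\Gamma \vdash x_i]\!](\gamma) = \gamma_i$.
   Formalization: The space X is assumed to lie in the universe U(0), which part 2 forces through Prop : Type_0; products ∀x:P.B of a type family B over a proposition P are not formed, following ECC's product rules without Prop ≤ Type. *)

theory Defs
  imports "HOL-Analysis.Abstract_Topology" "HOL-Library.Equipollence"
begin

section \<open>The ambient set theory\<close>

text \<open>
  The model lives in ZFC with inaccessible cardinals, which cannot be constructed in HOL. A type of
  class \<open>zfc\<close> is a universe of sets: \<open>elts x\<close> is the HOL set of members of the set \<open>x\<close>. Separation and
  replacement range over arbitrary HOL predicates and functions, and choice for members of the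
  universe follows from choice in HOL.
\<close>

class zfc =
  fixes elts :: "'a \<Rightarrow> 'a set"
  assumes extensionality: "elts x = elts y \<Longrightarrow> x = y"
    and foundation: "wf {(x, y). x \<in> elts y}"
    and separation: "\<exists>y. elts y = {z \<in> elts x. P z}"
    and replacement: "\<exists>y. elts y = f ` elts x"
    and pairing: "\<exists>z. elts z = {x, y}"
    and union: "\<exists>y. elts y = (\<Union>z\<in>elts x. elts z)"
    and powerset: "\<exists>y. elts y = {z. elts z \<subseteq> elts x}"
    and infinity: "\<exists>w. (\<exists>e\<in>elts w. elts e = {}) \<and>
                       (\<forall>x\<in>elts w. \<exists>y\<in>elts w. elts y = insert x (elts x))"

text \<open>\<open>VSet A\<close> is the set with members \<open>A\<close>; it is meaningful only when \<open>A\<close> is not a proper class.\<close>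

definition VSet :: "'v::zfc set \<Rightarrow> 'v" where
  "VSet A = (THE x. elts x = A)"

definition vpair :: "'v::zfc \<Rightarrow> 'v \<Rightarrow> 'v" where
  "vpair a b = VSet {VSet {a}, VSet {a, b}}"

definition vapp :: "'v::zfc \<Rightarrow> 'v \<Rightarrow> 'v" where
  "vapp f a = (THE b. vpair a b \<in> elts f)"

definition vlam :: "'v::zfc set \<Rightarrow> ('v \<Rightarrow> 'v) \<Rightarrow> 'v" where
  "vlam D f = VSet ((\<lambda>a. vpair a (f a)) ` D)"

definition vPi :: "'v::zfc set \<Rightarrow> ('v \<Rightarrow> 'v) \<Rightarrow> 'v" where
  "vPi D B = VSet {f. elts f \<subseteq> {vpair a b | a b. a \<in> D \<and> b \<in> elts (B a)} \<and>
                      (\<forall>a\<in>D. \<exists>!b. vpair a b \<in> elts f)}"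

definition transitive_set :: "'v::zfc \<Rightarrow> bool" where
  "transitive_set x \<longleftrightarrow> (\<forall>y\<in>elts x. elts y \<subseteq> elts x)"

definition ordinal :: "'v::zfc \<Rightarrow> bool" where
  "ordinal x \<longleftrightarrow> transitive_set x \<and> (\<forall>y\<in>elts x. transitive_set y)"

text \<open>
  Uncountable, regular, strong limit. Regularity says that no function from a smaller ordinal is
  unbounded in \<open>\<kappa>\<close>; this already forces \<open>\<kappa>\<close> to be a cardinal.
\<close>

definition inaccessible :: "'v::zfc \<Rightarrow> bool" where
  "inaccessible \<kappa> \<longleftrightarrow> ordinal \<kappa> \<and> uncountable (elts \<kappa>) \<and>
     (\<forall>\<alpha>\<in>elts \<kappa>. \<forall>f. f ` elts \<alpha> \<subseteq> elts \<kappa> \<longrightarrow> (\<exists>\<beta>\<in>elts \<kappa>. f ` elts \<alpha> \<subseteq> elts \<beta>)) \<and>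
     (\<forall>\<alpha>\<in>elts \<kappa>. Pow (elts \<alpha>) \<prec> elts \<kappa>)"

text \<open>\<open>inacc i\<close> is the \<open>i\<close>-th inaccessible cardinal, counted from 0.\<close>

definition inacc :: "nat \<Rightarrow> 'v::zfc" where
  "inacc i = (THE \<kappa>. inaccessible \<kappa> \<and> finite {\<mu> \<in> elts \<kappa>. inaccessible \<mu>} \<and>
                     card {\<mu> \<in> elts \<kappa>. inaccessible \<mu>} = i)"

function Vlevel :: "'v::zfc \<Rightarrow> 'v" where
  "Vlevel \<alpha> = VSet (\<Union>\<beta>\<in>elts \<alpha>. {x. elts x \<subseteq> elts (Vlevel \<beta>)})"
  by auto
termination
  by (relation "{(x, y). x \<in> elts y}") (auto simp: foundation)

definition Guniv :: "nat \<Rightarrow> 'v::zfc" where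
  "Guniv i = Vlevel (inacc i)"


section \<open>Terms\<close>

text \<open>De Bruijn indices: \<open>All A B\<close> and \<open>Lam A t\<close> bind index 0 in their second argument.\<close>

datatype tm = Prop | Type nat | Var nat | All tm tm | Lam tm tm | App tm tm

fun lift :: "nat \<Rightarrow> nat \<Rightarrow> tm \<Rightarrow> tm" where
  "lift n k Prop = Prop"
| "lift n k (Type i) = Type i"
| "lift n k (Var i) = Var (if i < k then i else i + n)"
| "lift n k (All A B) = All (lift n k A) (lift n (Suc k) B)"
| "lift n k (Lam A t) = Lam (lift n k A) (lift n (Suc k) t)"
| "lift n k (App u v) = App (lift n k u) (lift n k v)"

text \<open>\<open>subst s k t\<close> is \<open>t\<close> with \<open>s\<close> for index \<open>k\<close>, which is removed from the context.\<close>

fun subst :: "tm \<Rightarrow> nat \<Rightarrow> tm \<Rightarrow> tm" where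
  "subst s k Prop = Prop"
| "subst s k (Type i) = Type i"
| "subst s k (Var i) = (if i < k then Var i else if i = k then lift k 0 s else Var (i - 1))"
| "subst s k (All A B) = All (subst s k A) (subst s (Suc k) B)"
| "subst s k (Lam A t) = Lam (subst s k A) (subst s (Suc k) t)"
| "subst s k (App u v) = App (subst s k u) (subst s k v)"

fun occurs :: "nat \<Rightarrow> tm \<Rightarrow> bool" where
  "occurs k Prop \<longleftrightarrow> False"
| "occurs k (Type i) \<longleftrightarrow> False"
| "occurs k (Var i) \<longleftrightarrow> i = k"
| "occurs k (All A B) \<longleftrightarrow> occurs k A \<or> occurs (Suc k) B"
| "occurs k (Lam A t) \<longleftrightarrow> occurs k A \<or> occurs (Suc k) t"
| "occurs k (App u v) \<longleftrightarrow> occurs k u \<or> occurs k v"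

text \<open>
  Inverse of \<open>lift 1 k\<close>: if \<open>\<not> occurs 0 Q\<close>, then \<open>lower 0 Q\<close> is the term \<open>Q\<close> read in the context
  without the variable of index 0.
\<close>

fun lower :: "nat \<Rightarrow> tm \<Rightarrow> tm" where
  "lower k Prop = Prop"
| "lower k (Type i) = Type i"
| "lower k (Var i) = Var (if i < k then i else i - 1)"
| "lower k (All A B) = All (lower k A) (lower (Suc k) B)"
| "lower k (Lam A t) = Lam (lower k A) (lower (Suc k) t)"
| "lower k (App u v) = App (lower k u) (lower k v)"

lemma size_lower [simp]: "size (lower k t) = size t"
  by (induction t arbitrary: k) auto

inductive beta :: "tm \<Rightarrow> tm \<Rightarrow> bool" where
  beta_redex: "beta (App (Lam A t) v) (subst v 0 t)"
| beta_All1: "beta A A' \<Longrightarrow> beta (All A B) (All A' B)"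
| beta_All2: "beta B B' \<Longrightarrow> beta (All A B) (All A B')"
| beta_Lam1: "beta A A' \<Longrightarrow> beta (Lam A t) (Lam A' t)"
| beta_Lam2: "beta t t' \<Longrightarrow> beta (Lam A t) (Lam A t')"
| beta_App1: "beta u u' \<Longrightarrow> beta (App u v) (App u' v)"
| beta_App2: "beta v v' \<Longrightarrow> beta (App u v) (App u v')"

definition beta_eq :: "tm \<Rightarrow> tm \<Rightarrow> bool"  (infix "=\<^sub>\<beta>" 50) where
  "t =\<^sub>\<beta> u \<longleftrightarrow> (symclp beta)\<^sup>*\<^sup>* t u"


section \<open>Typing\<close>

text \<open>Cumulativity of ECC, without the step from \<open>Prop\<close> to \<open>Type 0\<close>.\<close>

inductive cumul :: "tm \<Rightarrow> tm \<Rightarrow> bool"  (infix "\<preceq>" 50) where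
  cumul_conv: "A =\<^sub>\<beta> B \<Longrightarrow> A \<preceq> B"
| cumul_trans: "A \<preceq> B \<Longrightarrow> B \<preceq> C \<Longrightarrow> A \<preceq> C"
| cumul_Type: "i \<le> j \<Longrightarrow> Type i \<preceq> Type j"
| cumul_All: "A =\<^sub>\<beta> A' \<Longrightarrow> B \<preceq> B' \<Longrightarrow> All A B \<preceq> All A' B'"

definition is_sort :: "tm \<Rightarrow> bool" where
  "is_sort s \<longleftrightarrow> s = Prop \<or> (\<exists>i. s = Type i)"

text \<open>Contexts are lists whose head is the most recent declaration.\<close>

type_synonym ctx = "tm list"

text \<open>
  The product rules are those of ECC: a product with propositional codomain is a proposition, and
  otherwise domain and codomain are both in some \<open>Type i\<close>. As \<open>Prop\<close> is not included in \<open>Type i\<close>,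
  there is no product of a family of types over a proposition. Since product formation is
  restricted, the rule for abstraction requires the product to be well-formed.
\<close>

inductive wf_ctx :: "ctx \<Rightarrow> bool"
  and typing :: "ctx \<Rightarrow> tm \<Rightarrow> tm \<Rightarrow> bool"  ("_ \<turnstile> _ : _" [51, 51, 51] 50)
where
  wf_Nil: "wf_ctx []"
| wf_Cons: "wf_ctx \<Gamma> \<Longrightarrow> \<Gamma> \<turnstile> A : s \<Longrightarrow> is_sort s \<Longrightarrow> wf_ctx (A # \<Gamma>)"
| T_Prop: "wf_ctx \<Gamma> \<Longrightarrow> \<Gamma> \<turnstile> Prop : Type 0"
| T_Type: "wf_ctx \<Gamma> \<Longrightarrow> \<Gamma> \<turnstile> Type i : Type (Suc i)"
| T_Var: "wf_ctx \<Gamma> \<Longrightarrow> i < length \<Gamma> \<Longrightarrow> \<Gamma> \<turnstile> Var i : lift (Suc i) 0 (\<Gamma> ! i)"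
| T_All_Prop_Prop:
    "\<Gamma> \<turnstile> P : Prop \<Longrightarrow> P # \<Gamma> \<turnstile> Q : Prop \<Longrightarrow> \<not> occurs 0 Q \<Longrightarrow> \<Gamma> \<turnstile> All P Q : Prop"
| T_All_Type_Prop: "\<Gamma> \<turnstile> A : Type i \<Longrightarrow> A # \<Gamma> \<turnstile> Q : Prop \<Longrightarrow> \<Gamma> \<turnstile> All A Q : Prop"
| T_All_Type_Type: "\<Gamma> \<turnstile> A : Type i \<Longrightarrow> A # \<Gamma> \<turnstile> B : Type i \<Longrightarrow> \<Gamma> \<turnstile> All A B : Type i"
| T_Lam: "A # \<Gamma> \<turnstile> t : B \<Longrightarrow> \<Gamma> \<turnstile> All A B : s \<Longrightarrow> is_sort s \<Longrightarrow> \<Gamma> \<turnstile> Lam A t : All A B"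
| T_App: "\<Gamma> \<turnstile> u : All A B \<Longrightarrow> \<Gamma> \<turnstile> v : A \<Longrightarrow> \<Gamma> \<turnstile> App u v : subst v 0 B"
| T_Cumul: "\<Gamma> \<turnstile> t : A \<Longrightarrow> \<Gamma> \<turnstile> A' : s \<Longrightarrow> is_sort s \<Longrightarrow> A \<preceq> A' \<Longrightarrow> \<Gamma> \<turnstile> t : A'"

definition propositional :: "ctx \<Rightarrow> tm \<Rightarrow> bool" where
  "propositional \<Gamma> P \<longleftrightarrow> \<Gamma> \<turnstile> P : Prop"

definition proof_term :: "ctx \<Rightarrow> tm \<Rightarrow> bool" where
  "proof_term \<Gamma> t \<longleftrightarrow> (\<exists>P. propositional \<Gamma> P \<and> \<Gamma> \<turnstile> t : P)"


section \<open>The interpretation\<close>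

text \<open>
  \<open>X\<close> is a topology on (the members of) a set of the universe; open sets occur both as HOL sets \<open>U\<close>
  and as elements \<open>VSet U\<close> of the universe.
\<close>

definition opens :: "'v::zfc topology \<Rightarrow> 'v" where
  "opens X = VSet (VSet ` {U. openin X U})"

definition open_meet :: "'v::zfc topology \<Rightarrow> 'v set \<Rightarrow> 'v" where
  "open_meet X S = VSet (if S = {} then topspace X else X interior_of (\<Inter>a\<in>S. elts a))"

text \<open>\<open>open_exp X b a\<close> is the exponential written \<open>b\<close> to the power \<open>a\<close>.\<close>

definition open_exp :: "'v::zfc topology \<Rightarrow> 'v \<Rightarrow> 'v \<Rightarrow> 'v" where
  "open_exp X b a = VSet (\<Union>{t. openin X t \<and> t \<inter> elts a \<subseteq> elts b})"

definition point_condition :: "'v topology \<Rightarrow> 'v \<Rightarrow> bool" where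
  "point_condition X p \<longleftrightarrow> openin X (\<Inter>{U. openin X U \<and> p \<in> U})"

text \<open>Members of the strict interpretation of \<open>A\<close>, given its interpretation \<open>a\<close>.\<close>

definition strict :: "'v::zfc \<Rightarrow> ctx \<Rightarrow> tm \<Rightarrow> 'v \<Rightarrow> 'v set" where
  "strict p \<Gamma> A a = (if propositional \<Gamma> A then elts a \<inter> {p} else elts a)"

text \<open>
  \<open>interp X p \<Gamma> t \<gamma>\<close> interprets the judgment of \<open>t\<close> in context \<open>\<Gamma>\<close> at the valuation \<open>\<gamma>\<close>, a list indexed
  like \<open>\<Gamma>\<close>. In the clause for \<open>All P Q\<close>, the codomain \<open>Q\<close> is a propositional term for \<open>\<Gamma>\<close> itself iff it
  does not contain the bound variable and \<open>lower 0 Q\<close> is a propositional term for \<open>\<Gamma>\<close>.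
\<close>

function interp :: "'v::zfc topology \<Rightarrow> 'v \<Rightarrow> ctx \<Rightarrow> tm \<Rightarrow> 'v list \<Rightarrow> 'v" where
  "interp X p \<Gamma> Prop \<gamma> = (if proof_term \<Gamma> Prop then p else opens X)"
| "interp X p \<Gamma> (Type i) \<gamma> = (if proof_term \<Gamma> (Type i) then p else Guniv i)"
| "interp X p \<Gamma> (Var i) \<gamma> = (if proof_term \<Gamma> (Var i) then p else \<gamma> ! i)"
| "interp X p \<Gamma> (All P Q) \<gamma> =
    (if proof_term \<Gamma> (All P Q) then p
     else if propositional \<Gamma> P \<and> \<not> occurs 0 Q \<and> propositional \<Gamma> (lower 0 Q) then
       open_exp X (interp X p \<Gamma> (lower 0 Q) \<gamma>) (interp X p \<Gamma> P \<gamma>)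
     else if \<not> propositional \<Gamma> P \<and> propositional (P # \<Gamma>) Q then
       open_meet X ((\<lambda>\<alpha>. interp X p (P # \<Gamma>) Q (\<alpha> # \<gamma>)) ` elts (interp X p \<Gamma> P \<gamma>))
     else
       vPi (strict p \<Gamma> P (interp X p \<Gamma> P \<gamma>)) (\<lambda>\<alpha>. interp X p (P # \<Gamma>) Q (\<alpha> # \<gamma>)))"
| "interp X p \<Gamma> (Lam A t) \<gamma> =
    (if proof_term \<Gamma> (Lam A t) then p
     else vlam (strict p \<Gamma> A (interp X p \<Gamma> A \<gamma>)) (\<lambda>\<alpha>. interp X p (A # \<Gamma>) t (\<alpha> # \<gamma>)))"
| "interp X p \<Gamma> (App u v) \<gamma> =
    (if proof_term \<Gamma> (App u v) then p
     else vapp (interp X p \<Gamma> u \<gamma>) (interp X p \<Gamma> v \<gamma>))"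
  by pat_completeness auto
termination
  by (relation "Wellfounded.measure (\<lambda>(X, p, \<Gamma>, t, \<gamma>). size t)") auto

fun ctx_interp :: "'v::zfc topology \<Rightarrow> 'v \<Rightarrow> ctx \<Rightarrow> 'v list set" where
  "ctx_interp X p [] = {[]}"
| "ctx_interp X p (A # \<Gamma>) =
    {\<alpha> # \<gamma> | \<alpha> \<gamma>. \<gamma> \<in> ctx_interp X p \<Gamma> \<and> \<alpha> \<in> strict p \<Gamma> A (interp X p \<Gamma> A \<gamma>)}"

end

(*
  Propositions are interpreted in the Heyting algebra of opens, and a proof of P in a context with
  propositions P1, ..., Pn is sound in the sense that the intersection of the Pi is included in P,
  while all proofs have the value p. Intersecting with p is only done at the very end. Proofs occur in
  no types, so p may be assigned to a variable of type Pi even where Pi does not contain p.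

  Conversion is between raw terms, so soundness of the conversion rule rests on confluence, subject
  reduction and uniqueness of types up to cumulativity; the latter makes being a proof term stable
  under weakening, substitution and reduction of typed terms. Strengthening is needed because the
  interpretation of a non-dependent product evaluates the codomain in the smaller context.
*)
theory Submission
  imports Defs
begin

section \<open>Renaming and substitution\<close>

text \<open>Every branch of \<open>interp\<close> is chosen by typing statements, so the choice must
  survive weakening, substitution and reduction. The lever is that \<open>Prop\<close> and
  \<open>Type i\<close> have no common lower bound for cumulativity, while any two types of a term
  have one; whether the type of a term is a proposition therefore does not depend on the type
  chosen. The second obstacle is a circle. A redex and its contractum agree in value only if the
  argument lies in the domain of the function, which is a consequence of soundness. Soundness of
  \<open>T_Cumul\<close> in turn needs invariance along the reductions that join two types, and the
  terms on the way occur in no derivation at hand. The predicate \<open>valid\<close> records the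
  domain conditions and is itself preserved by reduction, so it has to be known at the two ends
  only. There the induction hypotheses supply it: the one for the subject includes validity of its
  type, and the rule has a typing premise for the target type.\<close>

definition upr :: "(nat \<Rightarrow> nat) \<Rightarrow> nat \<Rightarrow> nat" where
  "upr r i = (case i of 0 \<Rightarrow> 0 | Suc j \<Rightarrow> Suc (r j))"

text \<open>Renamings and simultaneous substitutions given by functions on indices compose like
  functions. \<open>lift\<close> and \<open>subst\<close> are instances (\<open>lift_eq_ren\<close>,
  \<open>subst_eq_psub\<close>), so their commutation laws need little index arithmetic.\<close>

fun ren :: "(nat \<Rightarrow> nat) \<Rightarrow> tm \<Rightarrow> tm" where
  "ren r Prop = Prop"
| "ren r (Type i) = Type i"
| "ren r (Var i) = Var (r i)"
| "ren r (All A B) = All (ren r A) (ren (upr r) B)"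
| "ren r (Lam A t) = Lam (ren r A) (ren (upr r) t)"
| "ren r (App u v) = App (ren r u) (ren r v)"

definition ups :: "(nat \<Rightarrow> tm) \<Rightarrow> nat \<Rightarrow> tm" where
  "ups \<sigma> i = (case i of 0 \<Rightarrow> Var 0 | Suc j \<Rightarrow> ren Suc (\<sigma> j))"

fun psub :: "(nat \<Rightarrow> tm) \<Rightarrow> tm \<Rightarrow> tm" where
  "psub \<sigma> Prop = Prop"
| "psub \<sigma> (Type i) = Type i"
| "psub \<sigma> (Var i) = \<sigma> i"
| "psub \<sigma> (All A B) = All (psub \<sigma> A) (psub (ups \<sigma>) B)"
| "psub \<sigma> (Lam A t) = Lam (psub \<sigma> A) (psub (ups \<sigma>) t)"
| "psub \<sigma> (App u v) = App (psub \<sigma> u) (psub \<sigma> v)"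

definition scons :: "tm \<Rightarrow> (nat \<Rightarrow> tm) \<Rightarrow> nat \<Rightarrow> tm" where
  "scons s \<sigma> i = (case i of 0 \<Rightarrow> s | Suc j \<Rightarrow> \<sigma> j)"

lemma upr_simps [simp]: "upr r 0 = 0" "upr r (Suc j) = Suc (r j)"
  by (simp_all add: upr_def)

lemma ups_simps [simp]: "ups \<sigma> 0 = Var 0" "ups \<sigma> (Suc j) = ren Suc (\<sigma> j)"
  by (simp_all add: ups_def)

lemma scons_simps [simp]: "scons s \<sigma> 0 = s" "scons s \<sigma> (Suc j) = \<sigma> j"
  by (simp_all add: scons_def)

lemma nat_fun_eqI: "f 0 = g 0 \<Longrightarrow> (\<And>j. f (Suc j) = g (Suc j)) \<Longrightarrow> f = g"
  by (rule ext, case_tac x) auto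

lemma upr_comp: "upr r \<circ> upr q = upr (r \<circ> q)"
  by (rule nat_fun_eqI) auto

lemma ren_ren: "ren r (ren q t) = ren (r \<circ> q) t"
  by (induction t arbitrary: r q) (auto simp: upr_comp)

lemma upr_id: "upr id = id" "upr (\<lambda>x. x) = (\<lambda>x. x)"
  by (rule nat_fun_eqI; simp)+

lemma ren_id [simp]: "ren id t = t" "ren (\<lambda>x. x) t = t"
proof -
  show "ren id t = t" by (induction t) (auto simp: upr_id)
  then show "ren (\<lambda>x. x) t = t" by (simp add: id_def)
qed

lemma ups_upr: "ups \<sigma> \<circ> upr r = ups (\<sigma> \<circ> r)"
  by (rule nat_fun_eqI) auto

lemma psub_ren: "psub \<sigma> (ren r t) = psub (\<sigma> \<circ> r) t"
  by (induction t arbitrary: \<sigma> r) (auto simp: ups_upr)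

lemma ren_ups: "ren (upr r) \<circ> ups \<sigma> = ups (ren r \<circ> \<sigma>)"
  by (rule nat_fun_eqI) (auto simp: ren_ren o_def)

lemma ren_psub: "ren r (psub \<sigma> t) = psub (ren r \<circ> \<sigma>) t"
  by (induction t arbitrary: \<sigma> r) (auto simp: ren_ups)

lemma psub_ups: "psub (ups \<tau>) \<circ> ups \<sigma> = ups (psub \<tau> \<circ> \<sigma>)"
  by (rule nat_fun_eqI) (auto simp: psub_ren ren_psub o_def)

lemma psub_psub: "psub \<tau> (psub \<sigma> t) = psub (psub \<tau> \<circ> \<sigma>) t"
  by (induction t arbitrary: \<sigma> \<tau>) (auto simp: psub_ups)

lemma ups_Var_comp: "ups (Var \<circ> r) = Var \<circ> upr r"
  by (rule nat_fun_eqI) auto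

lemma ren_eq_psub: "ren r t = psub (Var \<circ> r) t"
  by (induction t arbitrary: r) (auto simp: ups_Var_comp)

lemma psub_Var [simp]: "psub Var t = t"
  using ren_eq_psub[of id t] by (simp add: o_def)

lemma lift_eq_ren: "lift n k t = ren (\<lambda>i. if i < k then i else i + n) t"
proof (induction t arbitrary: k)
  have *: "upr (\<lambda>i. if i < k then i else i + n) = (\<lambda>i. if i < Suc k then i else i + n)" for k
    by (rule nat_fun_eqI) auto
  case (All A B) then show ?case by (simp add: *)
next
  have *: "upr (\<lambda>i. if i < k then i else i + n) = (\<lambda>i. if i < Suc k then i else i + n)" for k
    by (rule nat_fun_eqI) auto
  case (Lam A B) then show ?case by (simp add: *)
qed auto

lemma lift0: "lift n 0 t = ren (\<lambda>i. i + n) t"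
  by (simp add: lift_eq_ren)

lemma subst_eq_psub:
  "subst s k t = psub (\<lambda>i. if i < k then Var i else if i = k then lift k 0 s else Var (i - 1)) t"
    (is "_ = psub (?\<sigma> k) t")
proof (induction t arbitrary: k)
  have *: "ups (?\<sigma> k) = ?\<sigma> (Suc k)" for k
    by (rule nat_fun_eqI) (auto simp: lift0 ren_ren o_def)
  case (All A B) then show ?case by (simp add: *)
next
  have *: "ups (?\<sigma> k) = ?\<sigma> (Suc k)" for k
    by (rule nat_fun_eqI) (auto simp: lift0 ren_ren o_def)
  case (Lam A B) then show ?case by (simp add: *)
qed auto

lemma subst0: "subst s 0 t = psub (scons s Var) t"
proof -
  have "(\<lambda>i. if i < 0 then Var i else if i = 0 then lift 0 0 s else Var (i - 1)) = scons s Var"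
    by (rule nat_fun_eqI) (auto simp: lift0)
  then show ?thesis by (simp add: subst_eq_psub)
qed

lemma psub_subst: "psub \<sigma> (subst v 0 t) = subst (psub \<sigma> v) 0 (psub (ups \<sigma>) t)"
proof -
  have "psub \<sigma> \<circ> scons v Var = psub (scons (psub \<sigma> v) Var) \<circ> ups \<sigma>"
    by (rule nat_fun_eqI) (auto simp: psub_ren o_def)
  then show ?thesis by (simp add: subst0 psub_psub)
qed

lemma ren_subst: "ren r (subst v 0 t) = subst (ren r v) 0 (ren (upr r) t)"
  by (simp add: ren_eq_psub psub_subst ups_Var_comp)

lemma subst_ren_Suc [simp]: "subst v 0 (ren Suc t) = t"
  by (simp add: subst0 psub_ren o_def)

lemma ren_upr_Suc: "ren (upr r) (ren Suc t) = ren Suc (ren r t)"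
  by (simp add: ren_ren o_def)

lemma psub_ups_Suc: "psub (ups \<sigma>) (ren Suc t) = ren Suc (psub \<sigma> t)"
  by (simp add: psub_ren ren_psub o_def)

lemma lift_lower: "\<not> occurs k t \<Longrightarrow> lift 1 k (lower k t) = t"
  by (induction t arbitrary: k) auto

lemma lower_lift: "lower k (lift 1 k t) = t"
  by (induction t arbitrary: k) auto

lemma occurs_lift: "\<not> occurs k (lift 1 k t)"
  by (induction t arbitrary: k) auto

lemma ren_Suc_lower: "\<not> occurs 0 t \<Longrightarrow> ren Suc (lower 0 t) = t"
  using lift_lower[of 0 t] by (simp add: lift0)

lemma lower_ren_Suc [simp]: "lower 0 (ren Suc t) = t"
  using lower_lift[of 0 t] by (simp add: lift0)

lemma occurs_ren_Suc [simp]: "\<not> occurs 0 (ren Suc t)"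
  using occurs_lift[of 0 t] by (simp add: lift0)

text \<open>Used in contrapositive form by strengthening: non-occurrence in a renamed term passes to
  the original term.\<close>

lemma occurs_ren: "occurs k t \<Longrightarrow> occurs (r k) (ren r t)"
proof (induction t arbitrary: k r)
  case (All A B) then show ?case by (metis occurs.simps(4) ren.simps(4) upr_simps(2))
next
  case (Lam A B) then show ?case by (metis occurs.simps(5) ren.simps(5) upr_simps(2))
qed auto

lemma ren_left_inverse:
  assumes "inj r" shows "ren (inv r) (ren r t) = t"
  using assms by (simp add: ren_ren)

lemma inj_upr: "inj r \<Longrightarrow> inj (upr r)"
proof (rule injI)
  fix x y assume "inj r" "upr r x = upr r y"
  then show "x = y" by (cases x; cases y) (auto dest: injD)
qed

section \<open>Confluence\<close>

text \<open>Parallel reduction in the style of Tait and Martin-Loef: it lies between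
  \<open>beta\<close> and its reflexive transitive closure and, unlike \<open>beta\<close>, has the
  diamond property.\<close>

inductive par :: "tm \<Rightarrow> tm \<Rightarrow> bool" where
  par_Prop: "par Prop Prop"
| par_Type: "par (Type i) (Type i)"
| par_Var: "par (Var i) (Var i)"
| par_All: "par A A' \<Longrightarrow> par B B' \<Longrightarrow> par (All A B) (All A' B')"
| par_Lam: "par A A' \<Longrightarrow> par t t' \<Longrightarrow> par (Lam A t) (Lam A' t')"
| par_App: "par u u' \<Longrightarrow> par v v' \<Longrightarrow> par (App u v) (App u' v')"
| par_redex: "par t t' \<Longrightarrow> par v v' \<Longrightarrow> par (App (Lam A t) v) (subst v' 0 t')"

text \<open>Takahashi's complete development: all redexes present in the term are contracted at
  once, newly created ones are left.\<close>

fun cdev :: "tm \<Rightarrow> tm" where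
  "cdev Prop = Prop"
| "cdev (Type i) = Type i"
| "cdev (Var i) = Var i"
| "cdev (All A B) = All (cdev A) (cdev B)"
| "cdev (Lam A t) = Lam (cdev A) (cdev t)"
| "cdev (App (Lam A t) v) = subst (cdev v) 0 (cdev t)"
| "cdev (App u v) = App (cdev u) (cdev v)"

lemma par_refl [simp]: "par t t"
  by (induction t) (auto intro: par.intros)

lemma par_ren: "par t t' \<Longrightarrow> par (ren r t) (ren r t')"
  by (induction arbitrary: r rule: par.induct) (auto simp: ren_subst intro: par.intros)

lemma par_ups: "(\<And>i. par (\<sigma> i) (\<tau> i)) \<Longrightarrow> par (ups \<sigma> i) (ups \<tau> i)"
  by (cases i) (auto intro: par_ren)

lemma par_psub: "par t t' \<Longrightarrow> (\<And>i. par (\<sigma> i) (\<tau> i)) \<Longrightarrow> par (psub \<sigma> t) (psub \<tau> t')"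
proof (induction arbitrary: \<sigma> \<tau> rule: par.induct)
  case (par_redex t t' v v' A)
  then show ?case by (simp add: psub_subst par.par_redex par_ups)
qed (auto intro!: par.intros simp: par_ups)

lemma par_subst: "par t t' \<Longrightarrow> par v v' \<Longrightarrow> par (subst v 0 t) (subst v' 0 t')"
  unfolding subst0 by (erule par_psub) (auto simp: scons_def split: nat.splits)

text \<open>Triangle property: \<open>cdev t\<close> depends on \<open>t\<close> alone, so it
  completes any two parallel steps from \<open>t\<close> to a diamond.\<close>

lemma par_cdev: "par t t' \<Longrightarrow> par t' (cdev t)"
proof (induction rule: par.induct)
  case (par_App u u' v v')
  show ?case
  \<comment> \<open>\<open>cdev\<close> contracts an application exactly when its function part is
    an abstraction; the parallel reduct of that part is then an abstraction too, and the redex can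
    still be contracted.\<close>
  proof (cases "\<exists>A t. u = Lam A t")
    case True
    then obtain A t where u: "u = Lam A t" by blast
    with par_App.hyps obtain A' t' where u': "u' = Lam A' t'" by (auto elim: par.cases)
    from par_App.IH(1) u u' have "par t' (cdev t)" by (auto elim: par.cases)
    with par_App.IH(2) u u' show ?thesis by (auto intro: par.par_redex)
  next
    case False
    then have "cdev (App u v) = App (cdev u) (cdev v)" by (cases u) auto
    with par_App.IH show ?thesis by (auto intro: par.intros)
  qed
qed (auto intro: par.intros par_subst)

lemma beta_imp_par: "beta t t' \<Longrightarrow> par t t'"
  by (induction rule: beta.induct) (auto intro: par.intros)

abbreviation betas :: "tm \<Rightarrow> tm \<Rightarrow> bool" (infix "\<longrightarrow>\<^sub>\<beta>" 50) where
  "t \<longrightarrow>\<^sub>\<beta> u \<equiv> beta\<^sup>*\<^sup>* t u"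

lemma betas_map:
  assumes "t \<longrightarrow>\<^sub>\<beta> t'" and "\<And>t t'. beta t t' \<Longrightarrow> beta (f t) (f t')"
  shows "f t \<longrightarrow>\<^sub>\<beta> f t'"
  using assms(1) by (induction) (auto intro: assms(2) rtranclp.rtrancl_into_rtrancl)

lemma betas_All: "A \<longrightarrow>\<^sub>\<beta> A' \<Longrightarrow> B \<longrightarrow>\<^sub>\<beta> B' \<Longrightarrow> All A B \<longrightarrow>\<^sub>\<beta> All A' B'"
  using betas_map[of A A' "\<lambda>A. All A B"] betas_map[of B B' "\<lambda>B. All A' B"]
  by (auto intro: beta.intros rtranclp_trans)

lemma betas_Lam: "A \<longrightarrow>\<^sub>\<beta> A' \<Longrightarrow> B \<longrightarrow>\<^sub>\<beta> B' \<Longrightarrow> Lam A B \<longrightarrow>\<^sub>\<beta> Lam A' B'"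
  using betas_map[of A A' "\<lambda>A. Lam A B"] betas_map[of B B' "\<lambda>B. Lam A' B"]
  by (auto intro: beta.intros rtranclp_trans)

lemma betas_App: "A \<longrightarrow>\<^sub>\<beta> A' \<Longrightarrow> B \<longrightarrow>\<^sub>\<beta> B' \<Longrightarrow> App A B \<longrightarrow>\<^sub>\<beta> App A' B'"
  using betas_map[of A A' "\<lambda>A. App A B"] betas_map[of B B' "\<lambda>B. App A' B"]
  by (auto intro: beta.intros rtranclp_trans)

lemma par_imp_betas: "par t t' \<Longrightarrow> t \<longrightarrow>\<^sub>\<beta> t'"
proof (induction rule: par.induct)
  case (par_redex t t' v v' A)
  have "App (Lam A t) v \<longrightarrow>\<^sub>\<beta> App (Lam A t') v'"
    using par_redex by (intro betas_App betas_Lam) auto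
  then show ?case using beta_redex by (rule rtranclp.rtrancl_into_rtrancl)
qed (auto intro: betas_All betas_Lam betas_App)

lemma pars_eq_betas: "par\<^sup>*\<^sup>* = beta\<^sup>*\<^sup>*"
proof (intro antisym predicate2I)
  fix t u show "par\<^sup>*\<^sup>* t u \<Longrightarrow> t \<longrightarrow>\<^sub>\<beta> u"
    by (induction rule: rtranclp_induct) (auto dest: par_imp_betas)
  show "t \<longrightarrow>\<^sub>\<beta> u \<Longrightarrow> par\<^sup>*\<^sup>* t u"
    by (induction rule: rtranclp_induct) (auto dest: beta_imp_par intro: rtranclp.rtrancl_into_rtrancl)
qed

lemma par_strip: "par\<^sup>*\<^sup>* t u \<Longrightarrow> par t v \<Longrightarrow> \<exists>w. par u w \<and> par\<^sup>*\<^sup>* v w"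
proof (induction rule: rtranclp_induct)
  case (step y z)
  then obtain w where "par y w" "par\<^sup>*\<^sup>* v w" by blast
  \<comment> \<open>Both \<open>z\<close> and \<open>w\<close> are one parallel step away from
    \<open>y\<close>, so \<open>cdev y\<close> joins them.\<close>
  with step(2) show ?case
    by (intro exI[of _ "cdev y"]) (meson par_cdev rtranclp.rtrancl_into_rtrancl)
qed blast

lemma betas_confluent: "t \<longrightarrow>\<^sub>\<beta> u \<Longrightarrow> t \<longrightarrow>\<^sub>\<beta> v \<Longrightarrow> \<exists>w. u \<longrightarrow>\<^sub>\<beta> w \<and> v \<longrightarrow>\<^sub>\<beta> w"
  unfolding pars_eq_betas[symmetric]
proof (induction arbitrary: v rule: rtranclp_induct)
  case (step y z)
  then obtain w where w: "par\<^sup>*\<^sup>* y w" "par\<^sup>*\<^sup>* v w" by blast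
  from par_strip[OF w(1) step(2)] w(2) show ?case
    by (meson rtranclp.rtrancl_into_rtrancl)
qed blast

text \<open>Church-Rosser: a zigzag that may run through ill-typed terms is replaced by two forward
  reductions, along which subject reduction applies.\<close>

lemma beta_eq_joinable: "t =\<^sub>\<beta> u \<longleftrightarrow> (\<exists>w. t \<longrightarrow>\<^sub>\<beta> w \<and> u \<longrightarrow>\<^sub>\<beta> w)"
proof
  show "t =\<^sub>\<beta> u \<Longrightarrow> \<exists>w. t \<longrightarrow>\<^sub>\<beta> w \<and> u \<longrightarrow>\<^sub>\<beta> w"
    unfolding beta_eq_def
  proof (induction rule: rtranclp_induct)
    case (step y z)
    then obtain w where w: "t \<longrightarrow>\<^sub>\<beta> w" "y \<longrightarrow>\<^sub>\<beta> w" by blast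
    from step(2) show ?case
    proof (rule symclpE)
      assume "beta y z"
      with w betas_confluent[of y w z] show ?thesis by (meson r_into_rtranclp rtranclp_trans)
    next
      assume "beta z y"
      with w show ?thesis by (meson converse_rtranclp_into_rtranclp)
    qed
  qed blast
  have *: "a \<longrightarrow>\<^sub>\<beta> b \<Longrightarrow> (symclp beta)\<^sup>*\<^sup>* a b" for a b
    by (rule mono_rtranclp[rule_format, of beta]) (auto simp: symclp_def)
  have **: "(symclp beta)\<^sup>*\<^sup>* a b \<Longrightarrow> (symclp beta)\<^sup>*\<^sup>* b a" for a b
    by (metis symp_rtranclp symp_def symclp_def)
  show "\<exists>w. t \<longrightarrow>\<^sub>\<beta> w \<and> u \<longrightarrow>\<^sub>\<beta> w \<Longrightarrow> t =\<^sub>\<beta> u"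
    unfolding beta_eq_def using * ** by (meson rtranclp_trans)
qed

lemma beta_eq_refl [simp]: "t =\<^sub>\<beta> t" and beta_eq_sym: "t =\<^sub>\<beta> u \<Longrightarrow> u =\<^sub>\<beta> t"
  by (auto simp: beta_eq_joinable)

lemma beta_eq_trans: "t =\<^sub>\<beta> u \<Longrightarrow> u =\<^sub>\<beta> v \<Longrightarrow> t =\<^sub>\<beta> v"
  by (auto simp: beta_eq_def)

lemma betas_imp_beta_eq: "t \<longrightarrow>\<^sub>\<beta> u \<Longrightarrow> t =\<^sub>\<beta> u"
  by (auto simp: beta_eq_joinable)

section \<open>Reduction under substitution and renaming\<close>

lemma beta_psub: "beta t t' \<Longrightarrow> beta (psub \<sigma> t) (psub \<sigma> t')"
  by (induction arbitrary: \<sigma> rule: beta.induct) (auto simp: psub_subst intro: beta.intros)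

lemma betas_psub: "t \<longrightarrow>\<^sub>\<beta> t' \<Longrightarrow> psub \<sigma> t \<longrightarrow>\<^sub>\<beta> psub \<sigma> t'"
  by (rule betas_map) (auto intro: beta_psub)

lemma beta_eq_psub: "t =\<^sub>\<beta> t' \<Longrightarrow> psub \<sigma> t =\<^sub>\<beta> psub \<sigma> t'"
  by (auto simp: beta_eq_joinable intro: betas_psub)

lemma beta_subst_arg: "beta v v' \<Longrightarrow> subst v 0 t =\<^sub>\<beta> subst v' 0 t"
  using beta_imp_par betas_imp_beta_eq par_imp_betas par_refl par_subst by blast

text \<open>Renaming creates no redexes, so every step of a renamed term is the renaming of a step.
  Strengthening pulls reductions back along renamings in this way.\<close>

lemma beta_renE:
  assumes "beta (ren r t) u"
  obtains t' where "u = ren r t'" "beta t t'"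
proof -
  have "beta s u \<Longrightarrow> s = ren r t \<Longrightarrow> \<exists>t'. u = ren r t' \<and> beta t t'" for s
  proof (induction arbitrary: r t rule: beta.induct)
    case (beta_redex A s v)
    then obtain A' s' v' where "t = App (Lam A' s') v'" "s = ren (upr r) s'" "v = ren r v'"
      by (cases t) (auto elim!: ren.elims[OF sym])
    then show ?case by (auto intro!: exI[of _ "subst v' 0 s'"] beta.intros simp: ren_subst)
  next
    case (beta_All1 A A' B)
    then obtain a b where "t = All a b" "A = ren r a" "B = ren (upr r) b" by (cases t) auto
    with beta_All1.IH show ?case by (metis beta.beta_All1 ren.simps(4))
  next
    case (beta_All2 B B' A)
    then obtain a b where "t = All a b" "A = ren r a" "B = ren (upr r) b" by (cases t) auto
    with beta_All2.IH show ?case by (metis beta.beta_All2 ren.simps(4))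
  next
    case (beta_Lam1 A A' B)
    then obtain a b where "t = Lam a b" "A = ren r a" "B = ren (upr r) b" by (cases t) auto
    with beta_Lam1.IH show ?case by (metis beta.beta_Lam1 ren.simps(5))
  next
    case (beta_Lam2 B B' A)
    then obtain a b where "t = Lam a b" "A = ren r a" "B = ren (upr r) b" by (cases t) auto
    with beta_Lam2.IH show ?case by (metis beta.beta_Lam2 ren.simps(5))
  next
    case (beta_App1 A A' B)
    then obtain a b where "t = App a b" "A = ren r a" "B = ren r b" by (cases t) auto
    with beta_App1.IH show ?case by (metis beta.beta_App1 ren.simps(6))
  next
    case (beta_App2 B B' A)
    then obtain a b where "t = App a b" "A = ren r a" "B = ren r b" by (cases t) auto
    with beta_App2.IH show ?case by (metis beta.beta_App2 ren.simps(6))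
  qed
  with assms that show thesis by blast
qed

lemma betas_renE:
  assumes "ren r t \<longrightarrow>\<^sub>\<beta> u"
  obtains t' where "u = ren r t'" "t \<longrightarrow>\<^sub>\<beta> t'"
proof -
  from assms have "\<exists>t'. u = ren r t' \<and> t \<longrightarrow>\<^sub>\<beta> t'"
    by (induction rule: rtranclp_induct)
      (blast, metis beta_renE rtranclp.rtrancl_into_rtrancl)
  with that show thesis by blast
qed

text \<open>A term without index 0 is \<open>ren Suc\<close> of its lowering, and reducts of
  weakened terms are weakened terms.\<close>

lemma betas_not_occurs:
  assumes "t \<longrightarrow>\<^sub>\<beta> u" "\<not> occurs 0 t" shows "\<not> occurs 0 u"
  by (metis assms betas_renE occurs_ren_Suc ren_Suc_lower)

inductive_cases beta_PropE: "beta Prop u"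
inductive_cases beta_TypeE: "beta (Type i) u"
inductive_cases beta_VarE: "beta (Var i) u"
inductive_cases beta_AllE: "beta (All A B) u"
inductive_cases beta_LamE: "beta (Lam A t) u"

lemma betas_sort: "is_sort s \<Longrightarrow> s \<longrightarrow>\<^sub>\<beta> u \<Longrightarrow> u = s"
  by (erule converse_rtranclpE) (auto simp: is_sort_def elim: beta_PropE beta_TypeE)

lemma betas_sort_iff [simp]: "Prop \<longrightarrow>\<^sub>\<beta> u \<longleftrightarrow> u = Prop" "Type i \<longrightarrow>\<^sub>\<beta> u \<longleftrightarrow> u = Type i"
  using betas_sort by (auto simp: is_sort_def)

lemma betas_AllE:
  assumes "All A B \<longrightarrow>\<^sub>\<beta> u"
  obtains A' B' where "u = All A' B'" "A \<longrightarrow>\<^sub>\<beta> A'" "B \<longrightarrow>\<^sub>\<beta> B'"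
proof -
  from assms have "\<exists>A' B'. u = All A' B' \<and> A \<longrightarrow>\<^sub>\<beta> A' \<and> B \<longrightarrow>\<^sub>\<beta> B'"
    by (induction rule: rtranclp_induct)
      (auto elim!: beta_AllE intro: rtranclp.rtrancl_into_rtrancl)
  with that show thesis by blast
qed

section \<open>Cumulativity\<close>

text \<open>
  By confluence, \<open>A \<preceq> B\<close> holds iff \<open>A\<close> and \<open>B\<close> have reducts related by \<open>scum\<close>. This removes the
  possibly ill-typed intermediate terms of \<open>cumul_trans\<close>, so that subject reduction applies.
\<close>

inductive scum :: "tm \<Rightarrow> tm \<Rightarrow> bool" where
  scum_refl: "scum A A"
| scum_Type: "i \<le> j \<Longrightarrow> scum (Type i) (Type j)"
| scum_All: "scum B B' \<Longrightarrow> scum (All A B) (All A B')"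

inductive_cases scum_TypeE: "scum (Type i) u"
inductive_cases scum_toPropE: "scum u Prop"
inductive_cases scum_toTypeE: "scum u (Type i)"
inductive_cases scum_AllE: "scum (All A B) u"
inductive_cases scum_toAllE: "scum u (All A B)"

text \<open>Related terms differ at most in a universe index at the end of a chain of codomains,
  where nothing reduces, so each step of one is matched by the same step of the other.\<close>

lemma scum_beta_right: "scum A B \<Longrightarrow> beta A A' \<Longrightarrow> \<exists>B'. beta B B' \<and> scum A' B'"
  by (induction arbitrary: A' rule: scum.induct)
    (blast intro: scum.intros beta.intros elim: beta_AllE beta_TypeE)+

lemma scum_beta_left: "scum A B \<Longrightarrow> beta B B' \<Longrightarrow> \<exists>A'. beta A A' \<and> scum A' B'"
  by (induction arbitrary: B' rule: scum.induct)
    (blast intro: scum.intros beta.intros elim: beta_AllE beta_TypeE)+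

lemma scum_betas_right: "A \<longrightarrow>\<^sub>\<beta> A' \<Longrightarrow> scum A B \<Longrightarrow> \<exists>B'. B \<longrightarrow>\<^sub>\<beta> B' \<and> scum A' B'"
  by (induction rule: rtranclp_induct)
    (blast, meson rtranclp.rtrancl_into_rtrancl scum_beta_right)

lemma scum_betas_left: "B \<longrightarrow>\<^sub>\<beta> B' \<Longrightarrow> scum A B \<Longrightarrow> \<exists>A'. A \<longrightarrow>\<^sub>\<beta> A' \<and> scum A' B'"
  by (induction rule: rtranclp_induct)
    (blast, meson rtranclp.rtrancl_into_rtrancl scum_beta_left)

lemma scum_trans: "scum A B \<Longrightarrow> scum B C \<Longrightarrow> scum A C"
  by (induction arbitrary: C rule: scum.induct)
    (auto intro: scum.intros elim!: scum_TypeE scum_AllE)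

lemma scum_imp_cumul: "scum A B \<Longrightarrow> A \<preceq> B"
  by (induction rule: scum.induct) (auto intro: cumul.intros)

lemma cumul_refl [simp]: "A \<preceq> A"
  by (rule cumul_conv) simp

lemma cumulE:
  assumes "A \<preceq> B"
  obtains A' B' where "A \<longrightarrow>\<^sub>\<beta> A'" "scum A' B'" "B \<longrightarrow>\<^sub>\<beta> B'"
proof -
  from assms have "\<exists>A' B'. A \<longrightarrow>\<^sub>\<beta> A' \<and> scum A' B' \<and> B \<longrightarrow>\<^sub>\<beta> B'"
  proof (induction rule: cumul.induct)
    case (cumul_conv A B) then show ?case by (auto simp: beta_eq_joinable intro: scum.intros)
  next
    case (cumul_trans A B C)
    then obtain A1 B1 B2 C2 where *: "A \<longrightarrow>\<^sub>\<beta> A1" "scum A1 B1" "B \<longrightarrow>\<^sub>\<beta> B1"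
      "B \<longrightarrow>\<^sub>\<beta> B2" "scum B2 C2" "C \<longrightarrow>\<^sub>\<beta> C2" by blast
    \<comment> \<open>The two reducts of the middle term are joined, and both \<open>scum\<close>
      relations are pushed along the joining reductions, where they compose.\<close>
    then obtain B3 where "B1 \<longrightarrow>\<^sub>\<beta> B3" "B2 \<longrightarrow>\<^sub>\<beta> B3" using betas_confluent by blast
    with * show ?case
      by (meson rtranclp_trans scum_betas_left scum_betas_right scum_trans)
  next
    case (cumul_All A A' B B')
    then show ?case by (meson betas_All beta_eq_joinable scum_All)
  qed (blast intro: scum.intros)
  with that show thesis by blast
qed

lemma cumulI: "A \<longrightarrow>\<^sub>\<beta> A' \<Longrightarrow> scum A' B' \<Longrightarrow> B \<longrightarrow>\<^sub>\<beta> B' \<Longrightarrow> A \<preceq> B"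
  by (meson betas_imp_beta_eq beta_eq_sym cumul.intros scum_imp_cumul)

lemma betas_cumul: "A \<longrightarrow>\<^sub>\<beta> B \<Longrightarrow> A \<preceq> B" "A \<longrightarrow>\<^sub>\<beta> B \<Longrightarrow> B \<preceq> A"
  by (auto intro: cumulI scum.intros)

lemma cumul_psub: "A \<preceq> B \<Longrightarrow> psub \<sigma> A \<preceq> psub \<sigma> B"
  by (induction arbitrary: \<sigma> rule: cumul.induct) (auto intro: cumul.intros beta_eq_psub)

lemma cumul_ren: "A \<preceq> B \<Longrightarrow> ren r A \<preceq> ren r B"
  by (simp add: ren_eq_psub cumul_psub)

lemma cumul_subst: "A \<preceq> B \<Longrightarrow> subst v 0 A \<preceq> subst v 0 B"
  by (simp add: subst0 cumul_psub)

lemma cumul_ren_reflect: "inj r \<Longrightarrow> ren r A \<preceq> ren r B \<Longrightarrow> A \<preceq> B"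
  by (metis cumul_ren ren_left_inverse)

text \<open>\<open>scum\<close> alters neither the head of a product nor its domain, so whatever
  lies below a product reduces to a product. This recovers the shape of the type of a function in
  the application cases.\<close>

lemma cumul_AllE_right:
  assumes "C \<preceq> All A B"
  obtains A' B' where "C \<longrightarrow>\<^sub>\<beta> All A' B'" "A' =\<^sub>\<beta> A" "B' \<preceq> B"
proof -
  from cumulE[OF assms] obtain C' D where *: "C \<longrightarrow>\<^sub>\<beta> C'" "scum C' D" "All A B \<longrightarrow>\<^sub>\<beta> D" by blast
  then obtain A1 B1 where D: "D = All A1 B1" "A \<longrightarrow>\<^sub>\<beta> A1" "B \<longrightarrow>\<^sub>\<beta> B1" by (auto elim: betas_AllE)
  with * obtain B2 where "C' = All A1 B2" "scum B2 B1"
    by (auto elim!: scum_toAllE intro: scum_refl)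
  with * D that show thesis
    by (meson betas_imp_beta_eq beta_eq_sym cumulI rtranclp.rtrancl_refl)
qed

lemma cumul_All_All:
  assumes "All A B \<preceq> All A' B'"
  shows "A =\<^sub>\<beta> A'" "B \<preceq> B'"
proof -
  from cumul_AllE_right[OF assms] obtain A1 B1 where
    *: "All A B \<longrightarrow>\<^sub>\<beta> All A1 B1" "A1 =\<^sub>\<beta> A'" "B1 \<preceq> B'" .
  then have "A \<longrightarrow>\<^sub>\<beta> A1" "B \<longrightarrow>\<^sub>\<beta> B1" by (auto elim: betas_AllE)
  with * show "A =\<^sub>\<beta> A'" "B \<preceq> B'"
    by (meson betas_imp_beta_eq beta_eq_trans cumul.intros)+
qed

lemma cumul_Prop_right: "A \<preceq> Prop \<Longrightarrow> A \<longrightarrow>\<^sub>\<beta> Prop"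
  by (erule cumulE) (auto elim: scum_toPropE)

lemma cumul_Type_right:
  assumes "A \<preceq> Type i" obtains j where "A \<longrightarrow>\<^sub>\<beta> Type j" "j \<le> i"
  using assms by (elim cumulE) (auto elim!: scum_toTypeE)

text \<open>Such a term would reduce both to \<open>Prop\<close> and to some \<open>Type j\<close>,
  two distinct normal forms. The missing step from \<open>Prop\<close> to \<open>Type 0\<close> is
  essential here.\<close>

lemma no_common_Prop_Type: "A \<preceq> Prop \<Longrightarrow> A \<preceq> Type i \<Longrightarrow> False"
  by (metis betas_confluent betas_sort cumul_Prop_right cumul_Type_right is_sort_def tm.distinct(1))

section \<open>Typing\<close>

lemma typing_wf: "\<Gamma> \<turnstile> t : T \<Longrightarrow> wf_ctx \<Gamma>"
  by (induction rule: wf_ctx_typing.inducts(2)[where ?P1.0 = "\<lambda>_. True"]) (auto elim: wf_ctx.cases)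

text \<open>Mutual induction with the trivial predicate on contexts, for claims that concern
  \<open>typing\<close> alone.\<close>

lemma typing_induct [consumes 1, case_names Prop Type Var PP TP TT Lam App Cumul]:
  assumes "\<Gamma> \<turnstile> t : T"
    and "\<And>\<Gamma>. wf_ctx \<Gamma> \<Longrightarrow> R \<Gamma> Prop (Type 0)"
    and "\<And>\<Gamma> i. wf_ctx \<Gamma> \<Longrightarrow> R \<Gamma> (Type i) (Type (Suc i))"
    and "\<And>\<Gamma> i. wf_ctx \<Gamma> \<Longrightarrow> i < length \<Gamma> \<Longrightarrow> R \<Gamma> (Var i) (lift (Suc i) 0 (\<Gamma> ! i))"
    and "\<And>\<Gamma> A B. \<Gamma> \<turnstile> A : Prop \<Longrightarrow> R \<Gamma> A Prop \<Longrightarrow> A # \<Gamma> \<turnstile> B : Prop \<Longrightarrow> R (A # \<Gamma>) B Prop \<Longrightarrow>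
      \<not> occurs 0 B \<Longrightarrow> R \<Gamma> (All A B) Prop"
    and "\<And>\<Gamma> A i B. \<Gamma> \<turnstile> A : Type i \<Longrightarrow> R \<Gamma> A (Type i) \<Longrightarrow> A # \<Gamma> \<turnstile> B : Prop \<Longrightarrow>
      R (A # \<Gamma>) B Prop \<Longrightarrow> R \<Gamma> (All A B) Prop"
    and "\<And>\<Gamma> A i B. \<Gamma> \<turnstile> A : Type i \<Longrightarrow> R \<Gamma> A (Type i) \<Longrightarrow> A # \<Gamma> \<turnstile> B : Type i \<Longrightarrow>
      R (A # \<Gamma>) B (Type i) \<Longrightarrow> R \<Gamma> (All A B) (Type i)"
    and "\<And>\<Gamma> A t B s. A # \<Gamma> \<turnstile> t : B \<Longrightarrow> R (A # \<Gamma>) t B \<Longrightarrow> \<Gamma> \<turnstile> All A B : s \<Longrightarrow> R \<Gamma> (All A B) s \<Longrightarrow>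
      is_sort s \<Longrightarrow> R \<Gamma> (Lam A t) (All A B)"
    and "\<And>\<Gamma> u A B v. \<Gamma> \<turnstile> u : All A B \<Longrightarrow> R \<Gamma> u (All A B) \<Longrightarrow> \<Gamma> \<turnstile> v : A \<Longrightarrow> R \<Gamma> v A \<Longrightarrow>
      R \<Gamma> (App u v) (subst v 0 B)"
    and "\<And>\<Gamma> t A A' s. \<Gamma> \<turnstile> t : A \<Longrightarrow> R \<Gamma> t A \<Longrightarrow> \<Gamma> \<turnstile> A' : s \<Longrightarrow> R \<Gamma> A' s \<Longrightarrow> is_sort s \<Longrightarrow> A \<preceq> A' \<Longrightarrow>
      R \<Gamma> t A'"
  shows "R \<Gamma> t T"
  using assms(1)
  by (induction rule: wf_ctx_typing.inducts(2)[where ?P1.0 = "\<lambda>_. True"])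
    (simp | blast intro: assms(2-))+

inductive_cases wf_ConsE: "wf_ctx (A # \<Gamma>)"

lemma is_sort_simps [simp]: "is_sort Prop" "is_sort (Type i)"
  by (auto simp: is_sort_def)

lemma wf_ConsI: "\<Gamma> \<turnstile> A : s \<Longrightarrow> is_sort s \<Longrightarrow> wf_ctx (A # \<Gamma>)"
  by (meson typing_wf wf_Cons)

lemma wf_Cons_sortI: "\<Gamma> \<turnstile> A : Prop \<Longrightarrow> wf_ctx (A # \<Gamma>)" "\<Gamma> \<turnstile> A : Type i \<Longrightarrow> wf_ctx (A # \<Gamma>)"
  by (auto intro: wf_ConsI)

lemma typing_ConsE:
  assumes "A # \<Gamma> \<turnstile> t : T" obtains s where "\<Gamma> \<turnstile> A : s" "is_sort s"
  using typing_wf[OF assms] by (blast elim: wf_ConsE)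

section \<open>Generation lemmas\<close>

lemma gen_Prop: "\<Gamma> \<turnstile> Prop : T \<Longrightarrow> Type 0 \<preceq> T"
  by (induction \<Gamma> "Prop" T rule: typing_induct) (auto intro: cumul_trans)

lemma gen_Type: "\<Gamma> \<turnstile> Type i : T \<Longrightarrow> Type (Suc i) \<preceq> T"
  by (induction \<Gamma> "Type i" T rule: typing_induct) (auto intro: cumul_trans)

lemma gen_Var: "\<Gamma> \<turnstile> Var i : T \<Longrightarrow> i < length \<Gamma> \<and> lift (Suc i) 0 (\<Gamma> ! i) \<preceq> T"
  by (induction \<Gamma> "Var i" T rule: typing_induct) (blast intro: cumul_trans cumul_refl)+

lemma gen_All:
  assumes "\<Gamma> \<turnstile> All A B : T"
  obtains (PP) "\<Gamma> \<turnstile> A : Prop" "A # \<Gamma> \<turnstile> B : Prop" "\<not> occurs 0 B" "Prop \<preceq> T"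
    | (TP) i where "\<Gamma> \<turnstile> A : Type i" "A # \<Gamma> \<turnstile> B : Prop" "Prop \<preceq> T"
    | (TT) i where "\<Gamma> \<turnstile> A : Type i" "A # \<Gamma> \<turnstile> B : Type i" "Type i \<preceq> T"
proof -
  from assms have "(\<Gamma> \<turnstile> A : Prop) \<and> (A # \<Gamma> \<turnstile> B : Prop) \<and> \<not> occurs 0 B \<and> Prop \<preceq> T \<or>
    (\<exists>i. (\<Gamma> \<turnstile> A : Type i) \<and> (A # \<Gamma> \<turnstile> B : Prop) \<and> Prop \<preceq> T) \<or>
    (\<exists>i. (\<Gamma> \<turnstile> A : Type i) \<and> (A # \<Gamma> \<turnstile> B : Type i) \<and> Type i \<preceq> T)"
    by (induction \<Gamma> "All A B" T rule: typing_induct) (blast intro: cumul_trans cumul_refl)+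
  then show thesis using that by blast
qed

lemma gen_Lam:
  assumes "\<Gamma> \<turnstile> Lam A t : T"
  obtains B s where "A # \<Gamma> \<turnstile> t : B" "\<Gamma> \<turnstile> All A B : s" "is_sort s" "All A B \<preceq> T"
proof -
  from assms have "\<exists>B s. (A # \<Gamma> \<turnstile> t : B) \<and> (\<Gamma> \<turnstile> All A B : s) \<and> is_sort s \<and> All A B \<preceq> T"
    by (induction \<Gamma> "Lam A t" T rule: typing_induct) (blast intro: cumul_trans cumul_refl)+
  then show thesis using that by blast
qed

lemma gen_App:
  assumes "\<Gamma> \<turnstile> App u v : T"
  obtains A B where "\<Gamma> \<turnstile> u : All A B" "\<Gamma> \<turnstile> v : A" "subst v 0 B \<preceq> T"
proof -
  from assms have "\<exists>A B. (\<Gamma> \<turnstile> u : All A B) \<and> (\<Gamma> \<turnstile> v : A) \<and> subst v 0 B \<preceq> T"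
    by (induction \<Gamma> "App u v" T rule: typing_induct) (blast intro: cumul_trans cumul_refl)+
  then show thesis using that by blast
qed

section \<open>Weakening, substitution and narrowing\<close>

definition entry :: "ctx \<Rightarrow> nat \<Rightarrow> tm" where
  "entry \<Gamma> i = lift (Suc i) 0 (\<Gamma> ! i)"

lemma entry_simps [simp]: "entry (A # \<Gamma>) 0 = ren Suc A" "entry (A # \<Gamma>) (Suc i) = ren Suc (entry \<Gamma> i)"
  by (auto simp: entry_def lift0 ren_ren o_def)

lemma typing_Var: "wf_ctx \<Gamma> \<Longrightarrow> i < length \<Gamma> \<Longrightarrow> \<Gamma> \<turnstile> Var i : entry \<Gamma> i"
  unfolding entry_def by (rule T_Var)

definition wt_ren :: "(nat \<Rightarrow> nat) \<Rightarrow> ctx \<Rightarrow> ctx \<Rightarrow> bool" where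
  "wt_ren r \<Gamma> \<Gamma>' \<longleftrightarrow> (\<forall>i<length \<Gamma>. r i < length \<Gamma>' \<and> entry \<Gamma>' (r i) = ren r (entry \<Gamma> i))"

lemma less_Suc_cases:
  assumes "i < Suc n" obtains "i = 0" | j where "i = Suc j" "j < n"
  using assms by (cases i) auto

lemma wt_ren_upr: "wt_ren r \<Gamma> \<Gamma>' \<Longrightarrow> wt_ren (upr r) (A # \<Gamma>) (ren r A # \<Gamma>')"
  unfolding wt_ren_def by (auto elim!: less_Suc_cases simp: ren_ren o_def)

lemma wt_ren_Suc: "wt_ren Suc \<Gamma> (A # \<Gamma>)"
  unfolding wt_ren_def by auto

lemma typing_All_sorts:
  assumes "\<Gamma> \<turnstile> All A B : T"
  obtains s s' where "\<Gamma> \<turnstile> A : s" "is_sort s" "A # \<Gamma> \<turnstile> B : s'" "is_sort s'"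
  using assms by (elim gen_All) auto

lemma typing_ren:
  "\<Gamma> \<turnstile> t : T \<Longrightarrow> wf_ctx \<Gamma>' \<Longrightarrow> wt_ren r \<Gamma> \<Gamma>' \<Longrightarrow> \<Gamma>' \<turnstile> ren r t : ren r T"
proof (induction arbitrary: \<Gamma>' r rule: typing_induct)
  case (Var \<Gamma> i)
  then show ?case using typing_Var[of \<Gamma>' "r i"] by (auto simp: wt_ren_def entry_def)
next
  case (PP \<Gamma> A B)
  then have A: "\<Gamma>' \<turnstile> ren r A : Prop" by simp
  then have "ren r A # \<Gamma>' \<turnstile> ren (upr r) B : Prop"
    using PP.IH(2)[OF wf_Cons_sortI(1)[OF A] wt_ren_upr[OF PP.prems(2)]] by simp
  \<comment> \<open>\<open>B\<close> is a weakening of \<open>lower 0 B\<close>, and renaming under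
    the binder takes weakenings to weakenings.\<close>
  moreover have "\<not> occurs 0 (ren (upr r) B)"
    using PP.hyps(3) by (metis occurs_ren_Suc ren_Suc_lower ren_upr_Suc)
  ultimately show ?case using \<open>\<Gamma>' \<turnstile> ren r A : Prop\<close> by (auto intro: T_All_Prop_Prop)
next
  case (TP \<Gamma> A i B)
  then have A: "\<Gamma>' \<turnstile> ren r A : Type i" by simp
  then have "ren r A # \<Gamma>' \<turnstile> ren (upr r) B : Prop"
    using TP.IH(2)[OF wf_Cons_sortI(2)[OF A] wt_ren_upr[OF TP.prems(2)]] by simp
  then show ?case using \<open>\<Gamma>' \<turnstile> ren r A : Type i\<close> by (auto intro: T_All_Type_Prop)
next
  case (TT \<Gamma> A i B)
  then have A: "\<Gamma>' \<turnstile> ren r A : Type i" by simp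
  then have "ren r A # \<Gamma>' \<turnstile> ren (upr r) B : Type i"
    using TT.IH(2)[OF wf_Cons_sortI(2)[OF A] wt_ren_upr[OF TT.prems(2)]] by simp
  then show ?case using \<open>\<Gamma>' \<turnstile> ren r A : Type i\<close> by (auto intro: T_All_Type_Type)
next
  case (Lam \<Gamma> A t B s)
  then have *: "\<Gamma>' \<turnstile> All (ren r A) (ren (upr r) B) : s" by (auto simp: is_sort_def)
  then have "wf_ctx (ren r A # \<Gamma>')" by (meson Lam.prems(1) typing_All_sorts wf_Cons)
  with Lam have "ren r A # \<Gamma>' \<turnstile> ren (upr r) t : ren (upr r) B" by (auto intro: wt_ren_upr)
  from T_Lam[OF this * \<open>is_sort s\<close>] show ?case by simp
next
  case (App \<Gamma> u A B v)
  then show ?case by (auto simp: ren_subst intro!: T_App)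
next
  case (Cumul \<Gamma> t A A' s)
  then show ?case by (metis T_Cumul cumul_ren is_sort_def ren.simps(1,2))
qed (auto intro: T_Prop T_Type)

lemma typing_weaken: "\<Gamma> \<turnstile> t : T \<Longrightarrow> \<Gamma> \<turnstile> A : s \<Longrightarrow> is_sort s \<Longrightarrow> A # \<Gamma> \<turnstile> ren Suc t : ren Suc T"
  by (meson typing_ren typing_wf wf_Cons wt_ren_Suc)

lemma is_sort_ren [simp]: "is_sort s \<Longrightarrow> ren r s = s"
  and is_sort_psub [simp]: "is_sort s \<Longrightarrow> psub \<sigma> s = s"
  by (auto simp: is_sort_def)

definition wt_sub :: "(nat \<Rightarrow> tm) \<Rightarrow> ctx \<Rightarrow> ctx \<Rightarrow> bool" where
  "wt_sub \<sigma> \<Gamma> \<Gamma>' \<longleftrightarrow> (\<forall>i<length \<Gamma>. \<Gamma>' \<turnstile> \<sigma> i : psub \<sigma> (entry \<Gamma> i))"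

lemma wt_sub_ups:
  assumes "wt_sub \<sigma> \<Gamma> \<Gamma>'" "\<Gamma>' \<turnstile> psub \<sigma> A : s" "is_sort s"
  shows "wt_sub (ups \<sigma>) (A # \<Gamma>) (psub \<sigma> A # \<Gamma>')"
proof -
  have "psub \<sigma> A # \<Gamma>' \<turnstile> ren Suc (\<sigma> i) : ren Suc (psub \<sigma> (entry \<Gamma> i))" if "i < length \<Gamma>" for i
    using assms(1) that typing_weaken[OF _ assms(2,3)] by (simp add: wt_sub_def)
  then show ?thesis
    using typing_Var[OF wf_ConsI[OF assms(2,3)], of 0]
    unfolding wt_sub_def by (auto elim!: less_Suc_cases simp: psub_ups_Suc)
qed

lemma typing_psub:
  "\<Gamma> \<turnstile> t : T \<Longrightarrow> wf_ctx \<Gamma>' \<Longrightarrow> wt_sub \<sigma> \<Gamma> \<Gamma>' \<Longrightarrow> \<Gamma>' \<turnstile> psub \<sigma> t : psub \<sigma> T"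
proof (induction arbitrary: \<Gamma>' \<sigma> rule: typing_induct)
  case (Var \<Gamma> i)
  then show ?case by (auto simp: wt_sub_def entry_def)
next
  case (PP \<Gamma> A B)
  then have A: "\<Gamma>' \<turnstile> psub \<sigma> A : Prop" by simp
  then have "psub \<sigma> A # \<Gamma>' \<turnstile> psub (ups \<sigma>) B : Prop"
    using PP.IH(2)[OF wf_Cons_sortI(1)[OF A] wt_sub_ups[OF PP.prems(2) A is_sort_simps(1)]] by simp
  moreover have "\<not> occurs 0 (psub (ups \<sigma>) B)"
    using PP.hyps(3) by (metis occurs_ren_Suc ren_Suc_lower psub_ups_Suc)
  ultimately show ?case using \<open>\<Gamma>' \<turnstile> psub \<sigma> A : Prop\<close> by (auto intro: T_All_Prop_Prop)
next
  case (TP \<Gamma> A i B)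
  then have A: "\<Gamma>' \<turnstile> psub \<sigma> A : Type i" by simp
  then have "psub \<sigma> A # \<Gamma>' \<turnstile> psub (ups \<sigma>) B : Prop"
    using TP.IH(2)[OF wf_Cons_sortI(2)[OF A] wt_sub_ups[OF TP.prems(2) A is_sort_simps(2)]] by simp
  then show ?case using \<open>\<Gamma>' \<turnstile> psub \<sigma> A : Type i\<close> by (auto intro: T_All_Type_Prop)
next
  case (TT \<Gamma> A i B)
  then have A: "\<Gamma>' \<turnstile> psub \<sigma> A : Type i" by simp
  then have "psub \<sigma> A # \<Gamma>' \<turnstile> psub (ups \<sigma>) B : Type i"
    using TT.IH(2)[OF wf_Cons_sortI(2)[OF A] wt_sub_ups[OF TT.prems(2) A is_sort_simps(2)]] by simp
  then show ?case using \<open>\<Gamma>' \<turnstile> psub \<sigma> A : Type i\<close> by (auto intro: T_All_Type_Type)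
next
  case (Lam \<Gamma> A t B s)
  then have *: "\<Gamma>' \<turnstile> All (psub \<sigma> A) (psub (ups \<sigma>) B) : s" by (auto simp: is_sort_def)
  then obtain s' where "\<Gamma>' \<turnstile> psub \<sigma> A : s'" "is_sort s'" by (rule typing_All_sorts)
  with Lam have "psub \<sigma> A # \<Gamma>' \<turnstile> psub (ups \<sigma>) t : psub (ups \<sigma>) B"
    by (meson wt_sub_ups wf_ConsI)
  from T_Lam[OF this * \<open>is_sort s\<close>] show ?case by simp
next
  case (App \<Gamma> u A B v)
  then show ?case by (auto simp: psub_subst intro!: T_App)
next
  case (Cumul \<Gamma> t A A' s)
  then show ?case by (metis T_Cumul cumul_psub is_sort_psub)
qed (auto intro: T_Prop T_Type)

lemma wt_sub_Var: "wf_ctx \<Gamma> \<Longrightarrow> wt_sub Var \<Gamma> \<Gamma>"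
  unfolding wt_sub_def by (simp add: typing_Var)

lemma wt_sub_scons: "\<Gamma> \<turnstile> v : A \<Longrightarrow> wt_sub (scons v Var) (A # \<Gamma>) \<Gamma>"
  using wt_sub_Var[OF typing_wf]
  unfolding wt_sub_def by (auto elim!: less_Suc_cases simp: psub_ren o_def)

lemma typing_subst: "A # \<Gamma> \<turnstile> t : T \<Longrightarrow> \<Gamma> \<turnstile> v : A \<Longrightarrow> \<Gamma> \<turnstile> subst v 0 t : subst v 0 T"
  unfolding subst0 by (meson typing_psub typing_wf wt_sub_scons)

text \<open>Narrowing is an instance of substitution: the identity is a well-typed substitution
  between the two contexts, because variable 0 of type \<open>A'\<close> also has type
  \<open>A\<close> by cumulativity.\<close>

lemma typing_ctx_cumul:
  assumes "A # \<Gamma> \<turnstile> t : T" "\<Gamma> \<turnstile> A' : s'" "is_sort s'" "A' \<preceq> A"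
  shows "A' # \<Gamma> \<turnstile> t : T"
proof -
  obtain s where s: "\<Gamma> \<turnstile> A : s" "is_sort s" using assms(1) by (rule typing_ConsE)
  have wf: "wf_ctx (A' # \<Gamma>)" using assms by (meson typing_wf wf_Cons)
  have "A' # \<Gamma> \<turnstile> ren Suc A : s" using typing_weaken[OF s(1) assms(2,3)] s by simp
  moreover have "A' # \<Gamma> \<turnstile> Var 0 : ren Suc A'" using typing_Var[OF wf, of 0] by simp
  ultimately have "A' # \<Gamma> \<turnstile> Var 0 : ren Suc A" using assms(4) s(2) by (meson T_Cumul cumul_ren)
  moreover have "A' # \<Gamma> \<turnstile> Var (Suc i) : ren Suc (entry \<Gamma> i)" if "i < length \<Gamma>" for i
    using typing_Var[OF wf, of "Suc i"] that by simp
  ultimately have "wt_sub Var (A # \<Gamma>) (A' # \<Gamma>)"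
    unfolding wt_sub_def by (auto elim!: less_Suc_cases)
  from typing_psub[OF assms(1) wf this] show ?thesis by simp
qed

section \<open>Types of types, subject reduction\<close>

lemma typing_entry: "wf_ctx \<Gamma> \<Longrightarrow> i < length \<Gamma> \<Longrightarrow> \<exists>s. is_sort s \<and> (\<Gamma> \<turnstile> entry \<Gamma> i : s)"
proof (induction \<Gamma> arbitrary: i)
  case (Cons A \<Gamma>)
  from Cons.prems(1) obtain s where s: "wf_ctx \<Gamma>" "\<Gamma> \<turnstile> A : s" "is_sort s" by (rule wf_ConsE)
  have "\<exists>B s'. entry (A # \<Gamma>) i = ren Suc B \<and> is_sort s' \<and> (\<Gamma> \<turnstile> B : s')"
    using Cons.prems(2) Cons.IH[OF s(1)] s by (cases i) auto
  then show ?case using typing_weaken[OF _ s(2,3)] by force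
qed simp

lemma typing_Type_sort: "wf_ctx \<Gamma> \<Longrightarrow> is_sort s \<Longrightarrow> \<exists>s'. is_sort s' \<and> (\<Gamma> \<turnstile> s : s')"
  unfolding is_sort_def by (blast intro: T_Prop T_Type)

lemma typing_type:
  assumes "\<Gamma> \<turnstile> t : T" obtains s where "is_sort s" "\<Gamma> \<turnstile> T : s"
proof -
  from assms have "\<exists>s. is_sort s \<and> (\<Gamma> \<turnstile> T : s)"
  proof (induction rule: typing_induct)
    case (Var \<Gamma> i) then show ?case using typing_entry by (simp add: entry_def)
  next
    case (App \<Gamma> u A B v)
    then show ?case by (metis gen_All is_sort_psub is_sort_simps subst0 typing_subst)
  qed (metis typing_Type_sort is_sort_simps typing_wf)+
  with that show thesis by blast
qed

lemma subject_reduction1: "\<Gamma> \<turnstile> t : T \<Longrightarrow> beta t t' \<Longrightarrow> \<Gamma> \<turnstile> t' : T"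
proof (induction arbitrary: t' rule: typing_induct)
  case (PP \<Gamma> A B)
  from PP.prems show ?case
  proof (rule beta_AllE)
    fix A' assume A': "t' = All A' B" "beta A A'"
    then have "\<Gamma> \<turnstile> A' : Prop" using PP by blast
    moreover from this have "A' # \<Gamma> \<turnstile> B : Prop"
      using A' by (intro typing_ctx_cumul[OF PP.hyps(2)] betas_cumul(2)) auto
    ultimately show ?thesis using A' PP by (simp add: T_All_Prop_Prop)
  next
    fix B' assume "t' = All A B'" "beta B B'"
    then show ?thesis using PP by (simp add: T_All_Prop_Prop betas_not_occurs[OF r_into_rtranclp])
  qed
next
  case (TP \<Gamma> A i B)
  from TP.prems show ?case
  proof (rule beta_AllE)
    fix A' assume A': "t' = All A' B" "beta A A'"
    then have "\<Gamma> \<turnstile> A' : Type i" using TP by blast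
    moreover from this have "A' # \<Gamma> \<turnstile> B : Prop"
      using A' by (intro typing_ctx_cumul[OF TP.hyps(2)] betas_cumul(2)) auto
    ultimately show ?thesis using A' by (auto intro: T_All_Type_Prop)
  qed (use TP in \<open>auto intro: T_All_Type_Prop\<close>)
next
  case (TT \<Gamma> A i B)
  from TT.prems show ?case
  proof (rule beta_AllE)
    fix A' assume A': "t' = All A' B" "beta A A'"
    then have "\<Gamma> \<turnstile> A' : Type i" using TT by blast
    moreover from this have "A' # \<Gamma> \<turnstile> B : Type i"
      using A' by (intro typing_ctx_cumul[OF TT.hyps(2)] betas_cumul(2)) auto
    ultimately show ?thesis using A' by (auto intro: T_All_Type_Type)
  qed (use TT in \<open>auto intro: T_All_Type_Type\<close>)
next
  case (Lam \<Gamma> A t B s)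
  from Lam.prems show ?case
  proof (rule beta_LamE)
    fix A' assume A': "t' = Lam A' t" "beta A A'"
    then have "\<Gamma> \<turnstile> All A' B : s" using Lam by (auto intro: beta.intros)
    moreover from this obtain s' where "\<Gamma> \<turnstile> A' : s'" "is_sort s'" by (rule typing_All_sorts)
    \<comment> \<open>The reduct is first given the type \<open>All A' B\<close>, which is then
      converted back to \<open>All A B\<close>.\<close>
    moreover have "A' \<preceq> A" "All A' B \<preceq> All A B"
      using A' by (auto intro!: betas_cumul(2) beta.intros)
    ultimately show ?thesis
      using Lam A' by (metis T_Cumul T_Lam typing_ctx_cumul)
  qed (use Lam in \<open>auto intro: T_Lam\<close>)
next
  case (App \<Gamma> u A B v)
  have "\<Gamma> \<turnstile> App u v : subst v 0 B" using App by (auto intro: T_App)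
  then obtain s where s: "is_sort s" "\<Gamma> \<turnstile> subst v 0 B : s" by (rule typing_type)
  from App.prems show ?case
  proof (cases rule: beta.cases)
    case (beta_redex A' t)
    with App have "\<Gamma> \<turnstile> Lam A' t : All A B" by simp
    then obtain B' s' where *: "A' # \<Gamma> \<turnstile> t : B'" "\<Gamma> \<turnstile> All A' B' : s'" "All A' B' \<preceq> All A B"
      by (rule gen_Lam)
    \<comment> \<open>Injectivity of products relates the domain and codomain of the abstraction
      itself to the expected ones; the argument is converted to \<open>A'\<close> before it is
      substituted.\<close>
    then have "A \<preceq> A'" "B' \<preceq> B" by (auto dest: cumul_All_All intro: beta_eq_sym cumul_conv)
    moreover obtain s'' where "\<Gamma> \<turnstile> A' : s''" "is_sort s''" using *(1) by (rule typing_ConsE)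
    ultimately have "\<Gamma> \<turnstile> subst v 0 t : subst v 0 B'"
      using * App by (meson typing_subst T_Cumul)
    then have "\<Gamma> \<turnstile> subst v 0 t : subst v 0 B" using s \<open>B' \<preceq> B\<close> by (meson T_Cumul cumul_subst)
    then show ?thesis using beta_redex by simp
  next
    case (beta_App2 v')
    then have "\<Gamma> \<turnstile> App u v' : subst v' 0 B" using App by (auto intro: T_App)
    moreover have "subst v' 0 B \<preceq> subst v 0 B"
      using beta_App2 by (auto intro: beta_subst_arg beta_eq_sym cumul_conv)
    ultimately have "\<Gamma> \<turnstile> App u v' : subst v 0 B" using s by (meson T_Cumul)
    then show ?thesis using beta_App2 by simp
  qed (use App in \<open>auto intro: T_App\<close>)
next
  case (Cumul \<Gamma> t A A' s) then show ?case by (meson T_Cumul)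
qed (auto elim: beta_PropE beta_TypeE beta_VarE)

lemma subject_reduction: "t \<longrightarrow>\<^sub>\<beta> t' \<Longrightarrow> \<Gamma> \<turnstile> t : T \<Longrightarrow> \<Gamma> \<turnstile> t' : T"
  by (induction rule: rtranclp_induct) (auto intro: subject_reduction1)

lemma typing_reduce_type:
  assumes "\<Gamma> \<turnstile> t : T" "T \<longrightarrow>\<^sub>\<beta> T'" shows "\<Gamma> \<turnstile> t : T'"
  using assms by (meson T_Cumul betas_cumul(1) subject_reduction typing_type)

section \<open>Uniqueness of types and stability of being a proof\<close>

text \<open>The lower bound is not claimed to be a type of \<open>t\<close>, nor even to be typed.
  This lets bounds be assembled under binders and substitutions, and it still separates
  \<open>Prop\<close> from \<open>Type i\<close>.\<close>

lemma types_common: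
  "\<Gamma> \<turnstile> t : T1 \<Longrightarrow> \<Gamma> \<turnstile> t : T2 \<Longrightarrow> \<exists>T. T \<preceq> T1 \<and> T \<preceq> T2"
proof (induction t arbitrary: \<Gamma> T1 T2)
  case (All A B)
  \<comment> \<open>Excludes that one typing puts the product in \<open>Prop\<close> and the other
    in some \<open>Type i\<close>, since its codomain would then have both sorts.\<close>
  have *: False if "A # \<Gamma> \<turnstile> B : Prop" "A # \<Gamma> \<turnstile> B : Type i" for i
    using All.IH(2)[OF that] no_common_Prop_Type by blast
  have **: "\<exists>T. T \<preceq> T1 \<and> T \<preceq> T2" if "Type i \<preceq> T1" "Type j \<preceq> T2" for i j
    using cumul_trans[OF cumul_Type that(1), of "min i j"] cumul_trans[OF cumul_Type that(2), of "min i j"]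
    by auto
  from All.prems show ?case
    by (elim gen_All) (blast dest: * intro: **)+
next
  case (Lam A t)
  from Lam.prems show ?case
    by (elim gen_Lam) (metis Lam.IH(2) beta_eq_refl cumul.intros(2,4))
next
  case (App u v)
  obtain A1 B1 A2 B2 where *: "\<Gamma> \<turnstile> u : All A1 B1" "\<Gamma> \<turnstile> u : All A2 B2"
    "subst v 0 B1 \<preceq> T1" "subst v 0 B2 \<preceq> T2"
    using App.prems by (auto elim!: gen_App)
  from App.IH(1)[OF *(1,2)] obtain U where U: "U \<preceq> All A1 B1" "U \<preceq> All A2 B2" by blast
  from U(1) obtain A B where AB: "U \<longrightarrow>\<^sub>\<beta> All A B" "B \<preceq> B1" by (rule cumul_AllE_right)
  with U(2) have "All A B \<preceq> All A2 B2" by (meson betas_cumul(2) cumul_trans)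
  then have "B \<preceq> B2" by (rule cumul_All_All)
  with AB * show ?case by (meson cumul_subst cumul_trans)
qed (blast dest: gen_Prop gen_Type gen_Var)+

lemma Prop_Type_disjoint: "\<Gamma> \<turnstile> A : Prop \<Longrightarrow> \<Gamma> \<turnstile> A : Type i \<Longrightarrow> False"
  using types_common no_common_Prop_Type by blast

lemma sort_Prop_iff: "\<Gamma> \<turnstile> A : s \<Longrightarrow> is_sort s \<Longrightarrow> \<Gamma> \<turnstile> A : Prop \<longleftrightarrow> s = Prop"
  using Prop_Type_disjoint by (auto simp: is_sort_def)

text \<open>A universe is no proposition, and a product is one only if its codomain is. Hence no
  universe ends the chain of codomains of a proposition, and \<open>scum\<close> has nothing to
  change.\<close>

lemma scum_Prop_left: "scum A B \<Longrightarrow> \<Gamma> \<turnstile> A : Prop \<Longrightarrow> A = B"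
proof (induction arbitrary: \<Gamma> rule: scum.induct)
  case (scum_Type i j)
  then show ?case by (auto dest!: gen_Type cumul_Prop_right)
next
  case (scum_All B B' A)
  from scum_All.prems show ?case
    by (rule gen_All) (auto intro: scum_All.IH dest: cumul_Prop_right)
qed simp

lemma scum_Prop_right: "scum A B \<Longrightarrow> \<Gamma> \<turnstile> B : Prop \<Longrightarrow> A = B"
proof (induction arbitrary: \<Gamma> rule: scum.induct)
  case (scum_Type i j)
  then show ?case by (auto dest!: gen_Type cumul_Prop_right)
next
  case (scum_All B B' A)
  from scum_All.prems show ?case
    by (rule gen_All) (auto intro: scum_All.IH dest: cumul_Prop_right)
qed simp

lemma cumul_Prop_right_iff:
  assumes "A \<preceq> B" "\<Gamma> \<turnstile> A : s" "\<Gamma> \<turnstile> B : s'" "is_sort s" "is_sort s'"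
  shows "s = Prop \<longleftrightarrow> s' = Prop"
proof -
  from assms(1) obtain A' B' where *: "A \<longrightarrow>\<^sub>\<beta> A'" "scum A' B'" "B \<longrightarrow>\<^sub>\<beta> B'" by (rule cumulE)
  with assms have "\<Gamma> \<turnstile> A' : s" "\<Gamma> \<turnstile> B' : s'" by (auto intro: subject_reduction)
  with * assms show ?thesis by (metis scum_Prop_left scum_Prop_right sort_Prop_iff)
qed

text \<open>Replaces the existential quantifier in \<open>proof_term\<close> by any type at hand;
  the stability lemmas for proof terms below rest on this.\<close>

lemma proof_term_iff:
  assumes "\<Gamma> \<turnstile> t : T" shows "proof_term \<Gamma> t \<longleftrightarrow> \<Gamma> \<turnstile> T : Prop"
proof
  assume "proof_term \<Gamma> t"
  then obtain P where P: "\<Gamma> \<turnstile> P : Prop" "\<Gamma> \<turnstile> t : P"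
    by (auto simp: proof_term_def propositional_def)
  from types_common[OF P(2) assms] obtain U where U: "U \<preceq> P" "U \<preceq> T" by blast
  obtain s where s: "is_sort s" "\<Gamma> \<turnstile> T : s" using assms by (rule typing_type)
  \<comment> \<open>\<open>U\<close> may be ill-typed, so propositionality travels from
    \<open>P\<close> to \<open>T\<close> over reducts: \<open>U1\<close> equals \<open>P'\<close>,
    subject reduction leads on to \<open>V\<close>, and \<open>V\<close> equals a reduct of
    \<open>T\<close>.\<close>
  from U obtain U1 P' U2 T' where *: "U \<longrightarrow>\<^sub>\<beta> U1" "scum U1 P'" "P \<longrightarrow>\<^sub>\<beta> P'"
    "U \<longrightarrow>\<^sub>\<beta> U2" "scum U2 T'" "T \<longrightarrow>\<^sub>\<beta> T'" by (meson cumulE)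
  have "\<Gamma> \<turnstile> P' : Prop" using * P by (auto intro: subject_reduction)
  then have "\<Gamma> \<turnstile> U1 : Prop" using * scum_Prop_right by blast
  moreover obtain V where V: "U1 \<longrightarrow>\<^sub>\<beta> V" "U2 \<longrightarrow>\<^sub>\<beta> V" using * betas_confluent by blast
  ultimately have "\<Gamma> \<turnstile> V : Prop" by (auto intro: subject_reduction)
  moreover obtain T'' where "scum V T''" "T' \<longrightarrow>\<^sub>\<beta> T''" using V * scum_betas_right by blast
  ultimately have "\<Gamma> \<turnstile> T'' : Prop" using scum_Prop_left by blast
  moreover have "\<Gamma> \<turnstile> T'' : s" using s * \<open>T' \<longrightarrow>\<^sub>\<beta> T''\<close> by (auto intro: subject_reduction)
  ultimately show "\<Gamma> \<turnstile> T : Prop" using s sort_Prop_iff by blast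
qed (use assms in \<open>auto simp: proof_term_def propositional_def\<close>)

lemma Prop_ren_iff:
  assumes "\<Gamma> \<turnstile> A : s" "is_sort s" "wf_ctx \<Gamma>'" "wt_ren r \<Gamma> \<Gamma>'"
  shows "\<Gamma>' \<turnstile> ren r A : Prop \<longleftrightarrow> \<Gamma> \<turnstile> A : Prop"
  using typing_ren[OF assms(1,3,4)] assms(1,2) by (simp add: sort_Prop_iff)

lemma Prop_psub_iff:
  assumes "\<Gamma> \<turnstile> A : s" "is_sort s" "wf_ctx \<Gamma>'" "wt_sub \<sigma> \<Gamma> \<Gamma>'"
  shows "\<Gamma>' \<turnstile> psub \<sigma> A : Prop \<longleftrightarrow> \<Gamma> \<turnstile> A : Prop"
  using typing_psub[OF assms(1,3,4)] assms(1,2) by (simp add: sort_Prop_iff)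

lemma proof_term_ren:
  assumes "\<Gamma> \<turnstile> t : T" "wf_ctx \<Gamma>'" "wt_ren r \<Gamma> \<Gamma>'"
  shows "proof_term \<Gamma>' (ren r t) \<longleftrightarrow> proof_term \<Gamma> t"
proof -
  obtain s where "is_sort s" "\<Gamma> \<turnstile> T : s" using assms(1) by (rule typing_type)
  with assms typing_ren[OF assms] show ?thesis by (simp add: proof_term_iff Prop_ren_iff)
qed

lemma proof_term_psub:
  assumes "\<Gamma> \<turnstile> t : T" "wf_ctx \<Gamma>'" "wt_sub \<sigma> \<Gamma> \<Gamma>'"
  shows "proof_term \<Gamma>' (psub \<sigma> t) \<longleftrightarrow> proof_term \<Gamma> t"
proof -
  obtain s where "is_sort s" "\<Gamma> \<turnstile> T : s" using assms(1) by (rule typing_type)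
  with assms typing_psub[OF assms] show ?thesis by (simp add: proof_term_iff Prop_psub_iff)
qed

lemma proof_term_beta:
  assumes "\<Gamma> \<turnstile> t : T" "beta t t'" shows "proof_term \<Gamma> t' \<longleftrightarrow> proof_term \<Gamma> t"
  using assms subject_reduction1[OF assms] by (simp add: proof_term_iff)

text \<open>The interpretation depends on the context only through the typing relation.\<close>

definition ctx_equiv :: "ctx \<Rightarrow> ctx \<Rightarrow> bool" where
  "ctx_equiv \<Gamma> \<Gamma>' \<longleftrightarrow> length \<Gamma> = length \<Gamma>' \<and> (\<forall>t T. (\<Gamma> \<turnstile> t : T) \<longleftrightarrow> (\<Gamma>' \<turnstile> t : T))"

lemma ctx_equiv_sym: "ctx_equiv \<Gamma> \<Gamma>' \<Longrightarrow> ctx_equiv \<Gamma>' \<Gamma>"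
  by (auto simp: ctx_equiv_def)

text \<open>The identity is a well-typed substitution between the extended contexts: older variables
  are typed by equivalence of the tails, followed by weakening.\<close>

lemma ctx_equiv_Cons:
  assumes "ctx_equiv \<Gamma> \<Gamma>'" shows "ctx_equiv (A # \<Gamma>) (A # \<Gamma>')"
proof -
  have *: "A # \<Gamma>2 \<turnstile> t : T" if eq: "ctx_equiv \<Gamma>1 \<Gamma>2" and t: "A # \<Gamma>1 \<turnstile> t : T" for \<Gamma>1 \<Gamma>2 t T
  proof -
    from t obtain s where s: "\<Gamma>1 \<turnstile> A : s" "is_sort s" by (rule typing_ConsE)
    with eq have s': "\<Gamma>2 \<turnstile> A : s" by (auto simp: ctx_equiv_def)
    then have wf: "wf_ctx (A # \<Gamma>2)" using s by (auto intro: wf_Cons typing_wf)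
    have "A # \<Gamma>2 \<turnstile> Var (Suc i) : ren Suc (entry \<Gamma>1 i)" if "i < length \<Gamma>1" for i
    proof -
      have "\<Gamma>2 \<turnstile> Var i : entry \<Gamma>1 i"
        using eq that typing_Var[OF typing_wf[OF s(1)]] by (auto simp: ctx_equiv_def)
      from typing_weaken[OF this s' s(2)] show ?thesis by simp
    qed
    then have "wt_sub Var (A # \<Gamma>1) (A # \<Gamma>2)"
      using typing_Var[OF wf, of 0] unfolding wt_sub_def by (auto elim!: less_Suc_cases)
    from typing_psub[OF t wf this] show ?thesis by simp
  qed
  have "length \<Gamma> = length \<Gamma>'" using assms by (simp add: ctx_equiv_def)
  then show ?thesis
    unfolding ctx_equiv_def[of "A # _"] using *[OF assms] *[OF ctx_equiv_sym[OF assms]] by auto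
qed

lemma ctx_equiv_beta:
  assumes "\<Gamma> \<turnstile> A : s" "is_sort s" "beta A A'" shows "ctx_equiv (A # \<Gamma>) (A' # \<Gamma>)"
  using assms subject_reduction1[OF assms(1,3)] typing_ctx_cumul
    betas_cumul[OF r_into_rtranclp, OF assms(3)]
  by (auto simp: ctx_equiv_def)

section \<open>Strengthening\<close>

lemma ren_All_betasE:
  assumes "ren r U \<longrightarrow>\<^sub>\<beta> All A B"
  obtains A' B' where "U \<longrightarrow>\<^sub>\<beta> All A' B'" "A = ren r A'" "B = ren (upr r) B'"
proof -
  from assms obtain U' where "All A B = ren r U'" "U \<longrightarrow>\<^sub>\<beta> U'" by (rule betas_renE)
  with that show thesis by (cases U') auto
qed

lemma is_sort_cumul_ren: "inj r \<Longrightarrow> is_sort s \<Longrightarrow> ren r S \<preceq> s \<Longrightarrow> S \<preceq> s"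
  by (metis cumul_ren_reflect is_sort_ren)

lemma Type_raise: "\<Gamma> \<turnstile> A : Type i \<Longrightarrow> i \<le> j \<Longrightarrow> \<Gamma> \<turnstile> A : Type j"
  by (meson T_Cumul T_Type cumul_Type is_sort_simps(2) typing_wf)

text \<open>Reflects typing along an injective renaming. \<open>T'\<close> may mention variables
  outside the range of \<open>r\<close>, so only a type below it can be pulled back. The last
  assumption keeps the variables of \<open>t\<close> inside \<open>\<Gamma>\<close>.\<close>

lemma typing_unren:
  assumes "\<Gamma>' \<turnstile> ren r t : T'" "wf_ctx \<Gamma>" "wt_ren r \<Gamma> \<Gamma>'" "inj r"
    and "\<And>i. r i < length \<Gamma>' \<Longrightarrow> i < length \<Gamma>"
  shows "\<exists>T. (\<Gamma> \<turnstile> t : T) \<and> ren r T \<preceq> T'"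
  using assms
proof (induction t arbitrary: \<Gamma> \<Gamma>' r T')
  case Prop
  then show ?case using T_Prop[of \<Gamma>] gen_Prop[of \<Gamma>'] by force
next
  case (Type i)
  then show ?case using T_Type[of \<Gamma>] gen_Type[of \<Gamma>'] by force
next
  case (Var i)
  then have "r i < length \<Gamma>'" "entry \<Gamma>' (r i) \<preceq> T'" by (auto dest!: gen_Var simp: entry_def)
  with Var show ?case using typing_Var[of \<Gamma> i] by (auto simp: wt_ren_def)
next
  case (All A B)
  have sort: "\<Gamma> \<turnstile> A : s" if "\<Gamma>' \<turnstile> ren r A : s" "is_sort s" for s
    using All.IH(1)[OF that(1) All.prems(2-5)] is_sort_cumul_ren[OF All.prems(4) that(2)]
    by (meson All.prems(2) T_Cumul that(2) typing_Type_sort)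
  have sort': "A # \<Gamma> \<turnstile> B : s"
    if A: "\<Gamma>' \<turnstile> ren r A : s'" "is_sort s'" and B: "ren r A # \<Gamma>' \<turnstile> ren (upr r) B : s" "is_sort s" for s s'
  proof -
    have wf: "wf_ctx (A # \<Gamma>)" using sort[OF A] A(2) All.prems(2) by (auto intro: wf_Cons)
    have "\<exists>S. (A # \<Gamma> \<turnstile> B : S) \<and> ren (upr r) S \<preceq> s"
    proof (rule All.IH(2)[OF B(1) wf wt_ren_upr[OF All.prems(3)] inj_upr[OF All.prems(4)]])
      fix i assume "upr r i < length (ren r A # \<Gamma>')"
      then show "i < length (A # \<Gamma>)" using All.prems(5) by (cases i) auto
    qed
    with wf B(2) is_sort_cumul_ren[OF inj_upr[OF All.prems(4)] B(2)] show ?thesis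
      by (meson T_Cumul typing_Type_sort)
  qed
  from All.prems(1) show ?case unfolding ren.simps
  proof (cases rule: gen_All)
    case PP
    have "\<not> occurs 0 B" using PP occurs_ren[of 0 B "upr r"] by auto
    with PP sort sort' show ?thesis by (force intro!: exI[of _ Prop] T_All_Prop_Prop)
  next
    case TP
    with sort sort' show ?thesis by (force intro!: exI[of _ Prop] T_All_Type_Prop)
  next
    case (TT i)
    with sort sort' show ?thesis by (force intro!: exI[of _ "Type i"] T_All_Type_Type)
  qed
next
  case (Lam A t)
  from Lam.prems(1) obtain B' s where B': "ren r A # \<Gamma>' \<turnstile> ren (upr r) t : B'"
    "\<Gamma>' \<turnstile> All (ren r A) B' : s" "is_sort s" "All (ren r A) B' \<preceq> T'"
    by (auto elim: gen_Lam)
  have sort: "\<Gamma> \<turnstile> A : s" if "\<Gamma>' \<turnstile> ren r A : s" "is_sort s" for s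
    using Lam.IH(1)[OF that(1) Lam.prems(2-5)] is_sort_cumul_ren[OF Lam.prems(4) that(2)]
    by (meson Lam.prems(2) T_Cumul that(2) typing_Type_sort)
  obtain sA where sA: "\<Gamma>' \<turnstile> ren r A : sA" "is_sort sA" using B'(2) by (rule typing_All_sorts)
  have wf: "wf_ctx (A # \<Gamma>)" using sort[OF sA] sA Lam.prems(2) by (auto intro: wf_Cons)
  have wf': "wf_ctx (ren r A # \<Gamma>')" using B'(1) by (rule typing_wf)
  have wr: "wt_ren (upr r) (A # \<Gamma>) (ren r A # \<Gamma>')" using Lam.prems(3) by (rule wt_ren_upr)
  have "\<exists>B. (A # \<Gamma> \<turnstile> t : B) \<and> ren (upr r) B \<preceq> B'"
  proof (rule Lam.IH(2)[OF B'(1) wf wr inj_upr[OF Lam.prems(4)]])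
    fix i assume "upr r i < length (ren r A # \<Gamma>')"
    then show "i < length (A # \<Gamma>)" using Lam.prems(5) by (cases i) auto
  qed
  then obtain B where B: "A # \<Gamma> \<turnstile> t : B" "ren (upr r) B \<preceq> B'" by blast
  obtain sB where sB: "is_sort sB" "A # \<Gamma> \<turnstile> B : sB" using B(1) by (rule typing_type)
  have rB: "ren r A # \<Gamma>' \<turnstile> ren (upr r) B : sB" using typing_ren[OF sB(2) wf' wr] sB(1) by simp
  \<comment> \<open>\<open>B\<close> may contain index 0 although \<open>B'\<close> does not, which
    would violate the side condition of \<open>T_All_Prop_Prop\<close>. Its reduct
    \<open>B2\<close>, whose renaming is \<open>scum\<close>-related to a reduct of
    \<open>B'\<close>, serves as codomain instead.\<close>
  from B(2) obtain Y Y' where Y: "ren (upr r) B \<longrightarrow>\<^sub>\<beta> Y" "scum Y Y'" "B' \<longrightarrow>\<^sub>\<beta> Y'" by (rule cumulE)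
  then obtain B2 where B2: "Y = ren (upr r) B2" "B \<longrightarrow>\<^sub>\<beta> B2" by (auto elim: betas_renE)
  have tB2: "A # \<Gamma> \<turnstile> t : B2" "A # \<Gamma> \<turnstile> B2 : sB"
    using B B2 sB by (auto intro: typing_reduce_type subject_reduction)
  have "\<exists>s2. is_sort s2 \<and> (\<Gamma> \<turnstile> All A B2 : s2)"
    using B'(2)
  proof (cases rule: gen_All)
    case PP
    have "sB = Prop" using cumul_Prop_right_iff[OF B(2) rB PP(2)] sB by simp
    moreover have "\<not> occurs 0 B2"
    proof -
      have "ren r A # \<Gamma>' \<turnstile> Y' : Prop" using Y PP by (auto intro: subject_reduction)
      then have "Y = Y'" using Y scum_Prop_right by blast
      then have "\<not> occurs 0 (ren (upr r) B2)" using B2 Y PP betas_not_occurs by blast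
      then show ?thesis using occurs_ren[of 0 B2 "upr r"] by auto
    qed
    ultimately show ?thesis using sort PP tB2 by (meson T_All_Prop_Prop is_sort_simps(1))
  next
    case (TP i)
    have "sB = Prop" using cumul_Prop_right_iff[OF B(2) rB TP(2)] sB by simp
    then show ?thesis using sort TP tB2 by (meson T_All_Type_Prop is_sort_simps)
  next
    case (TT i)
    have "sB \<noteq> Prop" using cumul_Prop_right_iff[OF B(2) rB TT(2)] sB by simp
    then obtain j where "sB = Type j" using sB by (auto simp: is_sort_def)
    with tB2 sort[OF TT(1)] have "\<Gamma> \<turnstile> A : Type (max i j)" "A # \<Gamma> \<turnstile> B2 : Type (max i j)"
      by (auto intro: Type_raise)
    then show ?thesis by (meson T_All_Type_Type is_sort_simps(2))
  qed
  then have "\<Gamma> \<turnstile> Lam A t : All A B2" using tB2 by (auto intro: T_Lam)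
  moreover have "All (ren r A) Y \<preceq> All (ren r A) B'"
    using Y by (auto intro!: cumul_All cumulI)
  ultimately show ?case using cumul_trans[OF _ B'(4)] B2(1) by (metis ren.simps(4))
next
  case (App u v)
  from App.prems(1) obtain A1 B1 where *: "\<Gamma>' \<turnstile> ren r u : All A1 B1" "\<Gamma>' \<turnstile> ren r v : A1"
    "subst (ren r v) 0 B1 \<preceq> T'" by (auto elim: gen_App)
  from App.IH(1)[OF *(1) App.prems(2-5)] obtain U where U: "\<Gamma> \<turnstile> u : U" "ren r U \<preceq> All A1 B1"
    by blast
  from U(2) obtain A2 B2 where A2: "ren r U \<longrightarrow>\<^sub>\<beta> All A2 B2" "A2 =\<^sub>\<beta> A1" "B2 \<preceq> B1"
    by (rule cumul_AllE_right)
  from A2(1) obtain A3 B3 where A3: "U \<longrightarrow>\<^sub>\<beta> All A3 B3" "A2 = ren r A3" "B2 = ren (upr r) B3"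
    by (rule ren_All_betasE)
  have u: "\<Gamma> \<turnstile> u : All A3 B3" using U(1) A3(1) by (rule typing_reduce_type)
  then obtain sU where "\<Gamma> \<turnstile> All A3 B3 : sU" by (rule typing_type)
  then obtain sA where sA: "\<Gamma> \<turnstile> A3 : sA" "is_sort sA" by (rule typing_All_sorts)
  from App.IH(2)[OF *(2) App.prems(2-5)] obtain V where V: "\<Gamma> \<turnstile> v : V" "ren r V \<preceq> A1" by blast
  then have "ren r V \<preceq> ren r A3" using A2(2) A3(2) by (metis beta_eq_sym cumul.intros(1,2))
  then have "V \<preceq> A3" by (rule cumul_ren_reflect[OF App.prems(4)])
  with V sA have "\<Gamma> \<turnstile> v : A3" by (meson T_Cumul)
  with u have "\<Gamma> \<turnstile> App u v : subst v 0 B3" by (rule T_App)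
  moreover have "ren r (subst v 0 B3) \<preceq> T'"
    using cumul_trans[OF cumul_subst[OF A2(3)] *(3)] A3(3) by (simp add: ren_subst)
  ultimately show ?case by blast
qed

lemma lower_Prop:
  assumes "P # \<Gamma> \<turnstile> Q : Prop" "\<not> occurs 0 Q" shows "\<Gamma> \<turnstile> lower 0 Q : Prop"
proof -
  have wf: "wf_ctx \<Gamma>" using typing_wf[OF assms(1)] by (rule wf_ConsE)
  have "\<exists>T. (\<Gamma> \<turnstile> lower 0 Q : T) \<and> ren Suc T \<preceq> Prop"
    using assms wf by (intro typing_unren[of "P # \<Gamma>"]) (auto simp: ren_Suc_lower wt_ren_Suc)
  then show ?thesis
    by (metis T_Cumul T_Prop inj_Suc is_sort_cumul_ren is_sort_simps wf)
qed

section \<open>Set theory\<close>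

definition is_set :: "'v::zfc set \<Rightarrow> bool" where
  "is_set A \<longleftrightarrow> (\<exists>x. elts x = A)"

lemma is_set_elts [simp]: "is_set (elts x)"
  by (auto simp: is_set_def)

lemma elts_inject [simp]: "elts x = elts y \<longleftrightarrow> x = y"
  by (auto dest: extensionality)

lemma VSet_elts [simp]: "VSet (elts x) = x"
  unfolding VSet_def by simp

lemma elts_VSet [simp]: "is_set A \<Longrightarrow> elts (VSet A) = A"
  by (auto simp: is_set_def)

lemma is_set_subset:
  fixes A :: "'v::zfc set"
  assumes "is_set B" "A \<subseteq> B" shows "is_set A"
proof -
  obtain x :: 'v where "elts x = B" using assms(1) by (auto simp: is_set_def)
  with assms(2) have "{z \<in> elts x. z \<in> A} = A" by auto
  with separation[of x "\<lambda>z. z \<in> A"] show ?thesis by (simp add: is_set_def)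
qed

lemma is_set_image: "is_set A \<Longrightarrow> is_set (f ` A)" for f :: "'v::zfc \<Rightarrow> 'v"
  using replacement[of f] by (auto simp: is_set_def)

lemma is_set_doubleton [simp]: "is_set {a, b}"
  using pairing by (auto simp: is_set_def)

lemma is_set_singleton [simp]: "is_set {a}"
  using is_set_doubleton[of a a] by simp

lemma is_set_UN:
  fixes B :: "'v::zfc \<Rightarrow> 'v set"
  assumes "is_set A" "\<And>a. a \<in> A \<Longrightarrow> is_set (B a)" shows "is_set (\<Union>a\<in>A. B a)"
proof -
  obtain x where x: "elts x = (\<lambda>a. VSet (B a)) ` A"
    using is_set_image[OF assms(1), of "\<lambda>a. VSet (B a)"] by (auto simp: is_set_def)
  have "(\<Union>z\<in>elts x. elts z) = (\<Union>a\<in>A. B a)" using assms(2) by (auto simp: x)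
  then show ?thesis using union[of x] by (auto simp: is_set_def)
qed

lemma is_set_Pow: "is_set A \<Longrightarrow> is_set {z. elts z \<subseteq> A}"
  using powerset by (auto simp: is_set_def)

lemma not_mem_self: "x \<notin> elts (x::'v::zfc)"
  using wf_not_refl[OF foundation] by simp

lemma not_mem_sym: "x \<in> elts y \<Longrightarrow> y \<notin> elts (x::'v::zfc)"
  using wf_not_sym[OF foundation] by simp

lemmas mem_induct = wf_induct_rule[OF foundation, simplified, case_names mem]

section \<open>Pairs, functions and dependent products as sets\<close>

lemma vpair_inject [simp]: "vpair a b = vpair c d \<longleftrightarrow> a = c \<and> b = d"
proof
  assume "vpair a b = vpair c d"
  then have "elts (vpair a b) = elts (vpair c d)" by simp
  then have "{VSet {a}, VSet {a, b}} = {VSet {c}, VSet {c, d}}" by (simp add: vpair_def)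
  moreover have "VSet A = VSet B \<longleftrightarrow> A = B" if "is_set A" "is_set B" for A B :: "'a set"
    using that by (metis elts_VSet)
  ultimately show "a = c \<and> b = d" by (auto simp: doubleton_eq_iff)
qed auto

lemma elts_vlam: "is_set D \<Longrightarrow> elts (vlam D f) = (\<lambda>a. vpair a (f a)) ` D"
  unfolding vlam_def by (simp add: is_set_image)

lemma vapp_vlam: "is_set D \<Longrightarrow> a \<in> D \<Longrightarrow> vapp (vlam D f) a = f a"
  unfolding vapp_def by (auto simp: elts_vlam)

lemma elts_vPi:
  assumes "is_set D"
  shows "elts (vPi D B) = {f. elts f \<subseteq> {vpair a b | a b. a \<in> D \<and> b \<in> elts (B a)} \<and>
                      (\<forall>a\<in>D. \<exists>!b. vpair a b \<in> elts f)}"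
proof -
  \<comment> \<open>All candidate graphs are subsets of this set of pairs, so by the power set axiom
    they form a set and \<open>VSet\<close> is meaningful in \<open>vPi\<close>.\<close>
  have "is_set (\<Union>a\<in>D. \<Union>b\<in>elts (B a). {vpair a b})"
    using assms by (intro is_set_UN) auto
  moreover have "(\<Union>a\<in>D. \<Union>b\<in>elts (B a). {vpair a b}) = {vpair a b | a b. a \<in> D \<and> b \<in> elts (B a)}"
    by auto
  ultimately have "is_set {vpair a b | a b. a \<in> D \<and> b \<in> elts (B a)}" by simp
  from is_set_Pow[OF this] show ?thesis
    unfolding vPi_def by (intro elts_VSet) (auto elim: is_set_subset)
qed

lemma vlam_in_vPi:
  assumes "is_set D" "\<And>a. a \<in> D \<Longrightarrow> f a \<in> elts (B a)" shows "vlam D f \<in> elts (vPi D B)"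
  using assms by (auto simp: elts_vPi elts_vlam)

lemma vPi_total: "is_set D \<Longrightarrow> f \<in> elts (vPi D B) \<Longrightarrow> a \<in> D \<Longrightarrow> \<exists>b. vpair a b \<in> elts f"
  by (auto simp: elts_vPi)

lemma vapp_in_vPi:
  assumes "is_set D" "f \<in> elts (vPi D B)" "a \<in> D" shows "vapp f a \<in> elts (B a)"
proof -
  have "\<exists>!b. vpair a b \<in> elts f" and sub: "elts f \<subseteq> {vpair a b | a b. a \<in> D \<and> b \<in> elts (B a)}"
    using assms by (auto simp: elts_vPi)
  then have "vpair a (vapp f a) \<in> elts f" unfolding vapp_def by (rule_tac theI')
  with sub show ?thesis by auto
qed

lemma vPi_mono:
  assumes "is_set D" "\<And>a. a \<in> D \<Longrightarrow> elts (B a) \<subseteq> elts (B' a)" shows "elts (vPi D B) \<subseteq> elts (vPi D B')"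
  using assms by (simp add: elts_vPi) blast

lemma vPi_cong: "D = D' \<Longrightarrow> (\<And>a. a \<in> D' \<Longrightarrow> B a = B' a) \<Longrightarrow> vPi D B = vPi D' B'"
  unfolding vPi_def by (rule arg_cong[of _ _ VSet]) (auto simp: subset_eq)

lemma vlam_cong: "D = D' \<Longrightarrow> (\<And>a. a \<in> D' \<Longrightarrow> f a = g a) \<Longrightarrow> vlam D f = vlam D' g"
  unfolding vlam_def by (rule arg_cong[of _ _ VSet]) auto

section \<open>Ordinals and the cumulative hierarchy\<close>

lemma ordinal_mem: "ordinal x \<Longrightarrow> y \<in> elts x \<Longrightarrow> ordinal y"
  unfolding ordinal_def transitive_set_def by blast

lemma ordinal_trans: "ordinal z \<Longrightarrow> x \<in> elts y \<Longrightarrow> y \<in> elts z \<Longrightarrow> x \<in> elts z"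
  unfolding ordinal_def transitive_set_def by blast

text \<open>Nested \<in>-induction: were the two incomparable, extensionality would give a member of
  one outside the other. The induction hypothesis compares this member with the other ordinal, and
  transitivity contradicts incomparability.\<close>

lemma ordinal_linear: "ordinal x \<Longrightarrow> ordinal y \<Longrightarrow> x \<in> elts y \<or> x = y \<or> y \<in> elts x"
proof (induction x arbitrary: y rule: mem_induct)
  case (mem x)
  note x = mem
  from \<open>ordinal y\<close> show ?case
  proof (induction y rule: mem_induct)
    case (mem y)
    show ?case
    proof (rule ccontr)
      assume neg: "\<not> (x \<in> elts y \<or> x = y \<or> y \<in> elts x)"
      moreover have "elts x \<subseteq> elts y \<Longrightarrow> elts y \<subseteq> elts x \<Longrightarrow> x = y"
        by (metis elts_inject subset_antisym)
      ultimately consider z where "z \<in> elts x" "z \<notin> elts y" | z where "z \<in> elts y" "z \<notin> elts x"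
        by blast
      then show False
      proof cases
        case 1
        then have "z = y \<or> y \<in> elts z" using x mem.prems ordinal_mem by blast
        then show False using neg 1 x(2) ordinal_trans by blast
      next
        case 2
        then have "x = z \<or> x \<in> elts z" using x mem ordinal_mem by blast
        then show False using neg 2 mem.prems ordinal_trans by blast
      qed
    qed
  qed
qed

declare Vlevel.simps [simp del]

lemma mem_Vlevel: "x \<in> elts (Vlevel \<alpha>) \<longleftrightarrow> (\<exists>\<beta>\<in>elts \<alpha>. elts x \<subseteq> elts (Vlevel \<beta>))"
proof -
  have "is_set (\<Union>\<beta>\<in>elts \<alpha>. {x. elts x \<subseteq> elts (Vlevel \<beta>)})"
    by (intro is_set_UN is_set_Pow) simp_all
  then show ?thesis by (subst Vlevel.simps) simp
qed

lemma Vlevel_mono: "ordinal \<alpha> \<Longrightarrow> \<beta> \<in> elts \<alpha> \<Longrightarrow> elts (Vlevel \<beta>) \<subseteq> elts (Vlevel \<alpha>)"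
  unfolding subset_iff[of "elts (Vlevel _)"] mem_Vlevel by (blast intro: ordinal_trans)

lemma Vlevel_transitive: "ordinal \<alpha> \<Longrightarrow> x \<in> elts (Vlevel \<alpha>) \<Longrightarrow> elts x \<subseteq> elts (Vlevel \<alpha>)"
  by (metis Vlevel_mono mem_Vlevel subset_trans)

lemma subset_Vlevel_imp_mem:
  "\<beta> \<in> elts \<alpha> \<Longrightarrow> elts x \<subseteq> elts (Vlevel \<beta>) \<Longrightarrow> x \<in> elts (Vlevel \<alpha>)"
  by (auto simp: mem_Vlevel)

text \<open>Kuratowski pairs cost two levels: one for the singleton and the doubleton, one for the
  pair of these.\<close>

lemma vpair_mem_Vlevel:
  assumes "a \<in> elts (Vlevel \<alpha>)" "b \<in> elts (Vlevel \<alpha>)" "\<alpha> \<in> elts \<beta>" "\<beta> \<in> elts \<gamma>"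
  shows "vpair a b \<in> elts (Vlevel \<gamma>)"
proof -
  have "VSet {a} \<in> elts (Vlevel \<beta>)" "VSet {a, b} \<in> elts (Vlevel \<beta>)"
    using assms by (auto intro!: subset_Vlevel_imp_mem[OF assms(3)])
  then show ?thesis by (auto simp: vpair_def intro!: subset_Vlevel_imp_mem[OF assms(4)])
qed

subsection \<open>Inaccessible cardinals\<close>

text \<open>Membership well-orders \<kappa>. A smaller cardinal is isomorphic to a proper initial
  segment of this order, and the segment below \<open>a\<close> is contained in
  \<open>elts a\<close>. \<open>A\<close> may have any element type.\<close>

lemma lesspoll_ordinalE:
  fixes \<kappa> :: "'v::zfc"
  assumes "ordinal \<kappa>" "A \<prec> elts \<kappa>" obtains \<alpha> where "\<alpha> \<in> elts \<kappa>" "A \<lesssim> elts \<alpha>"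
proof -
  define r where "r = {(x, y). x \<in> elts \<kappa> \<and> y \<in> elts \<kappa> \<and> (x = y \<or> x \<in> elts y)}"
  have Field: "Field r = elts \<kappa>" by (auto simp: r_def Field_def)
  have "wf (r - Id)" by (rule wf_subset[OF foundation]) (auto simp: r_def)
  moreover have "x \<in> elts y \<or> x = y \<or> y \<in> elts x" if "x \<in> elts \<kappa>" "y \<in> elts \<kappa>" for x y
    using that assms(1) ordinal_mem ordinal_linear by blast
  then have "total_on (elts \<kappa>) r" unfolding total_on_def r_def by blast
  moreover have "x \<in> elts z" if "x \<in> elts y" "y \<in> elts z" "z \<in> elts \<kappa>" for x y z
    using that assms(1) ordinal_mem ordinal_trans by blast
  then have "trans r" unfolding trans_def r_def by blast
  moreover have "antisym r" unfolding antisym_def r_def using not_mem_sym by blast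
  moreover have "refl_on (elts \<kappa>) r" "r \<subseteq> elts \<kappa> \<times> elts \<kappa>" unfolding refl_on_def r_def by blast+
  ultimately have wo: "well_order_on (elts \<kappa>) r"
    unfolding well_order_on_def linear_order_on_def partial_order_on_def preorder_on_def by blast
  then have Wo: "Well_order r" by (simp add: Field)
  have "A \<lesssim> elts \<kappa>" "\<not> A \<approx> elts \<kappa>" using assms(2) by (auto simp: lesspoll_def)
  then have "ordLess2 (card_of A) (card_of (elts \<kappa>))"
    by (meson card_of_ordLeq eqpoll_iff_card_of_ordIso lepoll_def ordLeq_iff_ordLess_or_ordIso)
  then have "ordLess2 (card_of A) r" using card_of_least[OF wo] ordLess_ordLeq_trans by blast
  then obtain a where a: "a \<in> elts \<kappa>" "ordIso2 (card_of A) (Restr r (underS r a))"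
    using ordLess_iff_ordIso_Restr[OF Wo card_of_Well_order] Field by blast
  have "ordLeq3 (card_of A) (card_of (Field (Restr r (underS r a))))"
    using card_of_mono2[OF ordIso_imp_ordLeq[OF a(2)]] by (simp only: Field_card_of)
  moreover have "Field (Restr r (underS r a)) \<subseteq> elts a"
    by (auto simp: r_def underS_def Field_def)
  ultimately have "A \<lesssim> elts a"
    by (meson card_of_ordLeq lepoll_def subset_imp_lepoll lepoll_trans)
  with a(1) that show thesis by blast
qed

lemma inaccessibleD:
  assumes "inaccessible \<kappa>"
  shows "ordinal \<kappa>" "infinite (elts \<kappa>)" "\<alpha> \<in> elts \<kappa> \<Longrightarrow> Pow (elts \<alpha>) \<prec> elts \<kappa>"
  using assms countable_finite by (auto simp: inaccessible_def)

text \<open>Regularity in \<open>inaccessible\<close> speaks of families indexed by a member of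
  \<kappa>. A non-empty index set of smaller cardinality is the image of such a member.\<close>

lemma inaccessible_bounded:
  assumes \<kappa>: "inaccessible \<kappa>" and I: "I \<prec> elts \<kappa>" and f: "f ` I \<subseteq> elts \<kappa>"
  obtains \<beta> where "\<beta> \<in> elts \<kappa>" "f ` I \<subseteq> elts \<beta>"
proof (cases "I = {}")
  case True
  have "elts \<kappa> \<noteq> {}" using inaccessibleD(2)[OF \<kappa>] by auto
  with True that show thesis by blast
next
  case False
  obtain \<alpha> where \<alpha>: "\<alpha> \<in> elts \<kappa>" "I \<lesssim> elts \<alpha>"
    using lesspoll_ordinalE[OF inaccessibleD(1)[OF \<kappa>] I] .
  then obtain g where "inj_on g I" "g ` I \<subseteq> elts \<alpha>" by (auto simp: lepoll_def)
  then obtain h where h: "h ` elts \<alpha> = I" using inj_on_iff_surj[OF False, of "elts \<alpha>"] by blast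
  then have "(f \<circ> h) ` elts \<alpha> \<subseteq> elts \<kappa>" using f by auto
  then obtain \<beta> where "\<beta> \<in> elts \<kappa>" "(f \<circ> h) ` elts \<alpha> \<subseteq> elts \<beta>"
    using \<kappa> \<alpha>(1) unfolding inaccessible_def by meson
  moreover have "(f \<circ> h) ` elts \<alpha> = f ` I" by (simp only: image_comp[symmetric] h)
  ultimately show thesis using that by simp
qed

lemma inaccessible_mem_less:
  assumes "inaccessible \<kappa>" "\<alpha> \<in> elts \<kappa>" shows "elts \<alpha> \<prec> elts \<kappa>"
  using lesspoll_trans1[OF lepoll_Pow_self inaccessibleD(3)[OF assms]] .

text \<open>Regularity for the one-element family \<alpha> already yields a member of \<kappa> above
  \<alpha>.\<close>

lemma inaccessible_limit:
  assumes "inaccessible \<kappa>" "\<alpha> \<in> elts \<kappa>" obtains \<beta> where "\<beta> \<in> elts \<kappa>" "\<alpha> \<in> elts \<beta>"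
proof -
  have "{()} \<prec> elts \<kappa>" using inaccessibleD(2)[OF assms(1)] by (simp add: finite_lesspoll_infinite)
  from inaccessible_bounded[OF assms(1) this, of "\<lambda>_. \<alpha>"] assms(2) that show thesis by auto
qed

lemma inaccessible_UN:
  assumes \<kappa>: "inaccessible \<kappa>" and I: "I \<prec> elts \<kappa>" and A: "\<And>i. i \<in> I \<Longrightarrow> A i \<prec> elts \<kappa>"
  shows "(\<Union>i\<in>I. A i) \<prec> elts \<kappa>"
proof -
  have "\<exists>\<beta>. \<beta> \<in> elts \<kappa> \<and> A i \<lesssim> elts \<beta>" if "i \<in> I" for i
    using lesspoll_ordinalE[OF inaccessibleD(1)[OF \<kappa>] A[OF that]] by blast
  then obtain b where b: "\<And>i. i \<in> I \<Longrightarrow> b i \<in> elts \<kappa> \<and> A i \<lesssim> elts (b i)" by metis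
  then obtain \<beta> where \<beta>: "\<beta> \<in> elts \<kappa>" "b ` I \<subseteq> elts \<beta>"
    using inaccessible_bounded[OF \<kappa> I, of b] by blast
  obtain \<alpha> where \<alpha>: "\<alpha> \<in> elts \<kappa>" "I \<lesssim> elts \<alpha>"
    using lesspoll_ordinalE[OF inaccessibleD(1)[OF \<kappa>] I] .
  note ord = ordinal_mem[OF inaccessibleD(1)[OF \<kappa>]]
  have "elts \<alpha> \<subseteq> elts \<beta> \<or> elts \<beta> \<subseteq> elts \<alpha>"
    using ordinal_linear[OF ord[OF \<alpha>(1)] ord[OF \<beta>(1)]] ord \<alpha>(1) \<beta>(1) ordinal_trans by blast
  then obtain \<gamma> where \<gamma>: "\<gamma> \<in> elts \<kappa>" "elts \<alpha> \<subseteq> elts \<gamma>" "elts \<beta> \<subseteq> elts \<gamma>"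
    using \<alpha>(1) \<beta>(1) by blast
  have I\<gamma>: "I \<lesssim> elts \<gamma>" using \<alpha>(2) \<gamma>(2) by (meson lepoll_trans subset_imp_lepoll)
  have A\<gamma>: "A i \<lesssim> elts \<gamma>" if "i \<in> I" for i
  proof -
    have "elts (b i) \<subseteq> elts \<gamma>" using that \<beta>(2) \<gamma>(1,3) ord ordinal_trans by blast
    then show ?thesis using b[OF that] by (meson lepoll_trans subset_imp_lepoll)
  qed
  show ?thesis
  \<comment> \<open>\<open>\<gamma>\<close> bounds the index set and all members of the family. If
    it is infinite, so many sets of at most that size have a union of at most that size; otherwise
    the union is finite, while \<kappa> is infinite.\<close>
  proof (cases "finite (elts \<gamma>)")
    case True
    have "finite I" using I\<gamma> True unfolding lepoll_def by (blast intro: inj_on_finite)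
    moreover have "finite (A i)" if "i \<in> I" for i
      using A\<gamma>[OF that] True unfolding lepoll_def by (blast intro: inj_on_finite)
    ultimately have "finite (\<Union>i\<in>I. A i)" by simp
    then show ?thesis using inaccessibleD(2)[OF \<kappa>] by (rule finite_lesspoll_infinite[rotated])
  next
    case False
    then have "ordLeq3 (card_of (\<Union>i\<in>I. A i)) (card_of (elts \<gamma>))"
      using I\<gamma> A\<gamma> unfolding lepoll_def card_of_ordLeq by (intro card_of_UNION_ordLeq_infinite ballI)
    then have "(\<Union>i\<in>I. A i) \<lesssim> elts \<gamma>" unfolding lepoll_def card_of_ordLeq .
    then show ?thesis using inaccessible_mem_less[OF \<kappa> \<gamma>(1)] by (rule lesspoll_trans1)
  qed
qed

lemma inaccessible_Pow:
  assumes "inaccessible \<kappa>" "A \<prec> elts \<kappa>" shows "Pow A \<prec> elts \<kappa>"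
proof -
  obtain \<alpha> where \<alpha>: "\<alpha> \<in> elts \<kappa>" "A \<lesssim> elts \<alpha>"
    using lesspoll_ordinalE[OF inaccessibleD(1)[OF assms(1)] assms(2)] .
  then obtain f where "inj_on f A" "f ` A \<subseteq> elts \<alpha>" by (auto simp: lepoll_def)
  then have "inj_on (image f) (Pow A)" "image f ` Pow A \<subseteq> Pow (elts \<alpha>)"
    by (auto intro: inj_on_image_Pow)
  then have "Pow A \<lesssim> Pow (elts \<alpha>)" unfolding lepoll_def by blast
  then show ?thesis using inaccessibleD(3)[OF assms(1) \<alpha>(1)] by (rule lesspoll_trans1)
qed

text \<open>The strong limit property handles the power set of each lower level, regularity the
  union over these levels.\<close>

lemma Vlevel_less_inaccessible:
  assumes "inaccessible \<kappa>" shows "\<beta> \<in> elts \<kappa> \<Longrightarrow> elts (Vlevel \<beta>) \<prec> elts \<kappa>"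
proof (induction \<beta> rule: mem_induct)
  case (mem \<beta>)
  have "{x. elts x \<subseteq> elts (Vlevel \<gamma>)} \<prec> elts \<kappa>" if "\<gamma> \<in> elts \<beta>" for \<gamma>
  proof -
    have "\<gamma> \<in> elts \<kappa>" using that mem.prems inaccessibleD(1)[OF assms] ordinal_trans by blast
    then have "Pow (elts (Vlevel \<gamma>)) \<prec> elts \<kappa>" using mem.IH that assms by (auto intro: inaccessible_Pow)
    moreover have "{x. elts x \<subseteq> elts (Vlevel \<gamma>)} \<lesssim> Pow (elts (Vlevel \<gamma>))"
      unfolding lepoll_def by (intro exI[of _ elts]) (auto simp: inj_on_def)
    ultimately show ?thesis by (meson lesspoll_trans1)
  qed
  moreover have "elts (Vlevel \<beta>) = (\<Union>\<gamma>\<in>elts \<beta>. {x. elts x \<subseteq> elts (Vlevel \<gamma>)})"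
    by (intro set_eqI) (simp add: mem_Vlevel)
  ultimately show ?case
    using inaccessible_UN[OF assms inaccessible_mem_less[OF assms mem.prems]] by metis
qed

lemma mem_Vlevel_less:
  assumes "inaccessible \<kappa>" "x \<in> elts (Vlevel \<kappa>)" shows "elts x \<prec> elts \<kappa>"
proof -
  obtain \<beta> where "\<beta> \<in> elts \<kappa>" "elts x \<subseteq> elts (Vlevel \<beta>)" using assms(2) by (auto simp: mem_Vlevel)
  then show ?thesis
    using Vlevel_less_inaccessible[OF assms(1)] lesspoll_trans1[OF subset_imp_lepoll] by blast
qed

lemma family_bounded:
  assumes \<kappa>: "inaccessible \<kappa>" and I: "I \<prec> elts \<kappa>" and f: "\<And>i. i \<in> I \<Longrightarrow> f i \<in> elts (Vlevel \<kappa>)"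
  obtains \<beta> where "\<beta> \<in> elts \<kappa>" "\<And>i. i \<in> I \<Longrightarrow> f i \<in> elts (Vlevel \<beta>)"
proof -
  from f obtain b where b: "\<And>i. i \<in> I \<Longrightarrow> b i \<in> elts \<kappa> \<and> elts (f i) \<subseteq> elts (Vlevel (b i))"
    unfolding mem_Vlevel by metis
  then obtain \<beta> where \<beta>: "\<beta> \<in> elts \<kappa>" "b ` I \<subseteq> elts \<beta>"
    using inaccessible_bounded[OF \<kappa> I, of b] by blast
  have "f i \<in> elts (Vlevel \<beta>)" if "i \<in> I" for i
    using that b[OF that] \<beta>(2) subset_Vlevel_imp_mem by blast
  then show thesis using that \<beta>(1) by blast
qed

lemma vPi_mem_Vlevel:
  assumes \<kappa>: "inaccessible \<kappa>" and a: "a \<in> elts (Vlevel \<kappa>)"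
    and B: "\<And>x. x \<in> elts a \<Longrightarrow> B x \<in> elts (Vlevel \<kappa>)"
  shows "vPi (elts a) B \<in> elts (Vlevel \<kappa>)"
proof -
  note ord = ordinal_mem[OF inaccessibleD(1)[OF \<kappa>]]
  have "insert a (B ` elts a) \<subseteq> elts (Vlevel \<kappa>)" using a B by auto
  moreover have "elts a \<prec> elts \<kappa>" using mem_Vlevel_less[OF \<kappa> a] .
  ultimately obtain \<beta> where \<beta>: "\<beta> \<in> elts \<kappa>" "\<And>x. x \<in> elts a \<Longrightarrow> B x \<in> elts (Vlevel \<beta>)"
    using family_bounded[OF \<kappa>, of "elts a" B] B by blast
  obtain \<alpha> where \<alpha>: "\<alpha> \<in> elts \<kappa>" "elts a \<subseteq> elts (Vlevel \<alpha>)" using a by (auto simp: mem_Vlevel)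
  have "elts (Vlevel \<alpha>) \<subseteq> elts (Vlevel \<beta>) \<or> elts (Vlevel \<beta>) \<subseteq> elts (Vlevel \<alpha>)"
    using ordinal_linear[OF ord[OF \<alpha>(1)] ord[OF \<beta>(1)]] ord \<alpha>(1) \<beta>(1) Vlevel_mono by blast
  then obtain \<gamma> where \<gamma>: "\<gamma> \<in> elts \<kappa>" "elts (Vlevel \<alpha>) \<subseteq> elts (Vlevel \<gamma>)"
    "elts (Vlevel \<beta>) \<subseteq> elts (Vlevel \<gamma>)"
    using \<alpha>(1) \<beta>(1) by blast
  \<comment> \<open>Above the level holding arguments and values, \<open>\<gamma>2\<close> makes
    room for pairs and \<open>\<gamma>3\<close> for graphs; the set of graphs is then a subset of a
    level below \<kappa>.\<close>
  obtain \<gamma>1 where \<gamma>1: "\<gamma>1 \<in> elts \<kappa>" "\<gamma> \<in> elts \<gamma>1" using inaccessible_limit[OF \<kappa> \<gamma>(1)] .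
  obtain \<gamma>2 where \<gamma>2: "\<gamma>2 \<in> elts \<kappa>" "\<gamma>1 \<in> elts \<gamma>2" using inaccessible_limit[OF \<kappa> \<gamma>1(1)] .
  obtain \<gamma>3 where \<gamma>3: "\<gamma>3 \<in> elts \<kappa>" "\<gamma>2 \<in> elts \<gamma>3" using inaccessible_limit[OF \<kappa> \<gamma>2(1)] .
  have "vpair x y \<in> elts (Vlevel \<gamma>2)" if "x \<in> elts a" "y \<in> elts (B x)" for x y
  proof (rule vpair_mem_Vlevel[OF _ _ \<gamma>1(2) \<gamma>2(2)])
    show "x \<in> elts (Vlevel \<gamma>)" using that \<alpha> \<gamma> by blast
    have "elts (B x) \<subseteq> elts (Vlevel \<beta>)" using Vlevel_transitive[OF ord[OF \<beta>(1)]] \<beta>(2) that by blast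
    then show "y \<in> elts (Vlevel \<gamma>)" using that \<gamma> by blast
  qed
  then have "elts f \<subseteq> elts (Vlevel \<gamma>2)" if "f \<in> elts (vPi (elts a) B)" for f
    using that by (auto simp: elts_vPi)
  then have "elts (vPi (elts a) B) \<subseteq> elts (Vlevel \<gamma>3)"
    by (auto intro: subset_Vlevel_imp_mem[OF \<gamma>3(2)])
  then show ?thesis by (rule subset_Vlevel_imp_mem[OF \<gamma>3(1)])
qed

section \<open>Enumeration of the inaccessibles, the universes\<close>

lemma ex1_card_below:
  assumes S: "infinite S" "\<And>x. x \<in> S \<Longrightarrow> ordinal (x::'v::zfc)"
  shows "\<exists>!\<kappa>. \<kappa> \<in> S \<and> finite {\<mu> \<in> elts \<kappa>. \<mu> \<in> S} \<and> card {\<mu> \<in> elts \<kappa>. \<mu> \<in> S} = i"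
proof -
  let ?b = "\<lambda>\<kappa>. {\<mu> \<in> elts \<kappa>. \<mu> \<in> S}"
  have less: "card (?b x) < card (?b y)" if "x \<in> S" "y \<in> S" "finite (?b y)" "x \<in> elts y" for x y
  proof (rule psubset_card_mono[OF that(3)])
    have "x \<in> ?b y" "x \<notin> ?b x" using that not_mem_self by auto
    moreover have "?b x \<subseteq> ?b y" using that S(2) ordinal_trans by blast
    ultimately show "?b x \<subset> ?b y" by blast
  qed
  have inj: "x = y" if "x \<in> S" "y \<in> S" "finite (?b x)" "finite (?b y)" "card (?b x) = card (?b y)" for x y
    using ordinal_linear[OF S(2) S(2), OF that(1,2)] less[of x y] less[of y x] that by auto
  \<comment> \<open>The number of predecessors in \<open>S\<close> determines an element, so
    \<open>T\<close> has at most \<open>i\<close> elements. A minimal element of \<open>S\<close>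
    outside \<open>T\<close> has all these predecessors in \<open>T\<close>, hence at most
    \<open>i\<close> of them, and not fewer as it is not in \<open>T\<close>.\<close>
  define T where "T = {x \<in> S. finite (?b x) \<and> card (?b x) < i}"
  have "inj_on (\<lambda>x. card (?b x)) T" using inj by (auto simp: T_def inj_on_def)
  moreover have "(\<lambda>x. card (?b x)) ` T \<subseteq> {..<i}" by (auto simp: T_def)
  ultimately have T: "finite T" "card T \<le> i"
    using inj_on_finite[of _ T "{..<i}"] card_inj_on_le[of _ T "{..<i}"] by auto
  have "S - T \<noteq> {}" using S(1) T(1) by (metis Diff_eq_empty_iff finite_subset)
  then obtain x where "x \<in> S - T" by blast
  then obtain m where m: "m \<in> S - T" "\<And>y. y \<in> elts m \<Longrightarrow> y \<notin> S - T"
    by (rule wfE_min[OF foundation]) auto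
  then have "?b m \<subseteq> T" by blast
  then have "finite (?b m)" "card (?b m) \<le> i"
    using T finite_subset[of _ T] card_mono[of T "?b m"] by auto
  then have "card (?b m) = i" using m(1) by (auto simp: T_def)
  then show ?thesis using m(1) \<open>finite (?b m)\<close> inj by blast
qed

lemma inacc_props:
  assumes "infinite {\<kappa>::'v::zfc. inaccessible \<kappa>}"
  shows "inaccessible (inacc i :: 'v)" "finite {\<mu> \<in> elts (inacc i :: 'v). inaccessible \<mu>}"
    "card {\<mu> \<in> elts (inacc i :: 'v). inaccessible \<mu>} = i"
proof -
  have "\<exists>!\<kappa>::'v. inaccessible \<kappa> \<and> finite {\<mu> \<in> elts \<kappa>. inaccessible \<mu>} \<and>
                     card {\<mu> \<in> elts \<kappa>. inaccessible \<mu>} = i"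
    using ex1_card_below[OF assms, of i] inaccessibleD(1) by auto
  from theI'[OF this, folded inacc_def]
  show "inaccessible (inacc i :: 'v)" "finite {\<mu> \<in> elts (inacc i :: 'v). inaccessible \<mu>}"
    "card {\<mu> \<in> elts (inacc i :: 'v). inaccessible \<mu>} = i" by blast+
qed

lemma inacc_less:
  assumes inf: "infinite {\<kappa>::'v::zfc. inaccessible \<kappa>}" and "i < j"
  shows "(inacc i :: 'v) \<in> elts (inacc j)"
proof -
  note ord = inaccessibleD(1)[OF inacc_props(1)[OF inf]]
  have False if "inacc j = (inacc i :: 'v) \<or> inacc j \<in> elts (inacc i :: 'v)"
  proof -
    have "elts (inacc j) \<subseteq> elts (inacc i :: 'v)" using that ordinal_trans[OF ord[of i]] by auto
    then have "{\<mu> \<in> elts (inacc j). inaccessible \<mu>} \<subseteq> {\<mu> \<in> elts (inacc i :: 'v). inaccessible \<mu>}" by blast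
    from card_mono[OF inacc_props(2)[OF inf] this] show False using inacc_props(3)[OF inf] \<open>i < j\<close> by simp
  qed
  then show ?thesis using ordinal_linear[OF ord ord, of i j] by auto
qed

lemma Guniv_mem: "infinite {\<kappa>::'v::zfc. inaccessible \<kappa>} \<Longrightarrow> (Guniv i :: 'v) \<in> elts (Guniv (Suc i))"
  unfolding Guniv_def by (meson inacc_less lessI order_refl subset_Vlevel_imp_mem)

lemma Guniv_mono:
  assumes "infinite {\<kappa>::'v::zfc. inaccessible \<kappa>}" "i \<le> j"
  shows "elts (Guniv i :: 'v) \<subseteq> elts (Guniv j)"
  using assms Vlevel_mono[OF inaccessibleD(1)[OF inacc_props(1)] inacc_less, of i j]
  unfolding Guniv_def by (cases "i = j") auto

lemma Guniv_vPi:
  assumes "infinite {\<kappa>::'v::zfc. inaccessible \<kappa>}" "a \<in> elts (Guniv i :: 'v)"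
    "\<And>x. x \<in> elts a \<Longrightarrow> B x \<in> elts (Guniv i)"
  shows "vPi (elts a) B \<in> elts (Guniv i)"
  using assms vPi_mem_Vlevel[OF inacc_props(1)] unfolding Guniv_def by blast

section \<open>The interpretation\<close>

lemma not_Prop_cumul_Type: "\<not> Prop \<preceq> Type i"
  using no_common_Prop_Type cumul_refl by blast

lemma sort_not_Prop: "is_sort s \<Longrightarrow> \<not> \<Gamma> \<turnstile> s : Prop"
  using no_common_Prop_Type[of "Type _"] by (auto simp: is_sort_def dest!: gen_Prop gen_Type cumul_Prop_right)

text \<open>Hence the branch of \<open>interp\<close> that returns \<open>p\<close> is never taken
  for a type.\<close>

lemma not_proof_term_type: "\<Gamma> \<turnstile> A : s \<Longrightarrow> is_sort s \<Longrightarrow> \<not> proof_term \<Gamma> A"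
  by (simp add: proof_term_iff sort_not_Prop)

lemma gen_All_Type:
  assumes "\<Gamma> \<turnstile> All A B : Type i"
  obtains j where "\<Gamma> \<turnstile> A : Type j" "A # \<Gamma> \<turnstile> B : Type j"
  using assms by (rule gen_All) (auto simp: not_Prop_cumul_Type)

text \<open>The product type of a function that is no proof lies in some \<open>Type i\<close>, and
  the rule forming it demands a domain in \<open>Type i\<close>. So such a function never binds a
  proof variable, and \<open>strict\<close> is plain membership in its clause.\<close>

lemma gen_Lam_nonproof:
  assumes "\<Gamma> \<turnstile> Lam A t : T" "\<not> proof_term \<Gamma> (Lam A t)"
  obtains B i where "A # \<Gamma> \<turnstile> t : B" "\<Gamma> \<turnstile> A : Type i" "A # \<Gamma> \<turnstile> B : Type i"
proof -
  from assms(1) obtain B s where *: "A # \<Gamma> \<turnstile> t : B" "\<Gamma> \<turnstile> All A B : s" "is_sort s" by (rule gen_Lam)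
  then have "\<Gamma> \<turnstile> Lam A t : All A B" by (rule T_Lam)
  then have "s \<noteq> Prop" using assms(2) * by (auto simp: proof_term_iff)
  then obtain i where "s = Type i" using * by (auto simp: is_sort_def)
  with * that show thesis by (auto elim: gen_All_Type)
qed

lemma propositional_Type [simp]: "\<Gamma> \<turnstile> A : Type i \<Longrightarrow> \<not> propositional \<Gamma> A"
  using Prop_Type_disjoint by (auto simp: propositional_def)

lemma propositional_Prop [simp]: "\<Gamma> \<turnstile> A : Prop \<Longrightarrow> propositional \<Gamma> A"
  by (simp add: propositional_def)

lemma proof_term_ctx_equiv: "ctx_equiv \<Gamma> \<Gamma>' \<Longrightarrow> proof_term \<Gamma> t \<longleftrightarrow> proof_term \<Gamma>' t"
  and propositional_ctx_equiv: "ctx_equiv \<Gamma> \<Gamma>' \<Longrightarrow> propositional \<Gamma> t \<longleftrightarrow> propositional \<Gamma>' t"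
  by (auto simp: proof_term_def propositional_def ctx_equiv_def)

lemma propositional_ren:
  "\<Gamma> \<turnstile> A : s \<Longrightarrow> is_sort s \<Longrightarrow> wf_ctx \<Gamma>' \<Longrightarrow> wt_ren r \<Gamma> \<Gamma>' \<Longrightarrow>
    propositional \<Gamma>' (ren r A) \<longleftrightarrow> propositional \<Gamma> A"
  by (simp add: propositional_def Prop_ren_iff)

lemma propositional_psub:
  "\<Gamma> \<turnstile> A : s \<Longrightarrow> is_sort s \<Longrightarrow> wf_ctx \<Gamma>' \<Longrightarrow> wt_sub \<sigma> \<Gamma> \<Gamma>' \<Longrightarrow>
    propositional \<Gamma>' (psub \<sigma> A) \<longleftrightarrow> propositional \<Gamma> A"
  by (simp add: propositional_def Prop_psub_iff)

lemma propositional_beta: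
  "\<Gamma> \<turnstile> A : s \<Longrightarrow> is_sort s \<Longrightarrow> beta A A' \<Longrightarrow> propositional \<Gamma> A' \<longleftrightarrow> propositional \<Gamma> A"
  using subject_reduction1 by (auto simp: propositional_def sort_Prop_iff)

context
  fixes X :: "'v::zfc topology" and p :: 'v
begin

abbreviation (input) sem :: "ctx \<Rightarrow> tm \<Rightarrow> 'v list \<Rightarrow> 'v" where
  "sem \<equiv> interp X p"

lemma sem_proof: "proof_term \<Gamma> t \<Longrightarrow> sem \<Gamma> t \<gamma> = p"
  by (cases t) auto

lemma sem_sorts:
  assumes "wf_ctx \<Gamma>" shows "sem \<Gamma> Prop \<gamma> = opens X" "sem \<Gamma> (Type i) \<gamma> = Guniv i"
  using T_Prop[OF assms] T_Type[OF assms, of i] by (simp_all add: proof_term_iff sort_not_Prop)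

lemma sem_PP_lower:
  assumes "\<Gamma> \<turnstile> P : Prop" "P # \<Gamma> \<turnstile> Q : Prop" "\<not> occurs 0 Q"
  shows "sem \<Gamma> (All P Q) \<gamma> = open_exp X (sem \<Gamma> (lower 0 Q) \<gamma>) (sem \<Gamma> P \<gamma>)"
proof -
  have "\<Gamma> \<turnstile> All P Q : Prop" using assms by (rule T_All_Prop_Prop)
  then have "\<not> proof_term \<Gamma> (All P Q)" by (rule not_proof_term_type) simp
  then show ?thesis using assms lower_Prop[OF assms(2,3)] by simp
qed

lemma sem_TP:
  assumes "\<Gamma> \<turnstile> A : Type i" "A # \<Gamma> \<turnstile> Q : Prop"
  shows "sem \<Gamma> (All A Q) \<gamma> = open_meet X ((\<lambda>\<alpha>. sem (A # \<Gamma>) Q (\<alpha> # \<gamma>)) ` elts (sem \<Gamma> A \<gamma>))"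
proof -
  have "\<Gamma> \<turnstile> All A Q : Prop" using assms by (rule T_All_Type_Prop)
  then have "\<not> proof_term \<Gamma> (All A Q)" by (rule not_proof_term_type) simp
  then show ?thesis using assms by simp
qed

lemma sem_TT:
  assumes "\<Gamma> \<turnstile> A : Type i" "A # \<Gamma> \<turnstile> B : Type j"
  shows "sem \<Gamma> (All A B) \<gamma> = vPi (elts (sem \<Gamma> A \<gamma>)) (\<lambda>\<alpha>. sem (A # \<Gamma>) B (\<alpha> # \<gamma>))"
proof -
  have "\<Gamma> \<turnstile> All A B : Type (max i j)"
    using assms by (meson T_All_Type_Type Type_raise max.cobounded1 max.cobounded2)
  then have "\<not> proof_term \<Gamma> (All A B)" by (rule not_proof_term_type) simp
  then show ?thesis using assms by (simp add: strict_def)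
qed

lemma sem_Lam:
  assumes "\<Gamma> \<turnstile> A : Type i" "\<not> proof_term \<Gamma> (Lam A t)"
  shows "sem \<Gamma> (Lam A t) \<gamma> = vlam (elts (sem \<Gamma> A \<gamma>)) (\<lambda>\<alpha>. sem (A # \<Gamma>) t (\<alpha> # \<gamma>))"
  using assms by (simp add: strict_def)

lemma sem_ctx_equiv: "ctx_equiv \<Gamma> \<Gamma>' \<Longrightarrow> sem \<Gamma> t \<gamma> = sem \<Gamma>' t \<gamma>"
\<comment> \<open>The clause for implications recurs on \<open>lower 0 Q\<close>, which need not be
  a subterm of \<open>All P Q\<close> but has smaller size.\<close>
proof (induction t arbitrary: \<Gamma> \<Gamma>' \<gamma> rule: measure_induct_rule[of size])
  case (less t)
  note eq = proof_term_ctx_equiv[OF less.prems] propositional_ctx_equiv[OF less.prems]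
    propositional_ctx_equiv[OF ctx_equiv_Cons[OF less.prems]]
  note IH = less.IH[OF _ less.prems] less.IH[OF _ ctx_equiv_Cons[OF less.prems]]
  show ?case
  proof (cases t)
    case (All P Q)
    have "sem \<Gamma> P \<gamma> = sem \<Gamma>' P \<gamma>" "sem \<Gamma> (lower 0 Q) \<gamma> = sem \<Gamma>' (lower 0 Q) \<gamma>"
      "sem (P # \<Gamma>) Q (\<alpha> # \<gamma>) = sem (P # \<Gamma>') Q (\<alpha> # \<gamma>)" for \<alpha>
      using All by (auto intro!: IH)
    then show ?thesis unfolding All by (simp add: eq strict_def)
  next
    case (Lam A u)
    have "sem \<Gamma> A \<gamma> = sem \<Gamma>' A \<gamma>" "sem (A # \<Gamma>) u (\<alpha> # \<gamma>) = sem (A # \<Gamma>') u (\<alpha> # \<gamma>)" for \<alpha>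
      using Lam by (auto intro!: IH)
    then show ?thesis unfolding Lam by (simp add: eq strict_def)
  next
    case (App u v)
    have "sem \<Gamma> u \<gamma> = sem \<Gamma>' u \<gamma>" "sem \<Gamma> v \<gamma> = sem \<Gamma>' v \<gamma>"
      using App by (auto intro!: IH)
    then show ?thesis unfolding App by (simp add: eq)
  qed (simp_all add: eq)
qed

lemma sem_ren:
  assumes "\<Gamma> \<turnstile> t : T" "wf_ctx \<Gamma>'" "wt_ren r \<Gamma> \<Gamma>'" "\<And>i. i < length \<Gamma> \<Longrightarrow> \<gamma>' ! r i = \<gamma> ! i"
  shows "sem \<Gamma>' (ren r t) \<gamma>' = sem \<Gamma> t \<gamma>"
  using assms
proof (induction t arbitrary: \<Gamma> \<Gamma>' \<gamma> \<gamma>' r T rule: measure_induct_rule[of size])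
  case (less t)
  note eq = proof_term_ren[OF less.prems(1-3)]
  have step: "sem (ren r A # \<Gamma>') (ren (upr r) u) (\<alpha> # \<gamma>') = sem (A # \<Gamma>) u (\<alpha> # \<gamma>)"
    if A: "\<Gamma> \<turnstile> A : s" "is_sort s" and u: "A # \<Gamma> \<turnstile> u : U" "size u < size t" for A s u U \<alpha>
  proof (rule less.IH[OF u(2,1)])
    show "wf_ctx (ren r A # \<Gamma>')"
      using typing_ren[OF A(1) less.prems(2,3)] A(2) by (auto intro: wf_ConsI)
    show "wt_ren (upr r) (A # \<Gamma>) (ren r A # \<Gamma>')" using less.prems(3) by (rule wt_ren_upr)
    show "(\<alpha> # \<gamma>') ! upr r i = (\<alpha> # \<gamma>) ! i" if "i < length (A # \<Gamma>)" for i
      using that less.prems(4) by (cases i) auto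
  qed
  show ?case
  proof (cases "proof_term \<Gamma> t")
    case True
    then show ?thesis using eq by (simp add: sem_proof)
  next
    case nonproof: False
    show ?thesis
    proof (cases t)
      case (Var i)
      then have "i < length \<Gamma>" using less.prems(1) gen_Var by blast
      then show ?thesis using Var eq less.prems(4) by simp
    next
      case (All P Q)
      have Q': "ren r P # \<Gamma>' \<turnstile> ren (upr r) Q : s" if "P # \<Gamma> \<turnstile> Q : s" "is_sort s" "\<Gamma> \<turnstile> P : s'" "is_sort s'" for s s'
        using typing_ren[OF that(1) _ wt_ren_upr[OF less.prems(3)]] typing_ren[OF that(3) less.prems(2,3)] that
        by (auto intro: wf_ConsI)
      have P: "sem \<Gamma>' (ren r P) \<gamma>' = sem \<Gamma> P \<gamma>" if "\<Gamma> \<turnstile> P : s" for s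
        using less.IH[OF _ that less.prems(2-4)] All by simp
      from less.prems(1) show ?thesis unfolding All ren.simps
      proof (cases rule: gen_All)
        case PP
        let ?Q = "lower 0 Q"
        have rQ: "ren (upr r) Q = ren Suc (ren r ?Q)"
          using PP(3) by (metis ren_Suc_lower ren_upr_Suc)
        have "sem \<Gamma>' (ren r ?Q) \<gamma>' = sem \<Gamma> ?Q \<gamma>"
          using less.IH[OF _ lower_Prop[OF PP(2,3)] less.prems(2-4)] All by simp
        moreover have "\<Gamma>' \<turnstile> ren r P : Prop" using typing_ren[OF PP(1) less.prems(2,3)] by simp
        ultimately show "sem \<Gamma>' (All (ren r P) (ren (upr r) Q)) \<gamma>' = sem \<Gamma> (All P Q) \<gamma>"
          using PP Q'[OF PP(2) _ PP(1)] by (simp add: sem_PP_lower P rQ del: interp.simps)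
      next
        case (TP i)
        then have "\<Gamma>' \<turnstile> ren r P : Type i" using typing_ren[OF TP(1) less.prems(2,3)] by simp
        then show "sem \<Gamma>' (All (ren r P) (ren (upr r) Q)) \<gamma>' = sem \<Gamma> (All P Q) \<gamma>"
          using TP Q'[OF TP(2) _ TP(1)] step[OF TP(1) _ TP(2)] All
          by (simp add: sem_TP P del: interp.simps)
      next
        case (TT i)
        then have "\<Gamma>' \<turnstile> ren r P : Type i" using typing_ren[OF TT(1) less.prems(2,3)] by simp
        then show "sem \<Gamma>' (All (ren r P) (ren (upr r) Q)) \<gamma>' = sem \<Gamma> (All P Q) \<gamma>"
          using TT Q'[OF TT(2) _ TT(1)] step[OF TT(1) _ TT(2)] All
          by (simp add: sem_TT P del: interp.simps)
      qed
    next
      case (Lam A u)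
      obtain B i where B: "A # \<Gamma> \<turnstile> u : B" "\<Gamma> \<turnstile> A : Type i"
        using gen_Lam_nonproof less.prems(1) nonproof unfolding Lam by metis
      have "\<Gamma>' \<turnstile> ren r A : Type i" using typing_ren[OF B(2) less.prems(2,3)] by simp
      moreover have "sem \<Gamma>' (ren r A) \<gamma>' = sem \<Gamma> A \<gamma>"
        using less.IH[OF _ B(2) less.prems(2-4)] Lam by simp
      ultimately show ?thesis
        using step[OF B(2) _ B(1)] nonproof eq B(2) unfolding Lam
        by (simp add: sem_Lam del: interp.simps)
    next
      case (App u v)
      obtain A B where "\<Gamma> \<turnstile> u : All A B" "\<Gamma> \<turnstile> v : A"
        using less.prems(1) gen_App unfolding App by metis
      then have "sem \<Gamma>' (ren r u) \<gamma>' = sem \<Gamma> u \<gamma>" "sem \<Gamma>' (ren r v) \<gamma>' = sem \<Gamma> v \<gamma>"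
        using less.IH[OF _ _ less.prems(2-4)] App by auto
      then show ?thesis using App nonproof eq by simp
    qed (use nonproof eq in auto)
  qed
qed

lemma sem_weaken:
  "\<Gamma> \<turnstile> t : T \<Longrightarrow> \<Gamma> \<turnstile> A : s \<Longrightarrow> is_sort s \<Longrightarrow> sem (A # \<Gamma>) (ren Suc t) (\<alpha> # \<gamma>) = sem \<Gamma> t \<gamma>"
  by (rule sem_ren) (auto intro: wf_ConsI wt_ren_Suc)

text \<open>As \<open>Q\<close> does not contain the variable bound to \<open>p\<close> here, \<open>p\<close> could be any set.\<close>

lemma sem_PP:
  assumes "\<Gamma> \<turnstile> P : Prop" "P # \<Gamma> \<turnstile> Q : Prop" "\<not> occurs 0 Q"
  shows "sem \<Gamma> (All P Q) \<gamma> = open_exp X (sem (P # \<Gamma>) Q (p # \<gamma>)) (sem \<Gamma> P \<gamma>)"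
  using sem_weaken[OF lower_Prop[OF assms(2,3)] assms(1), of p \<gamma>]
  by (simp add: sem_PP_lower assms ren_Suc_lower del: interp.simps)

section \<open>Substitution in the interpretation\<close>

text \<open>The comparison is with \<open>Var i\<close> and not with the entry
  \<open>\<gamma> ! i\<close>, because a proof variable denotes \<open>p\<close> whatever the
  valuation holds.\<close>

definition sem_sub :: "(nat \<Rightarrow> tm) \<Rightarrow> ctx \<Rightarrow> ctx \<Rightarrow> 'v list \<Rightarrow> 'v list \<Rightarrow> bool" where
  "sem_sub \<sigma> \<Gamma> \<Gamma>' \<gamma> \<gamma>' \<longleftrightarrow> (\<forall>i<length \<Gamma>. sem \<Gamma>' (\<sigma> i) \<gamma>' = sem \<Gamma> (Var i) \<gamma>)"

lemma sem_sub_ups: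
  assumes "sem_sub \<sigma> \<Gamma> \<Gamma>' \<gamma> \<gamma>'" "wt_sub \<sigma> \<Gamma> \<Gamma>'" "\<Gamma> \<turnstile> A : s" "is_sort s" "wf_ctx \<Gamma>'"
  shows "sem_sub (ups \<sigma>) (A # \<Gamma>) (psub \<sigma> A # \<Gamma>') (\<alpha> # \<gamma>) (\<alpha> # \<gamma>')"
  unfolding sem_sub_def
proof (intro allI impI)
  fix i assume i: "i < length (A # \<Gamma>)"
  have A': "\<Gamma>' \<turnstile> psub \<sigma> A : s" using typing_psub[OF assms(3,5,2)] assms(4) by simp
  have wf: "wf_ctx (A # \<Gamma>)" "wf_ctx (psub \<sigma> A # \<Gamma>')" using A' assms wf_ConsI by blast+
  show "sem (psub \<sigma> A # \<Gamma>') (ups \<sigma> i) (\<alpha> # \<gamma>') = sem (A # \<Gamma>) (Var i) (\<alpha> # \<gamma>)"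
  proof (cases i)
    case 0
    then show ?thesis
      using proof_term_psub[OF typing_Var[OF wf(1) i] wf(2) wt_sub_ups[OF assms(2) A' assms(4)]] by simp
  next
    case (Suc j)
    then have j: "j < length \<Gamma>" using i by simp
    have "sem (psub \<sigma> A # \<Gamma>') (ren Suc (\<sigma> j)) (\<alpha> # \<gamma>') = sem \<Gamma>' (\<sigma> j) \<gamma>'"
      using assms(2) j A' assms(4) by (auto simp: wt_sub_def intro: sem_weaken)
    also have "\<dots> = sem \<Gamma> (Var j) \<gamma>" using assms(1) j by (simp add: sem_sub_def)
    also have "\<dots> = sem (A # \<Gamma>) (ren Suc (Var j)) (\<alpha> # \<gamma>)"
      using sem_weaken[OF typing_Var[OF typing_wf[OF assms(3)] j] assms(3,4)] by simp
    finally show ?thesis using Suc by simp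
  qed
qed

text \<open>Structural induction suffices here because \<open>sem_PP\<close> evaluates the codomain
  itself under the binder, in place of its lowering.\<close>

lemma sem_psub:
  assumes "\<Gamma> \<turnstile> t : T" "wf_ctx \<Gamma>'" "wt_sub \<sigma> \<Gamma> \<Gamma>'" "sem_sub \<sigma> \<Gamma> \<Gamma>' \<gamma> \<gamma>'"
  shows "sem \<Gamma>' (psub \<sigma> t) \<gamma>' = sem \<Gamma> t \<gamma>"
  using assms
proof (induction t arbitrary: \<Gamma> \<Gamma>' \<gamma> \<gamma>' \<sigma> T)
  case (Var i)
  then show ?case using gen_Var by (auto simp: sem_sub_def)
next
  case (All P Q)
  note prems = All.prems
  have step: "sem (psub \<sigma> P # \<Gamma>') (psub (ups \<sigma>) Q) (\<alpha> # \<gamma>') = sem (P # \<Gamma>) Q (\<alpha> # \<gamma>)"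
    "psub \<sigma> P # \<Gamma>' \<turnstile> psub (ups \<sigma>) Q : s'" "\<Gamma>' \<turnstile> psub \<sigma> P : s"
    if "\<Gamma> \<turnstile> P : s" "is_sort s" "P # \<Gamma> \<turnstile> Q : s'" "is_sort s'" for s s' \<alpha>
  proof -
    show P': "\<Gamma>' \<turnstile> psub \<sigma> P : s" using typing_psub[OF that(1) prems(2,3)] that(2) by simp
    note * = wf_ConsI[OF P' that(2)] wt_sub_ups[OF prems(3) P' that(2)]
    from All.IH(2)[OF that(3) * sem_sub_ups[OF prems(4,3) that(1,2) prems(2)]]
    show "sem (psub \<sigma> P # \<Gamma>') (psub (ups \<sigma>) Q) (\<alpha> # \<gamma>') = sem (P # \<Gamma>) Q (\<alpha> # \<gamma>)" .
    show "psub \<sigma> P # \<Gamma>' \<turnstile> psub (ups \<sigma>) Q : s'" using typing_psub[OF that(3) *] that(4) by simp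
  qed
  have P: "sem \<Gamma>' (psub \<sigma> P) \<gamma>' = sem \<Gamma> P \<gamma>" if "\<Gamma> \<turnstile> P : s" for s
    using All.IH(1)[OF that prems(2-4)] .
  from prems(1) show ?case unfolding psub.simps
  proof (cases rule: gen_All)
    case PP
    have "\<not> occurs 0 (psub (ups \<sigma>) Q)" using PP(3) by (metis occurs_ren_Suc ren_Suc_lower psub_ups_Suc)
    then show "sem \<Gamma>' (All (psub \<sigma> P) (psub (ups \<sigma>) Q)) \<gamma>' = sem \<Gamma> (All P Q) \<gamma>"
      using PP step[OF PP(1) _ PP(2)] P[OF PP(1)] by (simp add: sem_PP del: interp.simps)
  next
    case (TP i)
    then show "sem \<Gamma>' (All (psub \<sigma> P) (psub (ups \<sigma>) Q)) \<gamma>' = sem \<Gamma> (All P Q) \<gamma>"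
      using step[OF TP(1) _ TP(2)] P[OF TP(1)] by (simp add: sem_TP del: interp.simps)
  next
    case (TT i)
    then show "sem \<Gamma>' (All (psub \<sigma> P) (psub (ups \<sigma>) Q)) \<gamma>' = sem \<Gamma> (All P Q) \<gamma>"
      using step[OF TT(1) _ TT(2)] P[OF TT(1)] by (simp add: sem_TT del: interp.simps)
  qed
next
  case (Lam A t)
  note prems = Lam.prems
  note eq = proof_term_psub[OF prems(1-3)]
  show ?case
  proof (cases "proof_term \<Gamma> (Lam A t)")
    case True
    then show ?thesis using eq by (simp add: sem_proof del: interp.simps)
  next
    case False
    then obtain B i where B: "A # \<Gamma> \<turnstile> t : B" "\<Gamma> \<turnstile> A : Type i"
      using gen_Lam_nonproof prems(1) by metis
    have A': "\<Gamma>' \<turnstile> psub \<sigma> A : Type i" using typing_psub[OF B(2) prems(2,3)] by simp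
    have "sem (psub \<sigma> A # \<Gamma>') (psub (ups \<sigma>) t) (\<alpha> # \<gamma>') = sem (A # \<Gamma>) t (\<alpha> # \<gamma>)" for \<alpha>
      by (rule Lam.IH(2)[OF B(1) wf_ConsI[OF A'] wt_sub_ups[OF prems(3) A'] sem_sub_ups[OF prems(4,3) B(2) _ prems(2)]])
        simp_all
    then show ?thesis
      using Lam.IH(1)[OF B(2) prems(2-4)] False eq A' B(2) by (simp add: sem_Lam del: interp.simps)
  qed
next
  case (App u v)
  obtain A B where "\<Gamma> \<turnstile> u : All A B" "\<Gamma> \<turnstile> v : A" using App.prems(1) by (rule gen_App)
  with App.IH App.prems(2-4) proof_term_psub[OF App.prems(1-3)] show ?case by simp
next
  case Prop
  show ?case using proof_term_psub[OF Prop(1-3)] by simp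
next
  case (Type i)
  show ?case using proof_term_psub[OF Type(1-3)] by simp
qed

lemma sem_sub_scons:
  assumes "\<Gamma> \<turnstile> v : A"
  shows "sem_sub (scons v Var) (A # \<Gamma>) \<Gamma> (sem \<Gamma> v \<gamma> # \<gamma>) \<gamma>"
  unfolding sem_sub_def
proof (intro allI impI)
  fix i assume i: "i < length (A # \<Gamma>)"
  obtain s where s: "is_sort s" "\<Gamma> \<turnstile> A : s" using assms by (rule typing_type)
  have wf: "wf_ctx (A # \<Gamma>)" using s wf_ConsI by blast
  show "sem \<Gamma> (scons v Var i) \<gamma> = sem (A # \<Gamma>) (Var i) (sem \<Gamma> v \<gamma> # \<gamma>)"
  proof (cases i)
    case 0
    then show ?thesis
      using proof_term_psub[OF typing_Var[OF wf i] typing_wf[OF assms] wt_sub_scons[OF assms]]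
      by (simp add: sem_proof)
  next
    case (Suc j)
    then show ?thesis
      using sem_weaken[OF typing_Var[OF typing_wf[OF assms]] s(2,1), of j "sem \<Gamma> v \<gamma>" \<gamma>] i by simp
  qed
qed

lemma sem_subst:
  assumes "A # \<Gamma> \<turnstile> t : T" "\<Gamma> \<turnstile> v : A"
  shows "sem \<Gamma> (subst v 0 t) \<gamma> = sem (A # \<Gamma>) t (sem \<Gamma> v \<gamma> # \<gamma>)"
  unfolding subst0
  by (rule sem_psub[OF assms(1) typing_wf[OF assms(2)] wt_sub_scons[OF assms(2)] sem_sub_scons[OF assms(2)]])

end

declare interp.simps [simp del]

section \<open>Validity\<close>

context
  fixes X :: "'v::zfc topology" and p :: 'v
begin

text \<open>A superset of \<open>strict\<close>: for a proposition the value \<open>p\<close> is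
  kept even when \<open>p\<close> lies outside it, so that bodies under propositional binders are
  always examined at \<open>p\<close>.\<close>

definition adm_vals :: "ctx \<Rightarrow> tm \<Rightarrow> 'v list \<Rightarrow> 'v set" where
  "adm_vals \<Gamma> A \<gamma> = (if propositional \<Gamma> A then {p} else elts (sem X p \<Gamma> A \<gamma>))"

text \<open>
  Invariance of the interpretation under reduction needs arguments of functions to lie in their
  domains, which is only known by soundness, whereas soundness of the conversion rule needs that
  invariance for types that occur in no premise. \<open>valid\<close> breaks the circle: it speaks about the values
  of subterms only, so it is stable under substitution and reduction without appeal to soundness.
\<close>

fun valid :: "ctx \<Rightarrow> tm \<Rightarrow> 'v list \<Rightarrow> bool" where
  "valid \<Gamma> (All A B) \<gamma> \<longleftrightarrow>
    proof_term \<Gamma> (All A B) \<or> valid \<Gamma> A \<gamma> \<and> (\<forall>\<alpha>\<in>adm_vals \<Gamma> A \<gamma>. valid (A # \<Gamma>) B (\<alpha> # \<gamma>))"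
| "valid \<Gamma> (Lam A t) \<gamma> \<longleftrightarrow>
    proof_term \<Gamma> (Lam A t) \<or> valid \<Gamma> A \<gamma> \<and> (\<forall>\<alpha>\<in>adm_vals \<Gamma> A \<gamma>. valid (A # \<Gamma>) t (\<alpha> # \<gamma>))"
| "valid \<Gamma> (App u v) \<gamma> \<longleftrightarrow>
    proof_term \<Gamma> (App u v) \<or>
    valid \<Gamma> u \<gamma> \<and> valid \<Gamma> v \<gamma> \<and> (\<exists>b. vpair (sem X p \<Gamma> v \<gamma>) b \<in> elts (sem X p \<Gamma> u \<gamma>))"
| "valid \<Gamma> t \<gamma> \<longleftrightarrow> True"

lemma valid_proof: "proof_term \<Gamma> t \<Longrightarrow> valid \<Gamma> t \<gamma>"
  by (cases t) auto

lemma adm_vals_ctx_equiv: "ctx_equiv \<Gamma> \<Gamma>' \<Longrightarrow> adm_vals \<Gamma> A \<gamma> = adm_vals \<Gamma>' A \<gamma>"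
  by (simp add: adm_vals_def propositional_ctx_equiv sem_ctx_equiv)

lemma valid_ctx_equiv: "ctx_equiv \<Gamma> \<Gamma>' \<Longrightarrow> valid \<Gamma> t \<gamma> \<longleftrightarrow> valid \<Gamma>' t \<gamma>"
proof (induction t arbitrary: \<Gamma> \<Gamma>' \<gamma>)
  case (All A B)
  then show ?case
    using All.IH(1)[OF All.prems] All.IH(2)[OF ctx_equiv_Cons[OF All.prems]]
    by (simp add: adm_vals_ctx_equiv[OF All.prems] proof_term_ctx_equiv[OF All.prems])
next
  case (Lam A t)
  then show ?case
    using Lam.IH(1)[OF Lam.prems] Lam.IH(2)[OF ctx_equiv_Cons[OF Lam.prems]]
    by (simp add: adm_vals_ctx_equiv[OF Lam.prems] proof_term_ctx_equiv[OF Lam.prems])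
next
  case (App u v)
  then show ?case
    using App.IH(1)[OF App.prems] App.IH(2)[OF App.prems]
      sem_ctx_equiv[OF App.prems, of X p u \<gamma>] sem_ctx_equiv[OF App.prems, of X p v \<gamma>]
    by (simp add: proof_term_ctx_equiv[OF App.prems])
qed simp_all

section \<open>Stability of validity under renaming and substitution\<close>

lemma adm_vals_ren:
  assumes "\<Gamma> \<turnstile> A : s" "is_sort s" "wf_ctx \<Gamma>'" "wt_ren r \<Gamma> \<Gamma>'" "\<And>i. i < length \<Gamma> \<Longrightarrow> \<gamma>' ! r i = \<gamma> ! i"
  shows "adm_vals \<Gamma>' (ren r A) \<gamma>' = adm_vals \<Gamma> A \<gamma>"
  using propositional_ren[OF assms(1-4)] sem_ren[OF assms(1,3-5)] by (simp add: adm_vals_def)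

lemma adm_vals_psub:
  assumes "\<Gamma> \<turnstile> A : s" "is_sort s" "wf_ctx \<Gamma>'" "wt_sub \<sigma> \<Gamma> \<Gamma>'" "sem_sub X p \<sigma> \<Gamma> \<Gamma>' \<gamma> \<gamma>'"
  shows "adm_vals \<Gamma>' (psub \<sigma> A) \<gamma>' = adm_vals \<Gamma> A \<gamma>"
  using propositional_psub[OF assms(1-4)] sem_psub[OF assms(1,3-5)] by (simp add: adm_vals_def)

lemma valid_ren:
  assumes "\<Gamma> \<turnstile> t : T" "wf_ctx \<Gamma>'" "wt_ren r \<Gamma> \<Gamma>'" "\<And>i. i < length \<Gamma> \<Longrightarrow> \<gamma>' ! r i = \<gamma> ! i" "valid \<Gamma> t \<gamma>"
  shows "valid \<Gamma>' (ren r t) \<gamma>'"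
  using assms
proof (induction t arbitrary: \<Gamma> \<Gamma>' \<gamma> \<gamma>' r T)
  case (All A B)
  note prems = All.prems
  show ?case
  proof (cases "proof_term \<Gamma> (All A B)")
    case True
    then show ?thesis using proof_term_ren[OF prems(1-3)] valid_proof by blast
  next
    case False
    obtain s s' where A: "\<Gamma> \<turnstile> A : s" "is_sort s" and B: "A # \<Gamma> \<turnstile> B : s'"
      using prems(1) by (rule typing_All_sorts)
    have "wf_ctx (ren r A # \<Gamma>')" using typing_ren[OF A(1) prems(2,3)] A(2) by (auto intro: wf_ConsI)
    moreover have "(\<alpha> # \<gamma>') ! upr r i = (\<alpha> # \<gamma>) ! i" if "i < length (A # \<Gamma>)" for i \<alpha>
      using that prems(4) by (cases i) auto
    ultimately have "valid (ren r A # \<Gamma>') (ren (upr r) B) (\<alpha> # \<gamma>')" if "\<alpha> \<in> adm_vals \<Gamma> A \<gamma>" for \<alpha>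
      using that False prems(5) by (intro All.IH(2)[OF B _ wt_ren_upr[OF prems(3)]]) auto
    moreover have "valid \<Gamma>' (ren r A) \<gamma>'" using All.IH(1)[OF A(1) prems(2-4)] False prems(5) by simp
    ultimately show ?thesis using adm_vals_ren[OF A prems(2-4)] by simp
  qed
next
  case (Lam A t)
  note prems = Lam.prems
  show ?case
  proof (cases "proof_term \<Gamma> (Lam A t)")
    case True
    then show ?thesis using proof_term_ren[OF prems(1-3)] valid_proof by blast
  next
    case False
    then obtain B i where t: "A # \<Gamma> \<turnstile> t : B" and A: "\<Gamma> \<turnstile> A : Type i"
      using gen_Lam_nonproof prems(1) by metis
    have "wf_ctx (ren r A # \<Gamma>')" using typing_ren[OF A(1) prems(2,3)] by (auto intro: wf_ConsI)
    moreover have "(\<alpha> # \<gamma>') ! upr r i = (\<alpha> # \<gamma>) ! i" if "i < length (A # \<Gamma>)" for i \<alpha>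
      using that prems(4) by (cases i) auto
    ultimately have "valid (ren r A # \<Gamma>') (ren (upr r) t) (\<alpha> # \<gamma>')" if "\<alpha> \<in> adm_vals \<Gamma> A \<gamma>" for \<alpha>
      using that False prems(5) by (intro Lam.IH(2)[OF t _ wt_ren_upr[OF prems(3)]]) auto
    moreover have "valid \<Gamma>' (ren r A) \<gamma>'" using Lam.IH(1)[OF A(1) prems(2-4)] False prems(5) by simp
    ultimately show ?thesis using adm_vals_ren[OF A is_sort_simps(2) prems(2-4)] by simp
  qed
next
  case (App u v)
  note prems = App.prems
  obtain A B where "\<Gamma> \<turnstile> u : All A B" "\<Gamma> \<turnstile> v : A" using App.prems(1) by (rule gen_App)
  with App.IH[OF _ prems(2-4)] prems(5) proof_term_ren[OF prems(1-3)] sem_ren[OF _ prems(2-4), of _ _ X p]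
  show ?case by auto
qed simp_all

lemma valid_weaken:
  "\<Gamma> \<turnstile> t : T \<Longrightarrow> \<Gamma> \<turnstile> A : s \<Longrightarrow> is_sort s \<Longrightarrow> valid \<Gamma> t \<gamma> \<Longrightarrow> valid (A # \<Gamma>) (ren Suc t) (\<alpha> # \<gamma>)"
  by (rule valid_ren) (auto intro: wf_ConsI wt_ren_Suc)

lemma valid_ups:
  assumes "\<And>i. i < length \<Gamma> \<Longrightarrow> valid \<Gamma>' (\<sigma> i) \<gamma>'" "wt_sub \<sigma> \<Gamma> \<Gamma>'" "\<Gamma>' \<turnstile> psub \<sigma> A : s" "is_sort s"
    and "i < length (A # \<Gamma>)"
  shows "valid (psub \<sigma> A # \<Gamma>') (ups \<sigma> i) (\<alpha> # \<gamma>')"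
  using assms by (cases i) (auto simp: wt_sub_def intro: valid_weaken)

text \<open>The substituted terms are assumed typed and valid, but nothing is assumed about their
  values lying in their types, which would presuppose soundness.\<close>

lemma valid_psub:
  assumes "\<Gamma> \<turnstile> t : T" "wf_ctx \<Gamma>'" "wt_sub \<sigma> \<Gamma> \<Gamma>'" "sem_sub X p \<sigma> \<Gamma> \<Gamma>' \<gamma> \<gamma>'"
    "\<And>i. i < length \<Gamma> \<Longrightarrow> valid \<Gamma>' (\<sigma> i) \<gamma>'" "valid \<Gamma> t \<gamma>"
  shows "valid \<Gamma>' (psub \<sigma> t) \<gamma>'"
  using assms
proof (induction t arbitrary: \<Gamma> \<Gamma>' \<gamma> \<gamma>' \<sigma> T)
  case (Var i)
  then show ?case using gen_Var by auto
next
  case (All A B)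
  note prems = All.prems
  show ?case
  proof (cases "proof_term \<Gamma> (All A B)")
    case True
    then show ?thesis using proof_term_psub[OF prems(1-3)] valid_proof by blast
  next
    case False
    obtain s s' where A: "\<Gamma> \<turnstile> A : s" "is_sort s" and B: "A # \<Gamma> \<turnstile> B : s'"
      using prems(1) by (rule typing_All_sorts)
    have A': "\<Gamma>' \<turnstile> psub \<sigma> A : s" using typing_psub[OF A(1) prems(2,3)] A(2) by simp
    note * = wf_ConsI[OF A' A(2)] wt_sub_ups[OF prems(3) A' A(2)] sem_sub_ups[OF prems(4,3) A prems(2)]
      valid_ups[OF prems(5,3) A' A(2)]
    have "valid (psub \<sigma> A # \<Gamma>') (psub (ups \<sigma>) B) (\<alpha> # \<gamma>')" if "\<alpha> \<in> adm_vals \<Gamma> A \<gamma>" for \<alpha>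
      using that False prems(6) by (intro All.IH(2)[OF B *]) auto
    moreover have "valid \<Gamma>' (psub \<sigma> A) \<gamma>'" using All.IH(1)[OF A(1) prems(2-5)] False prems(6) by simp
    ultimately show ?thesis using adm_vals_psub[OF A prems(2-4)] by simp
  qed
next
  case (Lam A t)
  note prems = Lam.prems
  show ?case
  proof (cases "proof_term \<Gamma> (Lam A t)")
    case True
    then show ?thesis using proof_term_psub[OF prems(1-3)] valid_proof by blast
  next
    case False
    then obtain B i where t: "A # \<Gamma> \<turnstile> t : B" and A: "\<Gamma> \<turnstile> A : Type i"
      using gen_Lam_nonproof prems(1) by metis
    have A': "\<Gamma>' \<turnstile> psub \<sigma> A : Type i" using typing_psub[OF A(1) prems(2,3)] by simp
    note s = is_sort_simps(2)[of i]
    note * = wf_ConsI[OF A' s] wt_sub_ups[OF prems(3) A' s] sem_sub_ups[OF prems(4,3) A s prems(2)]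
      valid_ups[OF prems(5,3) A' s]
    have "valid (psub \<sigma> A # \<Gamma>') (psub (ups \<sigma>) t) (\<alpha> # \<gamma>')" if "\<alpha> \<in> adm_vals \<Gamma> A \<gamma>" for \<alpha>
      using that False prems(6) by (intro Lam.IH(2)[OF t *]) auto
    moreover have "valid \<Gamma>' (psub \<sigma> A) \<gamma>'" using Lam.IH(1)[OF A(1) prems(2-5)] False prems(6) by simp
    ultimately show ?thesis using adm_vals_psub[OF A s prems(2-4)] by simp
  qed
next
  case (App u v)
  note prems = App.prems
  obtain A B where "\<Gamma> \<turnstile> u : All A B" "\<Gamma> \<turnstile> v : A" using App.prems(1) by (rule gen_App)
  with App.IH[OF _ prems(2-5)] prems(6) proof_term_psub[OF prems(1-3)] sem_psub[OF _ prems(2-4)]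
  show ?case by auto
qed simp_all

lemma valid_subst:
  assumes "A # \<Gamma> \<turnstile> t : T" "\<Gamma> \<turnstile> v : A" "valid \<Gamma> v \<gamma>" "valid (A # \<Gamma>) t (sem X p \<Gamma> v \<gamma> # \<gamma>)"
  shows "valid \<Gamma> (subst v 0 t) \<gamma>"
  unfolding subst0
proof (rule valid_psub[OF assms(1) typing_wf[OF assms(2)] wt_sub_scons[OF assms(2)]
      sem_sub_scons[OF assms(2)] _ assms(4)])
  fix i show "valid \<Gamma> (scons v Var i) \<gamma>" using assms(3) by (cases i) auto
qed

section \<open>Invariance under reduction\<close>

lemma adm_vals_Type: "\<Gamma> \<turnstile> A : Type i \<Longrightarrow> adm_vals \<Gamma> A \<gamma> = elts (sem X p \<Gamma> A \<gamma>)"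
  and adm_vals_Prop: "\<Gamma> \<turnstile> A : Prop \<Longrightarrow> adm_vals \<Gamma> A \<gamma> = {p}"
  by (simp_all add: adm_vals_def)

lemma sem_beta_proof:
  assumes "\<Gamma> \<turnstile> t : T" "beta t t'" "proof_term \<Gamma> t"
  shows "sem X p \<Gamma> t' \<gamma> = sem X p \<Gamma> t \<gamma> \<and> valid \<Gamma> t' \<gamma>"
  using assms proof_term_beta[OF assms(1,2)] by (simp add: sem_proof valid_proof)

lemma sem_beta:
  assumes "\<Gamma> \<turnstile> t : T" "beta t t'" "valid \<Gamma> t \<gamma>"
  shows "sem X p \<Gamma> t' \<gamma> = sem X p \<Gamma> t \<gamma> \<and> valid \<Gamma> t' \<gamma>"
  using assms(2,1,3)
proof (induction arbitrary: \<Gamma> T \<gamma> rule: beta.induct)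
  case (beta_redex A t v)
  show ?case
  proof (cases "proof_term \<Gamma> (App (Lam A t) v)")
    case True
    moreover have "proof_term \<Gamma> (subst v 0 t)"
      using True proof_term_beta[OF beta_redex(1) beta.beta_redex] by simp
    ultimately show ?thesis by (simp add: sem_proof valid_proof)
  next
    case False
    from beta_redex(1) obtain A' B' where *: "\<Gamma> \<turnstile> Lam A t : All A' B'" "\<Gamma> \<turnstile> v : A'" by (rule gen_App)
    from *(1) obtain B s where B: "A # \<Gamma> \<turnstile> t : B" "\<Gamma> \<turnstile> All A B : s" "is_sort s" "All A B \<preceq> All A' B'"
      by (rule gen_Lam)
    obtain sA where sA: "\<Gamma> \<turnstile> A : sA" "is_sort sA" using B(1) by (rule typing_ConsE)
    have "A' \<preceq> A" using cumul_All_All[OF B(4)] beta_eq_sym cumul_conv by blast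
    then have v: "\<Gamma> \<turnstile> v : A" using *(2) sA by (meson T_Cumul)
    \<comment> \<open>If the abstraction were a proof, its codomain would be a proposition and the
      whole redex a proof, contrary to the present case.\<close>
    have nonproof: "\<not> proof_term \<Gamma> (Lam A t)"
    proof
      assume "proof_term \<Gamma> (Lam A t)"
      then have "\<Gamma> \<turnstile> All A B : Prop" using proof_term_iff T_Lam[OF B(1-3)] by blast
      then have "A # \<Gamma> \<turnstile> B : Prop" by (rule gen_All) (auto dest: cumul_Prop_right)
      then have "\<Gamma> \<turnstile> subst v 0 B : Prop" using typing_subst[OF _ v] by fastforce
      moreover have "\<Gamma> \<turnstile> App (Lam A t) v : subst v 0 B" using T_App[OF T_Lam[OF B(1-3)] v] .
      ultimately show False using False proof_term_iff by blast
    qed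
    then obtain i where A: "\<Gamma> \<turnstile> A : Type i" using gen_Lam_nonproof *(1) by metis
    have val: "valid \<Gamma> (Lam A t) \<gamma>" "valid \<Gamma> v \<gamma>"
      and "\<exists>b. vpair (sem X p \<Gamma> v \<gamma>) b \<in> elts (sem X p \<Gamma> (Lam A t) \<gamma>)"
      using beta_redex(2) False by (auto simp del: valid.simps(2))
    \<comment> \<open>Validity provides a pair in the graph of the abstraction with the argument as
      first component, so the argument lies in the domain. Outside the domain the value of
      \<open>vapp\<close> is unspecified.\<close>
    then have mem: "sem X p \<Gamma> v \<gamma> \<in> elts (sem X p \<Gamma> A \<gamma>)"
      using sem_Lam[OF A nonproof, of X p \<gamma>] by (auto simp: elts_vlam)
    then have "sem X p \<Gamma> (App (Lam A t) v) \<gamma> = sem X p (A # \<Gamma>) t (sem X p \<Gamma> v \<gamma> # \<gamma>)"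
      using False sem_Lam[OF A nonproof, of X p \<gamma>] by (simp add: vapp_vlam interp.simps(6))
    moreover have "valid (A # \<Gamma>) t (sem X p \<Gamma> v \<gamma> # \<gamma>)"
      using val(1) nonproof mem adm_vals_Type[OF A] by simp
    ultimately show ?thesis using sem_subst[OF B(1) v] valid_subst[OF B(1) v val(2)] by simp
  qed
next
  case (beta_All1 A A' B)
  note prems = beta_All1.prems and red = beta_All1.hyps
  show ?case
  proof (cases "proof_term \<Gamma> (All A B)")
    case True
    then show ?thesis by (rule sem_beta_proof[OF prems(1) beta.beta_All1[OF red]])
  next
    case False
    obtain s where A: "\<Gamma> \<turnstile> A : s" "is_sort s" using prems(1) by (rule typing_All_sorts)
    have val: "valid \<Gamma> A \<gamma>" "\<And>\<alpha>. \<alpha> \<in> adm_vals \<Gamma> A \<gamma> \<Longrightarrow> valid (A # \<Gamma>) B (\<alpha> # \<gamma>)"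
      using prems(2) False by simp_all
    have IH: "sem X p \<Gamma> A' \<gamma> = sem X p \<Gamma> A \<gamma>" "valid \<Gamma> A' \<gamma>"
      using beta_All1.IH[OF A(1) val(1)] by simp_all
    note E = ctx_equiv_beta[OF A red]
    have dom: "adm_vals \<Gamma> A' \<gamma> = adm_vals \<Gamma> A \<gamma>" using IH propositional_beta[OF A red] by (simp add: adm_vals_def)
    have semB: "sem X p (A' # \<Gamma>) B \<delta> = sem X p (A # \<Gamma>) B \<delta>" for \<delta> using sem_ctx_equiv[OF E, of X p] by simp
    have typB: "A' # \<Gamma> \<turnstile> B : S" if "A # \<Gamma> \<turnstile> B : S" for S using E that by (simp add: ctx_equiv_def)
    have "valid \<Gamma> (All A' B) \<gamma>" using IH(2) val(2) dom valid_ctx_equiv[OF E] by simp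
    moreover from prems(1) have "sem X p \<Gamma> (All A' B) \<gamma> = sem X p \<Gamma> (All A B) \<gamma>"
    proof (cases rule: gen_All)
      case PP
      then show ?thesis using subject_reduction1[OF PP(1) red] typB[OF PP(2)] by (simp add: sem_PP semB IH)
    next
      case (TP i)
      then show ?thesis using subject_reduction1[OF TP(1) red] typB[OF TP(2)] by (simp add: sem_TP semB IH)
    next
      case (TT i)
      then show ?thesis using subject_reduction1[OF TT(1) red] typB[OF TT(2)] by (simp add: sem_TT semB IH)
    qed
    ultimately show ?thesis by blast
  qed
next
  case (beta_All2 B B' A)
  note prems = beta_All2.prems and red = beta_All2.hyps
  show ?case
  proof (cases "proof_term \<Gamma> (All A B)")
    case True
    then show ?thesis by (rule sem_beta_proof[OF prems(1) beta.beta_All2[OF red]])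
  next
    case False
    obtain s' where B: "A # \<Gamma> \<turnstile> B : s'" using prems(1) by (rule typing_All_sorts)
    have val: "valid \<Gamma> A \<gamma>" "\<And>\<alpha>. \<alpha> \<in> adm_vals \<Gamma> A \<gamma> \<Longrightarrow> valid (A # \<Gamma>) B (\<alpha> # \<gamma>)"
      using prems(2) False by simp_all
    have IH: "sem X p (A # \<Gamma>) B' (\<alpha> # \<gamma>) = sem X p (A # \<Gamma>) B (\<alpha> # \<gamma>)" "valid (A # \<Gamma>) B' (\<alpha> # \<gamma>)"
      if "\<alpha> \<in> adm_vals \<Gamma> A \<gamma>" for \<alpha>
      using beta_All2.IH[OF B val(2)[OF that]] by simp_all
    have "valid \<Gamma> (All A B') \<gamma>" using IH(2) val(1) by simp
    moreover from prems(1) have "sem X p \<Gamma> (All A B') \<gamma> = sem X p \<Gamma> (All A B) \<gamma>"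
    proof (cases rule: gen_All)
      case PP
      then show ?thesis
        using subject_reduction1[OF PP(2) red] betas_not_occurs[OF r_into_rtranclp, OF red] IH(1)[of p]
        by (simp add: sem_PP adm_vals_Prop)
    next
      case (TP i)
      then show ?thesis
        using subject_reduction1[OF TP(2) red] IH(1) by (simp add: sem_TP adm_vals_Type cong: image_cong)
    next
      case (TT i)
      then show ?thesis
        using subject_reduction1[OF TT(2) red] IH(1) by (simp add: sem_TT adm_vals_Type cong: vPi_cong)
    qed
    ultimately show ?thesis by blast
  qed
next
  case (beta_Lam1 A A' t)
  note prems = beta_Lam1.prems and red = beta_Lam1.hyps
  show ?case
  proof (cases "proof_term \<Gamma> (Lam A t)")
    case True
    then show ?thesis by (rule sem_beta_proof[OF prems(1) beta.beta_Lam1[OF red]])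
  next
    case False
    then obtain B i where t: "A # \<Gamma> \<turnstile> t : B" and A: "\<Gamma> \<turnstile> A : Type i"
      using gen_Lam_nonproof prems(1) by metis
    note s = is_sort_simps(2)[of i]
    have False': "\<not> proof_term \<Gamma> (Lam A' t)"
      using False proof_term_beta[OF prems(1) beta.beta_Lam1[OF red]] by simp
    have val: "valid \<Gamma> A \<gamma>" "\<And>\<alpha>. \<alpha> \<in> adm_vals \<Gamma> A \<gamma> \<Longrightarrow> valid (A # \<Gamma>) t (\<alpha> # \<gamma>)"
      using prems(2) False by simp_all
    have IH: "sem X p \<Gamma> A' \<gamma> = sem X p \<Gamma> A \<gamma>" "valid \<Gamma> A' \<gamma>"
      using beta_Lam1.IH[OF A val(1)] by simp_all
    note E = ctx_equiv_beta[OF A s red]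
    have dom: "adm_vals \<Gamma> A' \<gamma> = adm_vals \<Gamma> A \<gamma>" using IH propositional_beta[OF A s red] by (simp add: adm_vals_def)
    have semt: "sem X p (A' # \<Gamma>) t \<delta> = sem X p (A # \<Gamma>) t \<delta>" for \<delta> using sem_ctx_equiv[OF E, of X p] by simp
    have "valid \<Gamma> (Lam A' t) \<gamma>" using IH(2) val(2) dom valid_ctx_equiv[OF E] by simp
    then show ?thesis
      using sem_Lam[OF A False, of X p] sem_Lam[OF subject_reduction1[OF A red] False', of X p] IH(1) semt
      by simp
  qed
next
  case (beta_Lam2 t t' A)
  note prems = beta_Lam2.prems and red = beta_Lam2.hyps
  show ?case
  proof (cases "proof_term \<Gamma> (Lam A t)")
    case True
    then show ?thesis by (rule sem_beta_proof[OF prems(1) beta.beta_Lam2[OF red]])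
  next
    case False
    then obtain B i where t: "A # \<Gamma> \<turnstile> t : B" and A: "\<Gamma> \<turnstile> A : Type i"
      using gen_Lam_nonproof prems(1) by metis
    have False': "\<not> proof_term \<Gamma> (Lam A t')"
      using False proof_term_beta[OF prems(1) beta.beta_Lam2[OF red]] by simp
    have val: "valid \<Gamma> A \<gamma>" "\<And>\<alpha>. \<alpha> \<in> adm_vals \<Gamma> A \<gamma> \<Longrightarrow> valid (A # \<Gamma>) t (\<alpha> # \<gamma>)"
      using prems(2) False by simp_all
    have IH: "sem X p (A # \<Gamma>) t' (\<alpha> # \<gamma>) = sem X p (A # \<Gamma>) t (\<alpha> # \<gamma>)" "valid (A # \<Gamma>) t' (\<alpha> # \<gamma>)"
      if "\<alpha> \<in> adm_vals \<Gamma> A \<gamma>" for \<alpha>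
      using beta_Lam2.IH[OF t val(2)[OF that]] by simp_all
    have "valid \<Gamma> (Lam A t') \<gamma>" using IH(2) val(1) by simp
    moreover have "sem X p \<Gamma> (Lam A t') \<gamma> = sem X p \<Gamma> (Lam A t) \<gamma>"
      using IH(1) by (simp add: sem_Lam[OF A] False False' adm_vals_Type[OF A] cong: vlam_cong)
    ultimately show ?thesis by blast
  qed
next
  case (beta_App1 u u' v)
  have eq: "proof_term \<Gamma> (App u' v) \<longleftrightarrow> proof_term \<Gamma> (App u v)"
    by (rule proof_term_beta[OF beta_App1.prems(1) beta.beta_App1[OF beta_App1.hyps]])
  obtain A B where "\<Gamma> \<turnstile> u : All A B" using beta_App1.prems(1) by (rule gen_App)
  with beta_App1.IH beta_App1.prems(2) eq show ?case by (auto simp: interp.simps(6))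
next
  case (beta_App2 v v' u)
  have eq: "proof_term \<Gamma> (App u v') \<longleftrightarrow> proof_term \<Gamma> (App u v)"
    by (rule proof_term_beta[OF beta_App2.prems(1) beta.beta_App2[OF beta_App2.hyps]])
  obtain A B where "\<Gamma> \<turnstile> v : A" using beta_App2.prems(1) by (rule gen_App)
  with beta_App2.IH beta_App2.prems(2) eq show ?case by (auto simp: interp.simps(6))
qed

lemma sem_betas:
  assumes "t \<longrightarrow>\<^sub>\<beta> t'" "\<Gamma> \<turnstile> t : T" "valid \<Gamma> t \<gamma>"
  shows "sem X p \<Gamma> t' \<gamma> = sem X p \<Gamma> t \<gamma> \<and> valid \<Gamma> t' \<gamma>"
  using assms
proof (induction rule: rtranclp_induct)
  case (step t1 t2)
  then have "\<Gamma> \<turnstile> t1 : T" by (blast intro: subject_reduction)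
  from sem_beta[OF this step(2)] step show ?case by auto
qed simp

section \<open>Soundness\<close>

text \<open>
  Variables of propositional type get the value \<open>p\<close> even if \<open>p\<close> is not in the proposition; \<open>hyps\<close> is
  the open set on which the propositions of the context hold. The implication \<open>p \<in> P \<longrightarrow> p \<in> Q\<close>
  alone would not yield \<open>p \<in> Q\<^sup>P\<close>: a neighbourhood of \<open>p\<close> on which \<open>P\<close> is included in \<open>Q\<close> is needed.
\<close>

fun gval :: "ctx \<Rightarrow> 'v list set" where
  "gval [] = {[]}"
| "gval (A # \<Gamma>) = {\<alpha> # \<gamma> | \<alpha> \<gamma>. \<gamma> \<in> gval \<Gamma> \<and> \<alpha> \<in> adm_vals \<Gamma> A \<gamma>}"

fun hyps :: "ctx \<Rightarrow> 'v list \<Rightarrow> 'v set" where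
  "hyps [] \<gamma> = topspace X"
| "hyps (A # \<Gamma>) \<gamma> =
    (if propositional \<Gamma> A then hyps \<Gamma> (tl \<gamma>) \<inter> elts (sem X p \<Gamma> A (tl \<gamma>)) else hyps \<Gamma> (tl \<gamma>))"

text \<open>Openness of the propositions is recorded so that \<open>hyps\<close> is open; the
  universal properties of exponential and meet only speak of open sets.\<close>

fun ctx_valid :: "ctx \<Rightarrow> 'v list \<Rightarrow> bool" where
  "ctx_valid [] \<gamma> \<longleftrightarrow> True"
| "ctx_valid (A # \<Gamma>) \<gamma> \<longleftrightarrow> ctx_valid \<Gamma> (tl \<gamma>) \<and> valid \<Gamma> A (tl \<gamma>) \<and>
    (propositional \<Gamma> A \<longrightarrow> openin X (elts (sem X p \<Gamma> A (tl \<gamma>))))"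

definition realizes :: "ctx \<Rightarrow> tm \<Rightarrow> tm \<Rightarrow> 'v list \<Rightarrow> bool" where
  "realizes \<Gamma> t T \<gamma> \<longleftrightarrow>
    (if proof_term \<Gamma> t then hyps \<Gamma> \<gamma> \<subseteq> elts (sem X p \<Gamma> T \<gamma>)
     else sem X p \<Gamma> t \<gamma> \<in> elts (sem X p \<Gamma> T \<gamma>))"

lemma hyps_open: "ctx_valid \<Gamma> \<gamma> \<Longrightarrow> openin X (hyps \<Gamma> \<gamma>)"
  by (induction \<Gamma> arbitrary: \<gamma>) auto

text \<open>Universes grow with their index and dependent function spaces with their codomain.
  Exponentials and meets of distinct terms never have to be compared, since on propositions
  \<open>scum\<close> is equality.\<close>

lemma sem_scum:
  assumes "scum A B" "\<Gamma> \<turnstile> A : s" "\<Gamma> \<turnstile> B : s'" "is_sort s" "is_sort s'"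
    and inf: "infinite {\<kappa>::'v. inaccessible \<kappa>}"
  shows "elts (sem X p \<Gamma> A \<gamma>) \<subseteq> elts (sem X p \<Gamma> B \<gamma>)"
  using assms(1-5)
proof (induction arbitrary: \<Gamma> \<gamma> s s' rule: scum.induct)
  case (scum_Type i j)
  then show ?case using Guniv_mono[OF inf] by (simp add: sem_sorts typing_wf)
next
  case (scum_All B B' A)
  show ?case
  proof (cases "s = Prop \<or> s' = Prop")
    case True
    with scum_All have "All A B = All A B'" using scum.scum_All scum_Prop_left scum_Prop_right by metis
    then show ?thesis by simp
  next
    case False
    then obtain i i' where "\<Gamma> \<turnstile> All A B : Type i" "\<Gamma> \<turnstile> All A B' : Type i'"
      using scum_All.prems by (auto simp: is_sort_def)
    then obtain j j' where j: "\<Gamma> \<turnstile> A : Type j" "A # \<Gamma> \<turnstile> B : Type j" "A # \<Gamma> \<turnstile> B' : Type j'"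
      by (auto elim!: gen_All_Type)
    show ?thesis
      unfolding sem_TT[OF j(1,2)] sem_TT[OF j(1,3)]
      by (intro vPi_mono scum_All.IH[OF j(2,3)]) simp_all
  qed
qed simp

text \<open>\<open>scum\<close> compares typed reducts, and validity at both ends carries the
  inclusion back along the reductions.\<close>

lemma sem_cumul:
  assumes "A \<preceq> B" "\<Gamma> \<turnstile> A : s" "\<Gamma> \<turnstile> B : s'" "is_sort s" "is_sort s'" "valid \<Gamma> A \<gamma>" "valid \<Gamma> B \<gamma>"
    and inf: "infinite {\<kappa>::'v. inaccessible \<kappa>}"
  shows "elts (sem X p \<Gamma> A \<gamma>) \<subseteq> elts (sem X p \<Gamma> B \<gamma>)"
proof -
  obtain A' B' where *: "A \<longrightarrow>\<^sub>\<beta> A'" "scum A' B'" "B \<longrightarrow>\<^sub>\<beta> B'" using assms(1) by (rule cumulE)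
  then have "\<Gamma> \<turnstile> A' : s" "\<Gamma> \<turnstile> B' : s'" using assms(2,3) by (blast intro: subject_reduction)+
  from sem_scum[OF *(2) this assms(4,5) inf, of \<gamma>] show ?thesis
    using sem_betas[OF *(1) assms(2,6)] sem_betas[OF *(3) assms(3,7)] by simp
qed

context
  assumes inf: "infinite {\<kappa>::'v. inaccessible \<kappa>}"
    and space: "\<exists>x\<in>elts (Guniv 0). topspace X = elts x"
begin

section \<open>The opens as a complete Heyting algebra in the universe\<close>

lemma is_set_open: "openin X U \<Longrightarrow> is_set U"
  using space is_set_subset[OF is_set_elts] openin_subset[of X] by metis

lemma elts_VSet_open [simp]: "openin X U \<Longrightarrow> elts (VSet U) = U"
  by (simp add: is_set_open)

lemma mem_opens: "a \<in> elts (opens X) \<longleftrightarrow> openin X (elts a)"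
proof -
  have "is_set {z. elts z \<subseteq> topspace X}" using is_set_open by (auto intro: is_set_Pow)
  moreover have "VSet ` {U. openin X U} \<subseteq> {z. elts z \<subseteq> topspace X}" by (simp add: image_subset_iff openin_subset)
  ultimately have eq: "elts (opens X) = VSet ` {U. openin X U}"
    unfolding opens_def using is_set_subset elts_VSet by blast
  show ?thesis
  proof
    assume "a \<in> elts (opens X)"
    then obtain U where "a = VSet U" "openin X U" unfolding eq by blast
    then show "openin X (elts a)" by simp
  next
    assume "openin X (elts a)"
    then have "VSet (elts a) \<in> VSet ` {U. openin X U}" by blast
    then show "a \<in> elts (opens X)" unfolding eq by (simp only: VSet_elts)
  qed
qed

text \<open>Needed for \<open>Prop : Type 0\<close>. The space is contained in a level below
  \<open>inacc 0\<close>, so its open subsets are members of a later such level, and their set lies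
  in the first universe.\<close>

lemma opens_mem_Guniv: "opens X \<in> elts (Guniv 0)"
proof -
  note \<kappa> = inacc_props(1)[OF inf, of 0]
  obtain x where x: "x \<in> elts (Vlevel (inacc 0))" "topspace X = elts x"
    using space unfolding Guniv_def by blast
  obtain \<beta> where \<beta>: "\<beta> \<in> elts (inacc 0)" "elts x \<subseteq> elts (Vlevel \<beta>)" using x(1) unfolding mem_Vlevel by blast
  obtain \<gamma> where \<gamma>: "\<gamma> \<in> elts (inacc 0)" "\<beta> \<in> elts \<gamma>" using inaccessible_limit[OF \<kappa> \<beta>(1)] .
  have "elts (opens X) \<subseteq> elts (Vlevel \<gamma>)"
  proof
    fix a assume "a \<in> elts (opens X)"
    then have "elts a \<subseteq> elts x" unfolding mem_opens x(2)[symmetric] by (rule openin_subset)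
    then have "elts a \<subseteq> elts (Vlevel \<beta>)" using \<beta>(2) by (rule subset_trans)
    then show "a \<in> elts (Vlevel \<gamma>)" by (rule subset_Vlevel_imp_mem[OF \<gamma>(2)])
  qed
  then show ?thesis unfolding Guniv_def by (rule subset_Vlevel_imp_mem[OF \<gamma>(1)])
qed

text \<open>With an open set \<open>U\<close> of hypotheses, these are formation, introduction and
  elimination of implication.\<close>

lemma open_exp_open: "openin X (elts (open_exp X b a))"
  and open_exp_greatest: "openin X U \<Longrightarrow> U \<inter> elts a \<subseteq> elts b \<Longrightarrow> U \<subseteq> elts (open_exp X b a)"
  and open_exp_elim: "elts (open_exp X b a) \<inter> elts a \<subseteq> elts b"
proof -
  have *: "openin X (\<Union>{t. openin X t \<and> t \<inter> elts a \<subseteq> elts b})" by blast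
  show "openin X (elts (open_exp X b a))" unfolding open_exp_def using * by simp
  show "openin X U \<Longrightarrow> U \<inter> elts a \<subseteq> elts b \<Longrightarrow> U \<subseteq> elts (open_exp X b a)"
    unfolding open_exp_def elts_VSet_open[OF *] by blast
  show "elts (open_exp X b a) \<inter> elts a \<subseteq> elts b" unfolding open_exp_def elts_VSet_open[OF *] by blast
qed

text \<open>The corresponding rules for the universal quantifier. For an empty family the meet is
  the whole space, which contains every open \<open>U\<close>.\<close>

lemma open_meet_open: "openin X (elts (open_meet X S))"
  and open_meet_greatest: "openin X U \<Longrightarrow> (\<And>a. a \<in> S \<Longrightarrow> U \<subseteq> elts a) \<Longrightarrow> U \<subseteq> elts (open_meet X S)"
  and open_meet_lower: "a \<in> S \<Longrightarrow> elts (open_meet X S) \<subseteq> elts a"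
proof -
  have *: "openin X (if S = {} then topspace X else X interior_of (\<Inter>a\<in>S. elts a))" by simp
  show "openin X (elts (open_meet X S))" unfolding open_meet_def using * by simp
  show "openin X U \<Longrightarrow> (\<And>a. a \<in> S \<Longrightarrow> U \<subseteq> elts a) \<Longrightarrow> U \<subseteq> elts (open_meet X S)"
    unfolding open_meet_def elts_VSet_open[OF *]
    by (cases "S = {}") (simp_all add: openin_subset interior_of_maximal INT_greatest)
  show "a \<in> S \<Longrightarrow> elts (open_meet X S) \<subseteq> elts a"
    unfolding open_meet_def elts_VSet_open[OF *] using interior_of_subset[of X "\<Inter>a\<in>S. elts a"] by auto
qed

section \<open>The soundness induction\<close>

definition sound :: "ctx \<Rightarrow> tm \<Rightarrow> tm \<Rightarrow> 'v list \<Rightarrow> bool" where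
  "sound \<Gamma> t T \<gamma> \<longleftrightarrow> ctx_valid \<Gamma> \<gamma> \<and> valid \<Gamma> t \<gamma> \<and> valid \<Gamma> T \<gamma> \<and> realizes \<Gamma> t T \<gamma>"

lemma realizes_type: "\<Gamma> \<turnstile> A : s \<Longrightarrow> is_sort s \<Longrightarrow> realizes \<Gamma> A S \<gamma> \<longleftrightarrow> sem X p \<Gamma> A \<gamma> \<in> elts (sem X p \<Gamma> S \<gamma>)"
  by (simp add: realizes_def not_proof_term_type)

lemma realizes_proof: "\<Gamma> \<turnstile> t : T \<Longrightarrow> \<Gamma> \<turnstile> T : Prop \<Longrightarrow> realizes \<Gamma> t T \<gamma> \<longleftrightarrow> hyps \<Gamma> \<gamma> \<subseteq> elts (sem X p \<Gamma> T \<gamma>)"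
  and realizes_element: "\<Gamma> \<turnstile> t : T \<Longrightarrow> \<Gamma> \<turnstile> T : Type i \<Longrightarrow> realizes \<Gamma> t T \<gamma> \<longleftrightarrow> sem X p \<Gamma> t \<gamma> \<in> elts (sem X p \<Gamma> T \<gamma>)"
  using Prop_Type_disjoint by (auto simp: realizes_def proof_term_iff)

text \<open>A proof of \<open>A\<close> is only known to place \<open>hyps\<close> inside
  \<open>A\<close>, and \<open>hyps\<close> may miss \<open>p\<close>; its value \<open>p\<close> is
  admissible all the same because \<open>adm_vals\<close> does not ask for membership.\<close>

lemma sem_mem_adm_vals:
  assumes "\<Gamma> \<turnstile> v : A" "realizes \<Gamma> v A \<gamma>" shows "sem X p \<Gamma> v \<gamma> \<in> adm_vals \<Gamma> A \<gamma>"
  using assms by (auto simp: realizes_def adm_vals_def propositional_def proof_term_iff sem_proof)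

lemma sound_Cons:
  assumes "sound \<Gamma> A s \<gamma>" "\<Gamma> \<turnstile> A : s" "is_sort s" shows "ctx_valid (A # \<Gamma>) (\<alpha> # \<gamma>)"
proof -
  have "openin X (elts (sem X p \<Gamma> A \<gamma>))" if "propositional \<Gamma> A"
  proof -
    have "s = Prop" using that assms sort_Prop_iff by (auto simp: propositional_def)
    then show ?thesis
      using assms typing_wf[OF assms(2)] by (simp add: sound_def realizes_type sem_sorts mem_opens)
  qed
  then show ?thesis using assms(1) by (simp add: sound_def)
qed

lemma sound_entry:
  "wf_ctx \<Gamma> \<Longrightarrow> i < length \<Gamma> \<Longrightarrow> \<gamma> \<in> gval \<Gamma> \<Longrightarrow> ctx_valid \<Gamma> \<gamma> \<Longrightarrow>
    valid \<Gamma> (entry \<Gamma> i) \<gamma> \<and>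
    (if \<Gamma> \<turnstile> entry \<Gamma> i : Prop then hyps \<Gamma> \<gamma> \<subseteq> elts (sem X p \<Gamma> (entry \<Gamma> i) \<gamma>)
     else \<gamma> ! i \<in> elts (sem X p \<Gamma> (entry \<Gamma> i) \<gamma>))"
proof (induction \<Gamma> arbitrary: i \<gamma>)
  case (Cons A \<Gamma>)
  obtain s where A: "wf_ctx \<Gamma>" "\<Gamma> \<turnstile> A : s" "is_sort s" using Cons.prems(1) by (rule wf_ConsE)
  obtain \<alpha> \<delta> where \<gamma>: "\<gamma> = \<alpha> # \<delta>" "\<delta> \<in> gval \<Gamma>" "\<alpha> \<in> adm_vals \<Gamma> A \<delta>" using Cons.prems(3) by auto
  have weaken: "sem X p (A # \<Gamma>) (ren Suc B) (\<alpha> # \<delta>) = sem X p \<Gamma> B \<delta>"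
    "A # \<Gamma> \<turnstile> ren Suc B : Prop \<longleftrightarrow> \<Gamma> \<turnstile> B : Prop"
    "valid \<Gamma> B \<delta> \<Longrightarrow> valid (A # \<Gamma>) (ren Suc B) (\<alpha> # \<delta>)"
    if "\<Gamma> \<turnstile> B : s'" "is_sort s'" for B s'
    using that A Cons.prems(1)
    by (auto simp: Prop_ren_iff wt_ren_Suc intro: sem_weaken valid_weaken)
  show ?case
  proof (cases i)
    case 0
    then show ?thesis
      using weaken[OF A(2,3)] Cons.prems(4) \<gamma> by (auto simp: adm_vals_def propositional_def split: if_splits)
  next
    case (Suc j)
    then have j: "j < length \<Gamma>" using Cons.prems(2) by simp
    obtain s' where "is_sort s'" "\<Gamma> \<turnstile> entry \<Gamma> j : s'" using typing_entry[OF A(1) j] by blast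
    with weaken Cons.IH[OF A(1) j \<gamma>(2)] Cons.prems(4) show ?thesis
      by (auto simp: \<gamma>(1) Suc split: if_splits)
  qed
qed simp

lemma sound_Lam:
  assumes t: "A # \<Gamma> \<turnstile> t : B" and s: "\<Gamma> \<turnstile> All A B : s" "is_sort s" and ctx: "ctx_valid \<Gamma> \<gamma>"
    and val: "valid \<Gamma> (All A B) \<gamma>" and body: "\<And>\<alpha>. \<alpha> \<in> adm_vals \<Gamma> A \<gamma> \<Longrightarrow> sound (A # \<Gamma>) t B (\<alpha> # \<gamma>)"
  shows "valid \<Gamma> (Lam A t) \<gamma>" "realizes \<Gamma> (Lam A t) (All A B) \<gamma>"
proof -
  have Lam: "\<Gamma> \<turnstile> Lam A t : All A B" using t s by (rule T_Lam)
  have "valid \<Gamma> A \<gamma>" using val not_proof_term_type[OF s] by simp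
  then show "valid \<Gamma> (Lam A t) \<gamma>" using body by (simp add: sound_def)
  note H = hyps_open[OF ctx]
  have body': "realizes (A # \<Gamma>) t B (\<alpha> # \<gamma>)" if "\<alpha> \<in> adm_vals \<Gamma> A \<gamma>" for \<alpha>
    using body[OF that] by (simp add: sound_def)
  from s(1) show "realizes \<Gamma> (Lam A t) (All A B) \<gamma>"
  proof (cases rule: gen_All)
    case PP
    have "\<Gamma> \<turnstile> All A B : Prop" using PP by (blast intro: T_All_Prop_Prop)
    \<comment> \<open>\<open>p\<close> is always admissible for the proposition \<open>A\<close>, so
      the body may be used there. Its hypotheses are those of \<open>\<Gamma>\<close> intersected
      with \<open>A\<close>, which is the premise for introducing the exponential.\<close>
    moreover have "hyps \<Gamma> \<gamma> \<subseteq> elts (sem X p \<Gamma> (All A B) \<gamma>)"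
      using body'[of p] PP H
      by (auto simp: sem_PP adm_vals_Prop realizes_proof[OF t] intro!: open_exp_greatest[THEN subsetD])
    ultimately show ?thesis using Lam realizes_proof by blast
  next
    case (TP i)
    have "\<Gamma> \<turnstile> All A B : Prop" using TP by (blast intro: T_All_Type_Prop)
    \<comment> \<open>A declaration in \<open>Type i\<close> leaves \<open>hyps\<close> unchanged,
      so this open set is a lower bound of the whole family, also of an empty one.\<close>
    moreover have "hyps \<Gamma> \<gamma> \<subseteq> elts (sem X p \<Gamma> (All A B) \<gamma>)"
      unfolding sem_TP[OF TP(1,2)]
      using body' TP by (intro open_meet_greatest[OF H]) (auto simp: adm_vals_Type realizes_proof[OF t])
    ultimately show ?thesis using Lam realizes_proof by blast
  next
    case (TT i)
    have All: "\<Gamma> \<turnstile> All A B : Type i" using TT by (blast intro: T_All_Type_Type)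
    then have "\<not> proof_term \<Gamma> (Lam A t)" using Prop_Type_disjoint proof_term_iff[OF Lam] by blast
    from sem_Lam[OF TT(1) this, of X p \<gamma>]
    have "sem X p \<Gamma> (Lam A t) \<gamma> \<in> elts (sem X p \<Gamma> (All A B) \<gamma>)"
      unfolding sem_TT[OF TT(1,2)]
      using body' by (simp add: vlam_in_vPi adm_vals_Type[OF TT(1)] realizes_element[OF t TT(2)])
    then show ?thesis using Lam All realizes_element by blast
  qed
qed

lemma sound_App:
  assumes u: "\<Gamma> \<turnstile> u : All A B" and v: "\<Gamma> \<turnstile> v : A"
    and su: "sound \<Gamma> u (All A B) \<gamma>" and sv: "sound \<Gamma> v A \<gamma>"
  shows "sound \<Gamma> (App u v) (subst v 0 B) \<gamma>"
proof -
  have App: "\<Gamma> \<turnstile> App u v : subst v 0 B" using u v by (rule T_App)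
  obtain s where s: "is_sort s" "\<Gamma> \<turnstile> All A B : s" using u by (rule typing_type)
  obtain s' where B: "A # \<Gamma> \<turnstile> B : s'" using s(2) by (rule typing_All_sorts)
  note semB = sem_subst[OF B v, of X p \<gamma>]
  have dom: "sem X p \<Gamma> v \<gamma> \<in> adm_vals \<Gamma> A \<gamma>" using sv v by (simp add: sound_def sem_mem_adm_vals)
  then have "valid (A # \<Gamma>) B (sem X p \<Gamma> v \<gamma> # \<gamma>)"
    using su not_proof_term_type[OF s(2,1)] by (simp add: sound_def)
  then have "valid \<Gamma> (subst v 0 B) \<gamma>" using valid_subst[OF B v] sv by (simp add: sound_def)
  moreover from s(2) have "valid \<Gamma> (App u v) \<gamma> \<and> realizes \<Gamma> (App u v) (subst v 0 B) \<gamma>"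
  proof (cases rule: gen_All)
    case PP
    have P: "\<Gamma> \<turnstile> All A B : Prop" using PP by (blast intro: T_All_Prop_Prop)
    have Bv: "\<Gamma> \<turnstile> subst v 0 B : Prop" using typing_subst[OF PP(2) v] by simp
    have "hyps \<Gamma> \<gamma> \<subseteq> elts (open_exp X (sem X p (A # \<Gamma>) B (p # \<gamma>)) (sem X p \<Gamma> A \<gamma>))"
      using su P u PP by (simp add: sound_def realizes_proof sem_PP)
    moreover have "hyps \<Gamma> \<gamma> \<subseteq> elts (sem X p \<Gamma> A \<gamma>)"
      using sv v PP by (simp add: sound_def realizes_proof)
    ultimately have "hyps \<Gamma> \<gamma> \<subseteq> elts (sem X p (A # \<Gamma>) B (p # \<gamma>))"
      using open_exp_elim by blast
    \<comment> \<open>By \<open>dom\<close> the argument has the value \<open>p\<close>, so the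
      codomain at \<open>p\<close> is the interpretation of \<open>subst v 0 B\<close>.\<close>
    then show ?thesis
      using App Bv semB dom PP by (simp add: realizes_proof adm_vals_Prop valid_proof proof_term_iff)
  next
    case (TP i)
    have P: "\<Gamma> \<turnstile> All A B : Prop" using TP by (blast intro: T_All_Type_Prop)
    have Bv: "\<Gamma> \<turnstile> subst v 0 B : Prop" using typing_subst[OF TP(2) v] by simp
    have "hyps \<Gamma> \<gamma> \<subseteq> elts (sem X p \<Gamma> (All A B) \<gamma>)"
      using su P u by (simp add: sound_def realizes_proof)
    also have "\<dots> \<subseteq> elts (sem X p (A # \<Gamma>) B (sem X p \<Gamma> v \<gamma> # \<gamma>))"
      unfolding sem_TP[OF TP(1,2)] using dom TP(1) by (intro open_meet_lower) (simp add: adm_vals_Type)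
    finally show ?thesis
      using App Bv semB by (simp add: realizes_proof valid_proof proof_term_iff)
  next
    case (TT i)
    have P: "\<Gamma> \<turnstile> All A B : Type i" using TT by (blast intro: T_All_Type_Type)
    have Bv: "\<Gamma> \<turnstile> subst v 0 B : Type i" using typing_subst[OF TT(2) v] by simp
    have nonproof: "\<not> proof_term \<Gamma> (App u v)"
      using Bv Prop_Type_disjoint proof_term_iff[OF App] by blast
    have mem: "sem X p \<Gamma> u \<gamma> \<in> elts (sem X p \<Gamma> (All A B) \<gamma>)"
      using su P u by (simp add: sound_def realizes_element)
    \<comment> \<open>These facts serve twice: totality of the function gives the domain condition
      demanded by \<open>valid\<close>, and its value lies in the codomain.\<close>
    note mem' = is_set_elts mem[unfolded sem_TT[OF TT(1,2)]] dom[unfolded adm_vals_Type[OF TT(1)]]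
    have "valid \<Gamma> (App u v) \<gamma>" using vPi_total[OF mem'] su sv by (simp add: sound_def)
    moreover have "sem X p \<Gamma> (App u v) \<gamma> \<in> elts (sem X p \<Gamma> (subst v 0 B) \<gamma>)"
      using vapp_in_vPi[OF mem'] nonproof semB by (simp add: interp.simps(6))
    ultimately show ?thesis using App Bv realizes_element by blast
  qed
  ultimately show ?thesis using su by (simp add: sound_def)
qed

text \<open>Quantified over \<open>gval\<close> because the body of an implication is needed at
  \<open>p\<close> even where the premise does not contain \<open>p\<close>, a valuation that
  \<open>ctx_interp\<close> excludes.\<close>

lemma sound_typing:
  "wf_ctx \<Gamma> \<Longrightarrow> \<forall>\<gamma>\<in>gval \<Gamma>. ctx_valid \<Gamma> \<gamma>"
  "\<Gamma> \<turnstile> t : T \<Longrightarrow> \<forall>\<gamma>\<in>gval \<Gamma>. sound \<Gamma> t T \<gamma>"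
proof (induction rule: wf_ctx_typing.inducts)
  case wf_Nil
  show ?case by simp
next
  case (wf_Cons \<Gamma> A s)
  then show ?case using sound_Cons by fastforce
next
  case (T_Prop \<Gamma>)
  then show ?case
    using realizes_type[OF wf_ctx_typing.T_Prop[OF T_Prop(1)]] opens_mem_Guniv
    by (simp add: sound_def sem_sorts)
next
  case (T_Type \<Gamma> i)
  then show ?case
    using realizes_type[OF wf_ctx_typing.T_Type[OF T_Type(1)]] Guniv_mem[OF inf]
    by (simp add: sound_def sem_sorts)
next
  case (T_Var \<Gamma> i)
  have ty: "\<Gamma> \<turnstile> Var i : entry \<Gamma> i" using T_Var by (intro typing_Var)
  show ?case
  proof
    fix \<gamma> assume "\<gamma> \<in> gval \<Gamma>"
    then have "sound \<Gamma> (Var i) (entry \<Gamma> i) \<gamma>"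
      using sound_entry[OF T_Var.hyps] T_Var.IH proof_term_iff[OF ty]
      by (simp add: sound_def realizes_def interp.simps(3) split: if_splits)
    then show "sound \<Gamma> (Var i) (lift (Suc i) 0 (\<Gamma> ! i)) \<gamma>" by (simp add: entry_def)
  qed
next
  case (T_All_Prop_Prop \<Gamma> P Q)
  note All = wf_ctx_typing.T_All_Prop_Prop[OF T_All_Prop_Prop.hyps]
  show ?case
  proof
    fix \<gamma> assume "\<gamma> \<in> gval \<Gamma>"
    with T_All_Prop_Prop show "sound \<Gamma> (All P Q) Prop \<gamma>"
      by (auto simp: sound_def realizes_type[OF All] sem_sorts[OF typing_wf[OF All]] mem_opens sem_PP
          open_exp_open)
  qed
next
  case (T_All_Type_Prop \<Gamma> A i Q)
  note All = wf_ctx_typing.T_All_Type_Prop[OF T_All_Type_Prop.hyps]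
  show ?case
  proof
    fix \<gamma> assume "\<gamma> \<in> gval \<Gamma>"
    with T_All_Type_Prop show "sound \<Gamma> (All A Q) Prop \<gamma>"
      by (auto simp: sound_def realizes_type[OF All] sem_sorts[OF typing_wf[OF All]] mem_opens sem_TP
          open_meet_open)
  qed
next
  case (T_All_Type_Type \<Gamma> A i B)
  note All = wf_ctx_typing.T_All_Type_Type[OF T_All_Type_Type.hyps]
  note wf = typing_wf[OF All] typing_wf[OF T_All_Type_Type.hyps(2)]
  show ?case
  proof
    fix \<gamma> assume \<gamma>: "\<gamma> \<in> gval \<Gamma>"
    have A: "sound \<Gamma> A (Type i) \<gamma>" and B: "\<And>\<alpha>. \<alpha> \<in> adm_vals \<Gamma> A \<gamma> \<Longrightarrow> sound (A # \<Gamma>) B (Type i) (\<alpha> # \<gamma>)"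
      using T_All_Type_Type.IH \<gamma> by auto
    have "sem X p \<Gamma> (All A B) \<gamma> \<in> elts (Guniv i)"
      unfolding sem_TT[OF T_All_Type_Type.hyps]
      using A B T_All_Type_Type.hyps wf
      by (intro Guniv_vPi[OF inf]) (auto simp: sound_def realizes_type sem_sorts adm_vals_Type)
    then show "sound \<Gamma> (All A B) (Type i) \<gamma>"
      using A B by (simp add: sound_def realizes_type[OF All] sem_sorts wf)
  qed
next
  case (T_Lam A \<Gamma> t B s)
  show ?case
  proof
    fix \<gamma> assume \<gamma>: "\<gamma> \<in> gval \<Gamma>"
    have All: "sound \<Gamma> (All A B) s \<gamma>" and t: "\<And>\<alpha>. \<alpha> \<in> adm_vals \<Gamma> A \<gamma> \<Longrightarrow> sound (A # \<Gamma>) t B (\<alpha> # \<gamma>)"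
      using T_Lam.IH \<gamma> by auto
    then show "sound \<Gamma> (Lam A t) (All A B) \<gamma>"
      using sound_Lam[OF T_Lam.hyps(1,2) \<open>is_sort s\<close> _ _ t] by (simp add: sound_def)
  qed
next
  case (T_App \<Gamma> u A B v)
  then show ?case using sound_App by blast
next
  case (T_Cumul \<Gamma> t A A' s)
  obtain s' where A: "is_sort s'" "\<Gamma> \<turnstile> A : s'" using T_Cumul.hyps(1) by (rule typing_type)
  show ?case
  proof
    fix \<gamma> assume "\<gamma> \<in> gval \<Gamma>"
    then have t: "sound \<Gamma> t A \<gamma>" and A': "valid \<Gamma> A' \<gamma>" using T_Cumul.IH by (auto simp: sound_def)
    \<comment> \<open>Validity of \<open>A\<close> is part of the hypothesis for \<open>t\<close>;
      validity of \<open>A'\<close> comes from its own typing premise.\<close>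
    have "elts (sem X p \<Gamma> A \<gamma>) \<subseteq> elts (sem X p \<Gamma> A' \<gamma>)"
      using sem_cumul[OF \<open>A \<preceq> A'\<close> A(2) T_Cumul.hyps(2) A(1) \<open>is_sort s\<close> _ A' inf] t by (simp add: sound_def)
    then show "sound \<Gamma> t A' \<gamma>" using t A' by (auto simp: sound_def realizes_def split: if_splits)
  qed
qed

section \<open>Return to strict valuations\<close>

text \<open>A propositional entry of a strict valuation is \<open>p\<close> and also belongs to the
  proposition, so \<open>p\<close> satisfies every hypothesis; for the empty context this is
  membership in the space.\<close>

lemma ctx_interp_gval:
  "\<gamma> \<in> ctx_interp X p \<Gamma> \<Longrightarrow> p \<in> topspace X \<Longrightarrow> \<gamma> \<in> gval \<Gamma> \<and> p \<in> hyps \<Gamma> \<gamma>"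
  by (induction \<Gamma> arbitrary: \<gamma>) (auto simp: strict_def adm_vals_def split: if_splits)

text \<open>Soundness makes both terms valid, so each has the value of the common reduct.\<close>

lemma sem_beta_eq:
  assumes "t1 =\<^sub>\<beta> t2" "\<Gamma> \<turnstile> t1 : T" "\<Gamma> \<turnstile> t2 : T" "\<gamma> \<in> gval \<Gamma>"
  shows "sem X p \<Gamma> t1 \<gamma> = sem X p \<Gamma> t2 \<gamma>"
proof -
  obtain u where "t1 \<longrightarrow>\<^sub>\<beta> u" "t2 \<longrightarrow>\<^sub>\<beta> u" using assms(1) by (auto simp: beta_eq_joinable)
  then show ?thesis
    using assms(2-4) sound_typing(2)[of \<Gamma> _ T] sem_betas[of _ u \<Gamma> T \<gamma>] unfolding sound_def by metis
qed

text \<open>For a proof the value is \<open>p\<close>, and \<open>p\<close> lies in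
  \<open>hyps\<close>, which is included in the proposition; otherwise \<open>realizes\<close> is
  already the claim.\<close>

lemma sem_typing:
  assumes "\<Gamma> \<turnstile> t : T" "\<gamma> \<in> ctx_interp X p \<Gamma>" "p \<in> topspace X"
  shows "sem X p \<Gamma> t \<gamma> \<in> elts (sem X p \<Gamma> T \<gamma>)"
proof -
  have "realizes \<Gamma> t T \<gamma>" "p \<in> hyps \<Gamma> \<gamma>"
    using ctx_interp_gval[OF assms(2,3)] sound_typing(2)[OF assms(1)] by (auto simp: sound_def)
  then show ?thesis by (auto simp: realizes_def sem_proof split: if_splits)
qed

end

end

theorem theorem4:
  fixes X :: "'v::zfc topology" and p :: 'v and \<Gamma> :: ctx and \<gamma> :: "'v list"
  assumes "infinite {\<kappa>::'v. inaccessible \<kappa>}"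
    and "\<exists>x\<in>elts (Guniv 0). topspace X = elts x"
    and "p \<in> topspace X"
    and "point_condition X p"
    and "ctx_interp X p \<Gamma> \<noteq> {}"
    and "\<gamma> \<in> ctx_interp X p \<Gamma>"
  shows "(\<forall>t\<^sub>1 t\<^sub>2 T. t\<^sub>1 =\<^sub>\<beta> t\<^sub>2 \<and> (\<Gamma> \<turnstile> t\<^sub>1 : T) \<and> (\<Gamma> \<turnstile> t\<^sub>2 : T) \<longrightarrow>
            interp X p \<Gamma> t\<^sub>1 \<gamma> = interp X p \<Gamma> t\<^sub>2 \<gamma>) \<and>
         (\<forall>t T. (\<Gamma> \<turnstile> t : T) \<longrightarrow> interp X p \<Gamma> t \<gamma> \<in> elts (interp X p \<Gamma> T \<gamma>))"
  using sem_beta_eq[OF assms(1,2)] sem_typing[OF assms(1,2) _ assms(6,3)]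
    ctx_interp_gval[OF assms(1,2,6,3)] by blast

end
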